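(* Let $\Lambda$ be an odd integral lattice admitting a $2$-modularity, whose dimension is divisible by $4$ and whose oddity $o\in\mathbb{Z}/8$ is divisible by $4$. Then $\Lambda'=\sqrt{2}\,(\Lambda_0)^{*_{\{2\}}}$ is an integral lattice, and $\Lambda''=\sqrt{2}\,((\Lambda')_0)^{*_{\{2\}}}$ is an even lattice admitting a $2$-modularity which is rationally equivalent to $\Lambda$. Moreover, every modularity of $\Lambda$ is a modularity of $\Lambda''$.
   Context: An integral lattice is odd if it contains a vector of odd norm. For a $2$-integral lattice $M$, $M_0=\{u\in M: u\cdot u\in 2\mathbb{Z}_2\}$ (the even sublattice). For a set $\Pi$ of primes, the $\Pi$-dual $M^{*_\Pi}$ is the set of $v\in M\otimes\mathbb{Q}$ with $v\cdot u\in\mathbb{Z}_p$ for all $u\in M$, $p\in\Pi$, and $v\cdot u\in\mathbb{Z}_p$ for all $u\in M^*$, $p\notin\Pi$. A modularity of level $m$ (an $m$-modularity) of an integral lattice $M$ is a similarity $\sigma$ of $M\otimes\mathbb{R}$ multiplying norms by $m$ with $\sigma(M^{*_{\Pi(m)}})=M$, $\Pi(m)$ the set of primes dividing $m$; a modularity is an $m$-modularity for some $m$. The oddity is the $2$-adic invariant of Conway–Sloane, SPLAG Chapter 15. Rationally equivalent means the quadratic spaces $\Lambda\otimes\mathbb{Q}$ and $\Lambda''\otimes\mathbb{Q}$ are isometric. *)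

theory Defs
  imports "HOL-Analysis.Analysis" "HOL-Computational_Algebra.Primes"
begin

text \<open>
  Lattices are positive definite and of full rank in a Euclidean space, so that the tensor
  product of \<open>M\<close> with the reals is the whole type and the dimension of \<open>M\<close> is that of the
  type. The norm of \<open>u\<close> is \<open>u \<bullet> u\<close>, not its square root.
\<close>

definition is_lattice :: "'a::euclidean_space set \<Rightarrow> bool" where
  "is_lattice M \<longleftrightarrow>
     (\<exists>B. independent B \<and> span B = UNIV \<and>
          M = {\<Sum>b\<in>B. of_int (c b) *\<^sub>R b | c :: 'a \<Rightarrow> int. True})"

definition integral_lattice :: "'a::euclidean_space set \<Rightarrow> bool" where
  "integral_lattice M \<longleftrightarrow> is_lattice M \<and> (\<forall>u\<in>M. \<forall>v\<in>M. u \<bullet> v \<in> \<int>)"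

definition odd_lattice :: "'a::euclidean_space set \<Rightarrow> bool" where
  "odd_lattice M \<longleftrightarrow> integral_lattice M \<and> (\<exists>u\<in>M. \<exists>k::int. odd k \<and> u \<bullet> u = of_int k)"

definition even_lattice :: "'a::euclidean_space set \<Rightarrow> bool" where
  "even_lattice M \<longleftrightarrow> integral_lattice M \<and> (\<forall>u\<in>M. \<exists>k::int. even k \<and> u \<bullet> u = of_int k)"

text \<open>
  The rational \<open>p\<close>-adic integers. All inner products to which this is applied are rational, so
  the completion is not needed.
\<close>

definition padic_ints :: "nat \<Rightarrow> real set" where
  "padic_ints p = {of_int a / of_int b | a b :: int. \<not> int p dvd b}"

text \<open>
  The tensor product of \<open>M\<close> with the rationals. For an additive subgroup \<open>M\<close> this set is closed
  under addition (common denominators), hence is the rational span of \<open>M\<close>.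
\<close>

definition rational_space :: "'a::euclidean_space set \<Rightarrow> 'a set" where
  "rational_space M = {q *\<^sub>R u | q u. q \<in> \<rat> \<and> u \<in> M}"

definition dual_lattice :: "'a::euclidean_space set \<Rightarrow> 'a set" where
  "dual_lattice M = {v. \<forall>u\<in>M. v \<bullet> u \<in> \<int>}"

definition pi_dual :: "nat set \<Rightarrow> 'a::euclidean_space set \<Rightarrow> 'a set" where
  "pi_dual P M =
     {v \<in> rational_space M. \<forall>p. prime p \<longrightarrow>
        (p \<in> P \<longrightarrow> (\<forall>u\<in>M. v \<bullet> u \<in> padic_ints p)) \<and>
        (p \<notin> P \<longrightarrow> (\<forall>u\<in>dual_lattice M. v \<bullet> u \<in> padic_ints p))}"

definition even_sublattice :: "'a::euclidean_space set \<Rightarrow> 'a set" where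
  "even_sublattice M = {u \<in> M. \<exists>z\<in>padic_ints 2. u \<bullet> u = 2 * z}"

definition similarity :: "real \<Rightarrow> ('a::euclidean_space \<Rightarrow> 'a) \<Rightarrow> bool" where
  "similarity r \<sigma> \<longleftrightarrow> linear \<sigma> \<and> (\<forall>v. \<sigma> v \<bullet> \<sigma> v = r * (v \<bullet> v))"

definition m_modularity :: "nat \<Rightarrow> 'a::euclidean_space set \<Rightarrow> ('a \<Rightarrow> 'a) \<Rightarrow> bool" where
  "m_modularity m M \<sigma> \<longleftrightarrow>
     m > 0 \<and> integral_lattice M \<and> similarity (of_nat m) \<sigma> \<and>
     \<sigma> ` pi_dual {p. prime p \<and> p dvd m} M = M"

definition modularity :: "'a::euclidean_space set \<Rightarrow> ('a \<Rightarrow> 'a) \<Rightarrow> bool" where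
  "modularity M \<sigma> \<longleftrightarrow> (\<exists>m. m_modularity m M \<sigma>)"

definition rationally_equivalent ::
  "'a::euclidean_space set \<Rightarrow> 'b::euclidean_space set \<Rightarrow> bool" where
  "rationally_equivalent L M \<longleftrightarrow>
     (\<exists>f. bij_betw f (rational_space L) (rational_space M) \<and>
          (\<forall>x\<in>rational_space L. \<forall>y\<in>rational_space L. f (x + y) = f x + f y) \<and>
          (\<forall>q\<in>\<rat>. \<forall>x\<in>rational_space L. f (q *\<^sub>R x) = q *\<^sub>R f x) \<and>
          (\<forall>x\<in>rational_space L. \<forall>y\<in>rational_space L. f x \<bullet> f y = x \<bullet> y))"

text \<open>
  The oddity, or 2-signature, of Conway and Sloane (SPLAG, Chapter 15, Section 5): diagonalize
  the form over the rationals, write each diagonal entry as \<open>2 powi e * u\<close> with \<open>u\<close> a 2-adic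
  unit, add up the units modulo 8, and add 4 for each 2-adic antisquare, that is, each entry
  with \<open>e\<close> odd and \<open>u\<close> congruent to 3 or 5 modulo 8. Below, \<open>a b\<close> is an odd integer congruent
  to \<open>u\<close> modulo 8 in the 2-adic integers.
\<close>

definition rational_orthogonal_basis :: "'a::euclidean_space set \<Rightarrow> 'a set \<Rightarrow> bool" where
  "rational_orthogonal_basis M B \<longleftrightarrow>
     B \<subseteq> rational_space M \<and> pairwise orthogonal B \<and> 0 \<notin> B \<and> span B = UNIV"

definition has_oddity :: "'a::euclidean_space set \<Rightarrow> int \<Rightarrow> bool" where
  "has_oddity M k \<longleftrightarrow>
     (\<exists>B e a. rational_orthogonal_basis M B \<and>
        (\<forall>b\<in>B. odd (a b) \<and>
           (\<exists>u. b \<bullet> b = 2 powi e b * u \<and> (u - of_int (a b)) / 8 \<in> padic_ints 2)) \<and>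
        k = ((\<Sum>b\<in>B. a b) + 4 * int (card {b\<in>B. odd (e b) \<and> a b mod 8 \<in> {3, 5}})) mod 8)"

text \<open>
  The value does not depend on the diagonalization. It is a residue modulo 8, represented in
  \<open>{0..7}\<close>.
\<close>

definition oddity :: "'a::euclidean_space set \<Rightarrow> int" where
  "oddity M = (SOME k. has_oddity M k)"

end

theory Submission
  imports Defs
begin

text \<open>
  Everything happens at the prime 2. Let \<open>M\<close> be the localization of \<open>\<Lambda>\<close> at 2 and \<open>X\<close> its dual; the
  2-modularity \<open>\<sigma>\<close> gives \<open>\<sigma> X = M\<close>, hence \<open>2 X \<subseteq> M \<subseteq> X\<close>. Choose a characteristic vector \<open>t\<close> of
  \<open>M\<close> and put \<open>s = 2 \<sigma>\<^sup>-\<^sup>1 t\<close>. Splitting off lines and planes shows that the unit part of the discriminant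
  is congruent to \<open>1 - n + t \<bullet> t + (s \<bullet> s) / 2 + s \<bullet> t\<close> modulo 4 and that \<open>t \<bullet> t\<close> has the parity of the rank
  of \<open>M / 2X\<close>, which is \<open>n / 2\<close> because \<open>\<sigma>\<close> maps \<open>X / M\<close> onto \<open>M / 2X\<close>. Since modulo 4 the oddity is
  determined by the discriminant, the hypotheses say that \<open>t \<bullet> t\<close> is even and
  \<open>t \<bullet> t + (s \<bullet> s) / 2 + s \<bullet> t\<close> is divisible by 4. The first makes \<open>\<Lambda>'\<close> integral. Up to a factor 2,
  which is a unit at the odd primes, \<open>\<Lambda>''\<close> lies in the rational space of \<open>\<Lambda>\<close>, agrees with \<open>\<Lambda>\<close> at the odd
  primes, and is at 2 a neighbour \<open>M\<^sub>0 \<union> (M\<^sub>0 + g)\<close> of \<open>M\<close>; the second condition makes \<open>g \<bullet> g\<close> even.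
  The neighbour also has the same description starting from \<open>X\<close> instead of \<open>M\<close>, and
  therefore every modularity of \<open>\<Lambda>\<close> is one of \<open>\<Lambda>''\<close>.
\<close>

subsection \<open>Rational p-adic integers\<close>

text \<open>The vector \<open>t\<close> records norms in the unimodular Jordan constituent;
  \<open>s\<close> does the same in the 2-modular one, which becomes unimodular when the form is
  doubled. Modulo 4 a product of odd units is 1 plus the sum of the \<open>a - 1\<close>, and a
  diagonal unit \<open>a\<close> adds \<open>a\<close> to the expression in \<open>t\<close> and
  \<open>s\<close>; hence the constant \<open>1 - n\<close>. The term \<open>s \<bullet> t\<close>
  removes the dependence on choices: if \<open>t\<close> becomes \<open>t + 2 x\<close> with
  \<open>x\<close> in \<open>X\<close>, then modulo 4 both \<open>t \<bullet> t\<close> and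
  \<open>s \<bullet> t\<close> change by \<open>4 (x \<bullet> x)\<close>, which is even, so the
  changes cancel. The glue vector exists because \<open>2 (k \<bullet> l)\<close> is integral on the
  dual \<open>K\<close> of \<open>M\<^sub>0\<close>, so that \<open>k \<bullet> k\<close> is
  additive modulo 1 and is given by pairing with some \<open>g\<close>. The vectors of integral norm
  in \<open>K\<close> are those pairing integrally with \<open>g\<close>, and their dual is
  generated by \<open>M\<^sub>0\<close> and \<open>g\<close>. At 2, a modularity of even level maps
  \<open>X\<close> to \<open>M\<close> and \<open>M\<close> to \<open>2 X\<close>; it carries the
  construction from \<open>M\<close> to that from \<open>X\<close>, which is why the two have to
  agree.\<close>

lemma padic_ints_iff:
  assumes "prime p"
  shows "x \<in> padic_ints p \<longleftrightarrow> (\<exists>b::int. \<not> int p dvd b \<and> of_int b * x \<in> \<int>)"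
proof
  assume "x \<in> padic_ints p"
  then obtain a b :: int where "x = of_int a / of_int b" "\<not> int p dvd b"
    unfolding padic_ints_def by blast
  moreover from this have "b \<noteq> 0" by auto
  ultimately show "\<exists>b::int. \<not> int p dvd b \<and> of_int b * x \<in> \<int>"
    by (intro exI[of _ b]) auto
next
  assume "\<exists>b::int. \<not> int p dvd b \<and> of_int b * x \<in> \<int>"
  then obtain a b :: int where "\<not> int p dvd b" "of_int b * x = of_int a"
    by (auto elim: Ints_cases)
  moreover from this have "b \<noteq> 0" by auto
  ultimately have "x = of_int a / of_int b" by (simp add: field_simps)
  then show "x \<in> padic_ints p"
    unfolding padic_ints_def using \<open>\<not> int p dvd b\<close> by blast
qed

lemma padic_intsI:
  "prime p \<Longrightarrow> \<not> int p dvd b \<Longrightarrow> of_int b * x \<in> \<int> \<Longrightarrow> x \<in> padic_ints p"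
  using padic_ints_iff by blast

lemma padic_intsE:
  assumes "prime p" "x \<in> padic_ints p"
  obtains a b :: int where "\<not> int p dvd b" "of_int b * x = of_int a"
  using assms(2) unfolding padic_ints_iff[OF assms(1)] by (auto elim: Ints_cases)

lemma Z2E:
  assumes "x \<in> padic_ints 2"
  obtains a b :: int where "odd b" "of_int b * x = of_int a"
proof (rule padic_intsE[OF two_is_prime_nat assms])
  fix a b :: int
  assume "\<not> int 2 dvd b" "of_int b * x = of_int a"
  then show thesis using that[of b a] by simp
qed

lemma not_dvd_mult_int:
  assumes "prime p" "\<not> int p dvd a" "\<not> int p dvd b"
  shows "\<not> int p dvd a * b"
  using assms by (simp add: prime_dvd_mult_iff)

lemma padic_ints_of_int [simp]: "prime p \<Longrightarrow> of_int a \<in> padic_ints p"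
  by (subst padic_ints_iff) (auto intro!: exI[of _ 1] simp: not_prime_unit)

lemma padic_ints_Ints: "prime p \<Longrightarrow> x \<in> \<int> \<Longrightarrow> x \<in> padic_ints p"
  by (auto elim!: Ints_cases)

lemma padic_ints_numeral [simp]:
  assumes "prime p"
  shows "0 \<in> padic_ints p" "1 \<in> padic_ints p" "numeral n \<in> padic_ints p"
  by (rule padic_ints_Ints[OF assms], simp)+

lemma padic_ints_Rats: "x \<in> padic_ints p \<Longrightarrow> x \<in> \<rat>"
  unfolding padic_ints_def by auto

lemma padic_ints_add [intro]:
  assumes p: "prime p" and "x \<in> padic_ints p" "y \<in> padic_ints p"
  shows "x + y \<in> padic_ints p"
proof -
  obtain a b :: int where ab: "\<not> int p dvd a" "of_int a * x \<in> \<int>" "\<not> int p dvd b" "of_int b * y \<in> \<int>"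
    using assms padic_ints_iff[OF p] by blast
  have "of_int (a * b) * (x + y) = of_int b * (of_int a * x) + of_int a * (of_int b * y)"
    by (simp add: algebra_simps)
  also have "\<dots> \<in> \<int>" using ab by auto
  finally show ?thesis using not_dvd_mult_int[OF p ab(1,3)] padic_ints_iff[OF p] by blast
qed

lemma padic_ints_mult [intro]:
  assumes p: "prime p" and "x \<in> padic_ints p" "y \<in> padic_ints p"
  shows "x * y \<in> padic_ints p"
proof -
  obtain a b :: int where ab: "\<not> int p dvd a" "of_int a * x \<in> \<int>" "\<not> int p dvd b" "of_int b * y \<in> \<int>"
    using assms padic_ints_iff[OF p] by blast
  have "of_int (a * b) * (x * y) = (of_int a * x) * (of_int b * y)"
    by (simp add: algebra_simps)
  also have "\<dots> \<in> \<int>" using ab by auto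
  finally show ?thesis using not_dvd_mult_int[OF p ab(1,3)] padic_ints_iff[OF p] by blast
qed

lemma padic_ints_minus [intro]:
  assumes p: "prime p" and "x \<in> padic_ints p"
  shows "- x \<in> padic_ints p"
  using padic_ints_mult[OF p padic_ints_of_int[OF p, of "-1"] assms(2)] by simp

lemma padic_ints_diff [intro]:
  assumes p: "prime p" and "x \<in> padic_ints p" "y \<in> padic_ints p"
  shows "x - y \<in> padic_ints p"
  using padic_ints_add[OF p assms(2) padic_ints_minus[OF p assms(3)]] by simp

lemma padic_ints_power [intro]:
  "prime p \<Longrightarrow> x \<in> padic_ints p \<Longrightarrow> x ^ n \<in> padic_ints p"
  by (induction n) auto

lemma padic_ints_divide:
  assumes p: "prime p" and "\<not> int p dvd c" "of_int c * x \<in> padic_ints p"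
  shows "x \<in> padic_ints p"
proof -
  obtain b where b: "\<not> int p dvd b" "of_int b * (of_int c * x) \<in> \<int>"
    using assms padic_ints_iff by blast
  then have "of_int (b * c) * x \<in> \<int>" by (simp add: algebra_simps)
  then show ?thesis using not_dvd_mult_int[OF p b(1) assms(2)] padic_ints_iff[OF p] by blast
qed

section \<open>Local-global principle for additive subgroups\<close>

definition add_subgroup :: "'a::real_vector set \<Rightarrow> bool" where
  "add_subgroup S \<longleftrightarrow> 0 \<in> S \<and> (\<forall>u\<in>S. \<forall>v\<in>S. u - v \<in> S)"

lemma add_subgroupD:
  assumes "add_subgroup S"
  shows "0 \<in> S" "u \<in> S \<Longrightarrow> v \<in> S \<Longrightarrow> u - v \<in> S" "u \<in> S \<Longrightarrow> v \<in> S \<Longrightarrow> u + v \<in> S"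
    "u \<in> S \<Longrightarrow> of_int n *\<^sub>R u \<in> S"
proof -
  show zero: "0 \<in> S" and diff: "\<And>u v. u \<in> S \<Longrightarrow> v \<in> S \<Longrightarrow> u - v \<in> S"
    using assms by (auto simp: add_subgroup_def)
  show add: "u + v \<in> S" if "u \<in> S" "v \<in> S" for u v
    using diff[OF that(1) diff[OF zero that(2)]] by simp
  have nat: "of_nat n *\<^sub>R u \<in> S" if "u \<in> S" for n u
    by (induction n) (auto simp: zero algebra_simps intro: add that)
  show "of_int n *\<^sub>R u \<in> S" if "u \<in> S" for n u
    using nat[OF that] diff[OF zero nat[OF that]] by (cases n rule: int_cases2) auto
qed

lemma in_subgroup_if_locally:
  fixes v :: "'a::real_vector"
  assumes S: "add_subgroup S"
    and loc: "\<And>p. prime p \<Longrightarrow> \<exists>c::int. \<not> int p dvd c \<and> of_int c *\<^sub>R v \<in> S"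
  shows "v \<in> S"
proof -
  note diff = add_subgroupD(2)[OF S] and mul = add_subgroupD(4)[OF S]
  \<comment> \<open>The admissible denominators form an ideal that contains, for each prime, an element
    not divisible by it.\<close>
  define I where "I = {c::int. of_int c *\<^sub>R v \<in> S}"
  obtain c0 where c0: "\<not> int 2 dvd c0" "c0 \<in> I" using loc[of 2] by (auto simp: I_def)
  define P where "P n \<longleftrightarrow> 0 < n \<and> int n \<in> I" for n
  have neg: "-c \<in> I" if "c \<in> I" for c
    using mul[of "of_int c *\<^sub>R v" "-1"] that by (simp add: I_def)
  have "c0 \<noteq> 0" using c0(1) by auto
  then have "P (nat \<bar>c0\<bar>)" using c0 neg by (auto simp: P_def abs_if)
  then have P: "P (LEAST n. P n)" by (rule LeastI)
  define d where "d = (LEAST n. P n)"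
  have d: "d > 0" "int d \<in> I" using P by (auto simp: d_def P_def)
  have dvd: "int d dvd c" if "c \<in> I" for c
  proof -
    have "of_int (c mod int d) *\<^sub>R v = of_int c *\<^sub>R v - of_int (c div int d) *\<^sub>R (of_int (int d) *\<^sub>R v)"
      by (simp add: minus_div_mult_eq_mod[symmetric] algebra_simps)
    moreover have "of_int c *\<^sub>R v - of_int (c div int d) *\<^sub>R (of_int (int d) *\<^sub>R v) \<in> S"
      using d(2) that diff mul unfolding I_def mem_Collect_eq by blast
    ultimately have "c mod int d \<in> I" by (simp only: I_def mem_Collect_eq)
    moreover have "0 \<le> c mod int d" "c mod int d < int d" using d by auto
    ultimately have "\<not> 0 < c mod int d"
      using not_less_Least[of "nat (c mod int d)" P, folded d_def] by (auto simp: P_def)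
    then show ?thesis using \<open>0 \<le> c mod int d\<close> by auto
  qed
  have "d = 1"
  proof (rule ccontr)
    assume "d \<noteq> 1"
    then obtain p where p: "prime p" "p dvd d" using prime_factor_nat by blast
    obtain c where "\<not> int p dvd c" "c \<in> I" using loc[OF p(1)] by (auto simp: I_def)
    then show False using dvd p(2) by (meson dvd_trans of_nat_dvd_iff)
  qed
  then show ?thesis using d(2) by (simp add: I_def)
qed

lemma Ints_if_padic_ints:
  assumes "\<And>p. prime p \<Longrightarrow> x \<in> padic_ints p"
  shows "x \<in> \<int>"
  using in_subgroup_if_locally[of "\<int>" x] assms by (auto simp: padic_ints_iff add_subgroup_def)

section \<open>Parity, units and divisibility in the localization of the integers at 2\<close>

abbreviation Z2 :: "real set" where "Z2 \<equiv> padic_ints 2"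

lemma Z2I [intro, simp]:
  "of_int i \<in> Z2" "0 \<in> Z2" "1 \<in> Z2" "numeral n \<in> Z2"
  "x \<in> Z2 \<Longrightarrow> y \<in> Z2 \<Longrightarrow> x + y \<in> Z2" "x \<in> Z2 \<Longrightarrow> y \<in> Z2 \<Longrightarrow> x - y \<in> Z2"
  "x \<in> Z2 \<Longrightarrow> y \<in> Z2 \<Longrightarrow> x * y \<in> Z2" "x \<in> Z2 \<Longrightarrow> - x \<in> Z2" "x \<in> Z2 \<Longrightarrow> x ^ m \<in> Z2"
  by auto

lemma half_notin_Z2: "1 / 2 \<notin> Z2"
proof
  assume "1 / 2 \<in> Z2"
  then obtain b c :: int where b: "odd b" "of_int b * (1 / 2 :: real) = of_int c"
    by (rule Z2E)
  then have "real_of_int b = of_int (2 * c)" by simp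
  then have "b = 2 * c" by linarith
  then show False using b(1) by simp
qed

text \<open>The residue field has two elements: once an odd denominator is cleared, the parity is
  that of the numerator.\<close>

lemma Z2_parity:
  assumes "x \<in> Z2"
  obtains y where "y \<in> Z2" "x = 2 * y" | y where "y \<in> Z2" "x = 1 + 2 * y"
proof -
  obtain a b :: int where b: "odd b" "of_int b * x = of_int a"
    using assms by (rule Z2E)
  have b0: "b \<noteq> 0" using b(1) by auto
  show ?thesis
  proof (cases "even a")
    case True
    then obtain k where "a = 2 * k" by blast
    then have "of_int b * (x / 2) = of_int k" using b by simp
    then have "x / 2 \<in> Z2" using b(1) by (intro padic_intsI[of 2 b]) auto
    then show ?thesis using that(1)[of "x / 2"] by simp
  next
    case False
    then obtain k where "a - b = 2 * k" using b(1) by (metis dvdE odd_even_add even_diff)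
    then have "real_of_int a - of_int b = 2 * of_int k" by linarith
    then have "of_int b * ((x - 1) / 2) = of_int k" using b by (simp add: algebra_simps)
    then have "(x - 1) / 2 \<in> Z2" using b(1) by (intro padic_intsI[of 2 b]) auto
    then show ?thesis using that(2)[of "(x - 1) / 2"] by (simp add: field_simps)
  qed
qed

text \<open>Supplies the cancellation modulo 4 between \<open>s \<bullet> s / 2\<close> and
  \<open>s \<bullet> t\<close> when a line is split off.\<close>

lemma Z2_consecutive: "x \<in> Z2 \<Longrightarrow> x * (x + 1) / 2 \<in> Z2"
  by (erule Z2_parity) (auto simp: algebra_simps power2_eq_square add_divide_distrib)

lemma Z2_inverse:
  assumes "y \<in> Z2"
  obtains z where "z \<in> Z2" "(1 + 2 * y) * (1 + 2 * z) = 1"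
proof -
  obtain a b :: int where b: "odd b" "of_int b * y = of_int a"
    using assms by (rule Z2E)
  \<comment> \<open>With \<open>y = a / b\<close> the unit \<open>1 + 2 * y\<close> is
    \<open>c / b\<close>, so its inverse is \<open>b / c = 1 + 2 * (- a / c)\<close>.\<close>
  define c where "c = b + 2 * a"
  have c: "odd c" using b by (simp add: c_def)
  then have c0: "c \<noteq> 0" by auto
  have bc: "of_int c = of_int b * (1 + 2 * y)" using b by (simp add: c_def algebra_simps)
  have "of_int c * (- of_int a / of_int c) = (of_int (-a) :: real)" using c0 by simp
  then have "- of_int a / of_int c \<in> Z2" using c
    by (intro padic_intsI[of 2 c]) (simp_all only: two_is_prime_nat, simp_all)
  moreover have "(1 + 2 * y) * (1 + 2 * (- of_int a / of_int c)) = 1"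
  proof -
    have "1 + 2 * (- of_int a / of_int c) = (of_int c - 2 * of_int a) / (of_int c :: real)"
      using c0 by (simp add: diff_divide_distrib)
    also have "\<dots> = of_int b / of_int c" by (simp add: c_def)
    finally have "(1 + 2 * y) * (1 + 2 * (- of_int a / of_int c)) = of_int b * (1 + 2 * y) / of_int c"
      by simp
    also have "\<dots> = 1" using bc c0 by (metis divide_self of_int_eq_0_iff)
    finally show ?thesis .
  qed
  ultimately show ?thesis using that by blast
qed

lemma Z2_odd_neq_0: "y \<in> Z2 \<Longrightarrow> 1 + 2 * y \<noteq> 0"
proof
  assume "y \<in> Z2" "1 + 2 * y = 0"
  then have "y = - (1 / 2)" by simp
  then have "1/2 \<in> Z2" using \<open>y \<in> Z2\<close> Z2I(8)[of y] by simp
  then show False using half_notin_Z2 by simp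
qed

text \<open>A nonzero rational has finite 2-adic valuation. Applied to norms, this shows that a
  lattice without constituents of scale 1 and 2 is zero, where the splitting ends.\<close>

lemma Z2_infinitely_divisible:
  assumes "\<And>k. x / 2 ^ k \<in> Z2"
  shows "x = 0"
proof (rule ccontr)
  assume x: "x \<noteq> 0"
  have "x \<in> Z2" using assms[of 0] by simp
  then obtain a b :: int where b: "odd b" "of_int b * x = of_int a"
    by (rule Z2E)
  then have "a \<noteq> 0" using x by auto
  have "2 ^ k dvd a" for k
  proof -
    obtain c d :: int where c: "odd c" "of_int c * (x / 2 ^ k) = of_int d"
      using assms[of k] by (rule Z2E)
    have "real_of_int (c * a) = of_int c * (of_int b * x)" using b by simp
    also have "\<dots> = of_int b * of_int d * 2 ^ k" unfolding c(2)[symmetric] by simp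
    finally have "real_of_int (c * a) = of_int (b * d * 2 ^ k)" by simp
    then have "c * a = b * d * 2 ^ k" using of_int_eq_iff by blast
    then have "2 ^ k dvd c * a" by simp
    moreover have "coprime (2 ^ k) c" using c(1) by simp
    ultimately show ?thesis by (simp add: coprime_dvd_mult_right_iff)
  qed
  \<comment> \<open>The exponent \<open>nat \<bar>a\<bar>\<close> is large enough because
    \<open>2 ^ n > n\<close>.\<close>
  from this[of "nat \<bar>a\<bar>"] have "2 ^ nat \<bar>a\<bar> \<le> \<bar>a\<bar>" using dvd_imp_le_int[OF \<open>a \<noteq> 0\<close>] by (metis abs_of_nonneg zero_le_numeral zero_le_power)
  moreover have "int (nat \<bar>a\<bar>) < 2 ^ nat \<bar>a\<bar>"
    by (rule of_nat_less_two_power)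
  ultimately show False by simp
qed

subsection \<open>Lattices over the 2-adic integers and their duals\<close>

text \<open>A rational quadratic space realized inside the real one. Since all inner products are
  rational, Gram-Schmidt and orthogonal projections do not leave it.\<close>

definition rat_space :: "'a::euclidean_space set \<Rightarrow> bool" where
  "rat_space W \<longleftrightarrow> 0 \<in> W \<and> (\<forall>u\<in>W. \<forall>v\<in>W. u + v \<in> W \<and> u \<bullet> v \<in> \<rat>) \<and>
     (\<forall>q\<in>\<rat>. \<forall>v\<in>W. q *\<^sub>R v \<in> W)"

lemma rat_spaceD:
  assumes "rat_space W"
  shows "0 \<in> W" "u \<in> W \<Longrightarrow> v \<in> W \<Longrightarrow> u + v \<in> W" "u \<in> W \<Longrightarrow> v \<in> W \<Longrightarrow> u \<bullet> v \<in> \<rat>"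
    "q \<in> \<rat> \<Longrightarrow> v \<in> W \<Longrightarrow> q *\<^sub>R v \<in> W"
  using assms by (auto simp: rat_space_def)

lemma rat_space_diff: "rat_space W \<Longrightarrow> u \<in> W \<Longrightarrow> v \<in> W \<Longrightarrow> u - v \<in> W"
  using rat_spaceD(2)[of W u "- v"] rat_spaceD(4)[of W "-1" v] by simp

definition dual_in :: "'a::euclidean_space set \<Rightarrow> 'a set \<Rightarrow> 'a set" where
  "dual_in W S = {v \<in> W. \<forall>u\<in>S. v \<bullet> u \<in> Z2}"

lemma dual_in_closed:
  assumes "rat_space W"
  shows "0 \<in> dual_in W S"
    "u \<in> dual_in W S \<Longrightarrow> v \<in> dual_in W S \<Longrightarrow> u + v \<in> dual_in W S"
    "u \<in> dual_in W S \<Longrightarrow> v \<in> dual_in W S \<Longrightarrow> u - v \<in> dual_in W S"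
    "r \<in> Z2 \<Longrightarrow> u \<in> dual_in W S \<Longrightarrow> r *\<^sub>R u \<in> dual_in W S"
  using rat_spaceD[OF assms] rat_space_diff[OF assms] padic_ints_Rats
  by (auto simp: dual_in_def inner_add_left inner_diff_left)

text \<open>Reflexivity is part of the definition and takes the place of finite generation, so that
  summands can be split off without choosing bases. The last two clauses leave only Jordan
  constituents of scale 1 and 2.\<close>

definition dual_pair :: "'a::euclidean_space set \<Rightarrow> 'a set \<Rightarrow> 'a set \<Rightarrow> bool" where
  "dual_pair W M X \<longleftrightarrow> rat_space W \<and> X = dual_in W M \<and> M = dual_in W X \<and> M \<subseteq> X \<and>
     (\<forall>x\<in>X. 2 *\<^sub>R x \<in> M)"

lemma dual_pair_eqs:
  assumes "dual_pair W M X"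
  shows "rat_space W" "dual_in W M = X" "dual_in W X = M" "M \<subseteq> X" "\<forall>x\<in>X. 2 *\<^sub>R x \<in> M"
proof -
  note P = assms[unfolded dual_pair_def]
  show "rat_space W" by (rule conjunct1[OF P])
  show "dual_in W M = X" by (rule sym[OF conjunct1[OF conjunct2[OF P]]])
  show "dual_in W X = M" by (rule sym[OF conjunct1[OF conjunct2[OF conjunct2[OF P]]]])
  show "M \<subseteq> X" "\<forall>x\<in>X. 2 *\<^sub>R x \<in> M"
    using conjunct2[OF conjunct2[OF conjunct2[OF P]]] by auto
qed

lemma dual_pairD:
  assumes "dual_pair W M X"
  shows "rat_space W" "M \<subseteq> W" "X \<subseteq> W" "M \<subseteq> X" "x \<in> X \<Longrightarrow> 2 *\<^sub>R x \<in> M"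
    "x \<in> X \<Longrightarrow> u \<in> M \<Longrightarrow> x \<bullet> u \<in> Z2" "x \<in> X \<Longrightarrow> u \<in> M \<Longrightarrow> u \<bullet> x \<in> Z2"
    "u \<in> M \<Longrightarrow> v \<in> M \<Longrightarrow> u \<bullet> v \<in> Z2" "v \<in> W \<Longrightarrow> (\<And>x. x \<in> X \<Longrightarrow> v \<bullet> x \<in> Z2) \<Longrightarrow> v \<in> M"
    "v \<in> W \<Longrightarrow> (\<And>u. u \<in> M \<Longrightarrow> v \<bullet> u \<in> Z2) \<Longrightarrow> v \<in> X"
proof -
  note E = dual_pair_eqs[OF assms]
  have X: "v \<in> X \<longleftrightarrow> v \<in> W \<and> (\<forall>u\<in>M. v \<bullet> u \<in> Z2)"
    and M: "v \<in> M \<longleftrightarrow> v \<in> W \<and> (\<forall>u\<in>X. v \<bullet> u \<in> Z2)" for v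
    by (subst E(2,3)[symmetric], simp add: dual_in_def)+
  note W = E(1) and MX = E(4) and X2 = E(5)
  show "rat_space W" "M \<subseteq> X" "x \<in> X \<Longrightarrow> 2 *\<^sub>R x \<in> M" using W MX X2 by blast+
  show "M \<subseteq> W" using M by blast
  show "X \<subseteq> W" using X by blast
  show "x \<in> X \<Longrightarrow> u \<in> M \<Longrightarrow> x \<bullet> u \<in> Z2" using X by blast
  show "x \<in> X \<Longrightarrow> u \<in> M \<Longrightarrow> u \<bullet> x \<in> Z2" using M by blast
  show "u \<in> M \<Longrightarrow> v \<in> M \<Longrightarrow> u \<bullet> v \<in> Z2" using M MX by blast
  show "v \<in> W \<Longrightarrow> (\<And>x. x \<in> X \<Longrightarrow> v \<bullet> x \<in> Z2) \<Longrightarrow> v \<in> M" using M by blast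
  show "v \<in> W \<Longrightarrow> (\<And>u. u \<in> M \<Longrightarrow> v \<bullet> u \<in> Z2) \<Longrightarrow> v \<in> X" using X by blast
qed

lemma dual_pair_closed:
  assumes "dual_pair W M X"
  shows "0 \<in> M" "u \<in> M \<Longrightarrow> v \<in> M \<Longrightarrow> u + v \<in> M" "u \<in> M \<Longrightarrow> v \<in> M \<Longrightarrow> u - v \<in> M"
    "r \<in> Z2 \<Longrightarrow> u \<in> M \<Longrightarrow> r *\<^sub>R u \<in> M"
    "0 \<in> X" "x \<in> X \<Longrightarrow> y \<in> X \<Longrightarrow> x + y \<in> X" "x \<in> X \<Longrightarrow> y \<in> X \<Longrightarrow> x - y \<in> X"
    "r \<in> Z2 \<Longrightarrow> x \<in> X \<Longrightarrow> r *\<^sub>R x \<in> X"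
proof -
  note W = dual_pair_eqs(1)[OF assms] and X = dual_pair_eqs(2)[OF assms] and M = dual_pair_eqs(3)[OF assms]
  show "0 \<in> M" "u \<in> M \<Longrightarrow> v \<in> M \<Longrightarrow> u + v \<in> M" "u \<in> M \<Longrightarrow> v \<in> M \<Longrightarrow> u - v \<in> M"
    "r \<in> Z2 \<Longrightarrow> u \<in> M \<Longrightarrow> r *\<^sub>R u \<in> M"
    using dual_in_closed[OF W, where S = X, unfolded M] by blast+
  show "0 \<in> X" "x \<in> X \<Longrightarrow> y \<in> X \<Longrightarrow> x + y \<in> X" "x \<in> X \<Longrightarrow> y \<in> X \<Longrightarrow> x - y \<in> X"
    "r \<in> Z2 \<Longrightarrow> x \<in> X \<Longrightarrow> r *\<^sub>R x \<in> X"
    using dual_in_closed[OF W, where S = M, unfolded X] by blast+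
qed

lemma dual_pair_double:
  assumes "dual_pair W M X" "x \<in> X" "y \<in> X"
  shows "2 * (x \<bullet> y) \<in> Z2"
  using dual_pairD(7)[OF assms(1) assms(3) dual_pairD(5)[OF assms(1,2)]] by simp

text \<open>The vector \<open>t\<close> is characteristic for \<open>M\<close>, and \<open>s\<close> is characteristic for the dual \<open>X\<close>
  with its form doubled. The class of \<open>t \<bullet> t + (s \<bullet> s) / 2 + s \<bullet> t\<close> modulo 4 does not depend on the
  choice of \<open>t\<close> and \<open>s\<close>; it is the oddity modulo 4.\<close>

definition char_pair :: "'a::euclidean_space set \<Rightarrow> 'a set \<Rightarrow> 'a set \<Rightarrow> 'a \<Rightarrow> 'a \<Rightarrow> bool" where
  "char_pair W M X t s \<longleftrightarrow> dual_pair W M X \<and> t \<in> M \<and> s \<in> M \<and>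
     (\<forall>u\<in>M. (t \<bullet> u - u \<bullet> u) / 2 \<in> Z2) \<and> (\<forall>x\<in>X. (s \<bullet> x - 2 * (x \<bullet> x)) / 2 \<in> Z2)"

lemma char_pairD:
  assumes "char_pair W M X t s"
  shows "dual_pair W M X" "t \<in> M" "s \<in> M" "u \<in> M \<Longrightarrow> (t \<bullet> u - u \<bullet> u) / 2 \<in> Z2"
    "x \<in> X \<Longrightarrow> (s \<bullet> x - 2 * (x \<bullet> x)) / 2 \<in> Z2"
  using assms by (auto simp: char_pair_def)

text \<open>On \<open>M\<close> norms are already integral, so the doubled norms to which
  \<open>s\<close> is adapted are even there.\<close>

lemma char_pair_s_even:
  assumes "char_pair W M X t s" "u \<in> M"
  shows "s \<bullet> u / 2 \<in> Z2"
proof -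
  note D = dual_pairD[OF char_pairD(1)[OF assms(1)]]
  have "u \<in> X" using D(4) assms(2) by auto
  then have "(s \<bullet> u - 2 * (u \<bullet> u)) / 2 + u \<bullet> u \<in> Z2"
    using char_pairD(5)[OF assms(1)] D(8) assms(2) by blast
  then show ?thesis by (simp add: field_simps)
qed

section \<open>Orders of quotients of additive subgroups\<close>

definition index :: "'a::real_vector set \<Rightarrow> 'a set \<Rightarrow> nat" where
  "index X M = card ((\<lambda>x. {y \<in> X. y - x \<in> M}) ` X)"

lemma card_image_eqI:
  assumes "\<And>x y. x \<in> A \<Longrightarrow> y \<in> A \<Longrightarrow> f x = f y \<longleftrightarrow> g x = g y"
  shows "card (f ` A) = card (g ` A)"
proof -
  define s where "s k = (SOME x. x \<in> A \<and> f x = k)" for k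
  have s: "s (f x) \<in> A \<and> f (s (f x)) = f x" if "x \<in> A" for x
    unfolding s_def by (rule someI[of _ x]) (use that in simp)
  have g: "g (s (f x)) = g x" if "x \<in> A" for x using assms s[OF that] that by blast
  have "bij_betw (\<lambda>k. g (s k)) (f ` A) (g ` A)"
  proof (rule bij_betwI')
    fix k l assume "k \<in> f ` A" "l \<in> f ` A"
    then show "g (s k) = g (s l) \<longleftrightarrow> k = l" using g assms by auto
  next
    fix k assume "k \<in> f ` A"
    then show "g (s k) \<in> g ` A" using g by auto
  next
    fix k assume "k \<in> g ` A"
    then obtain x where "x \<in> A" "k = g (s (f x))" using g by auto
    then show "\<exists>l\<in>f ` A. k = g (s l)" by auto
  qed
  then show ?thesis by (rule bij_betw_same_card)
qed

text \<open>Any complete invariant of the cosets may be used to count them; labels such as parities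
  then replace sets of cosets.\<close>

lemma index_eq_card:
  assumes "\<And>x y. x \<in> X \<Longrightarrow> y \<in> X \<Longrightarrow> y - x \<in> M \<longleftrightarrow> f x = f y"
  shows "index X M = card (f ` X)"
proof -
  have eq: "{z \<in> X. z - x \<in> M} = {z \<in> X. z - y \<in> M} \<longleftrightarrow> f x = f y" if "x \<in> X" "y \<in> X" for x y
  proof
    assume "{z \<in> X. z - x \<in> M} = {z \<in> X. z - y \<in> M}"
    moreover have "x \<in> {z \<in> X. z - x \<in> M}" using assms[OF that(1,1)] that(1) by simp
    ultimately have "x - y \<in> M" by simp
    then show "f x = f y" using assms[OF that(2,1)] by simp
  next
    assume "f x = f y"
    then have "z - x \<in> M \<longleftrightarrow> z - y \<in> M" if "z \<in> X" for z
      using assms[OF \<open>x \<in> X\<close> that] assms[OF \<open>y \<in> X\<close> that] by simp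
    then show "{z \<in> X. z - x \<in> M} = {z \<in> X. z - y \<in> M}" by blast
  qed
  then show ?thesis unfolding index_def by (rule card_image_eqI)
qed

lemma index_linear_image:
  fixes f :: "'a::real_vector \<Rightarrow> 'b::real_vector"
  assumes lin: "linear f" and inj: "inj f"
  shows "index (f ` X) (f ` M) = index X M"
proof -
  have sub: "f y - f x \<in> f ` M \<longleftrightarrow> y - x \<in> M" for x y
    unfolding linear_diff[OF lin, symmetric] by (rule inj_image_mem_iff[OF inj])
  have img: "{y \<in> f ` X. y - f x \<in> f ` M} = f ` {y \<in> X. y - x \<in> M}" for x
  proof (intro equalityI subsetI)
    fix z assume "z \<in> {y \<in> f ` X. y - f x \<in> f ` M}"
    then obtain y where "y \<in> X" "z = f y" "f y - f x \<in> f ` M" by blast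
    then show "z \<in> f ` {y \<in> X. y - x \<in> M}" unfolding sub by blast
  next
    fix z assume "z \<in> f ` {y \<in> X. y - x \<in> M}"
    then obtain y where "y \<in> X" "z = f y" "y - x \<in> M" by blast
    then show "z \<in> {y \<in> f ` X. y - f x \<in> f ` M}" using sub by blast
  qed
  have "inj_on (\<lambda>K. f ` K) A" for A
    by (intro inj_onI) (simp add: inj_image_eq_iff[OF inj])
  then show ?thesis unfolding index_def image_image img
    unfolding image_image[of "(`) f" "\<lambda>x. {y \<in> X. y - x \<in> M}", symmetric]
    by (rule card_image)
qed

lemma index_scale:
  fixes X M :: "'a::real_vector set"
  assumes "(c::real) \<noteq> 0"
  shows "index ((*\<^sub>R) c ` X) ((*\<^sub>R) c ` M) = index X M"
  using assms by (intro index_linear_image linear_scaleR) (simp add: inj_def)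

text \<open>The label \<open>h\<close> names the coset in a split-off summand and
  \<open>\<pi>\<close> projects to the complement, so \<open>X / M\<close> becomes the product of
  \<open>H\<close> and \<open>X' / M'\<close>; by \<open>surj\<close> every pair occurs.\<close>

lemma index_split:
  fixes \<pi> :: "'a::real_vector \<Rightarrow> 'b::real_vector" and h :: "'a \<Rightarrow> 'c"
  assumes sub: "\<And>x y. x \<in> X' \<Longrightarrow> y \<in> X' \<Longrightarrow> x - y \<in> M' \<Longrightarrow> y - x \<in> M'" "0 \<in> M'"
      "\<And>x y. x \<in> M' \<Longrightarrow> y \<in> M' \<Longrightarrow> x + y \<in> M'"
    and pi: "\<And>x. x \<in> X \<Longrightarrow> \<pi> x \<in> X'" and h: "\<And>x. x \<in> X \<Longrightarrow> h x \<in> H"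
    and surj: "\<And>x' k. x' \<in> X' \<Longrightarrow> k \<in> H \<Longrightarrow> \<exists>x\<in>X. \<pi> x = x' \<and> h x = k"
    and eq: "\<And>x y. x \<in> X \<Longrightarrow> y \<in> X \<Longrightarrow> y - x \<in> M \<longleftrightarrow> h x = h y \<and> \<pi> y - \<pi> x \<in> M'"
  shows "index X M = card H * index X' M'"
proof -
  let ?C = "\<lambda>x. {y \<in> X'. y - x \<in> M'}"
  have C: "?C x = ?C y \<longleftrightarrow> y - x \<in> M'" if "x \<in> X'" "y \<in> X'" for x y
  proof
    assume "?C x = ?C y"
    moreover have "y \<in> ?C y" using that(2) sub(2) by simp
    ultimately have "y \<in> ?C x" by simp
    then show "y - x \<in> M'" by simp
  next
    assume a: "y - x \<in> M'"
    have b: "x - y \<in> M'" using sub(1)[OF that(2,1) a] .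
    have "z - x \<in> M' \<longleftrightarrow> z - y \<in> M'" for z
    proof
      assume "z - x \<in> M'"
      from sub(3)[OF this b] show "z - y \<in> M'" by simp
    next
      assume "z - y \<in> M'"
      from sub(3)[OF this a] show "z - x \<in> M'" by simp
    qed
    then show "?C x = ?C y" by blast
  qed
  have "index X M = card ((\<lambda>x. (h x, ?C (\<pi> x))) ` X)"
  proof (rule index_eq_card)
    fix x y assume xy: "x \<in> X" "y \<in> X"
    show "y - x \<in> M \<longleftrightarrow> (h x, ?C (\<pi> x)) = (h y, ?C (\<pi> y))"
      unfolding eq[OF xy] prod.inject C[OF pi[OF xy(1)] pi[OF xy(2)]] by (rule refl)
  qed
  also have "(\<lambda>x. (h x, ?C (\<pi> x))) ` X = H \<times> (?C ` X')"
  proof (intro equalityI subsetI)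
    fix k assume "k \<in> (\<lambda>x. (h x, ?C (\<pi> x))) ` X"
    then obtain x where "x \<in> X" "k = (h x, ?C (\<pi> x))" by blast
    then show "k \<in> H \<times> (?C ` X')" using pi[of x] h[of x] by blast
  next
    fix k assume "k \<in> H \<times> (?C ` X')"
    then obtain x' where x': "x' \<in> X'" "snd k = ?C x'" "fst k \<in> H" by auto
    then obtain x where "x \<in> X" "\<pi> x = x'" "h x = fst k" using surj by blast
    then have "k = (h x, ?C (\<pi> x))" using x'(2) by (intro prod_eqI) simp_all
    then show "k \<in> (\<lambda>x. (h x, ?C (\<pi> x))) ` X" using \<open>x \<in> X\<close> by blast
  qed
  also have "card \<dots> = card H * index X' M'" by (simp add: card_cartesian_product index_def)
  finally show ?thesis .
qed

text \<open>If \<open>M\<close> has unimodular Jordan component of rank \<open>q\<close> and 2-modular component of rank \<open>p\<close>,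
  then \<open>X / M\<close> and \<open>M / 2X\<close> have orders \<open>2 ^ p\<close> and \<open>2 ^ q\<close>. A unit \<open>w\<close> is congruent modulo 4
  to one plus the sum of \<open>a - 1\<close> over the unit parts \<open>a\<close> of a diagonalization.\<close>

definition discriminant_data :: "'a::euclidean_space set \<Rightarrow> 'a set \<Rightarrow> 'a set \<Rightarrow> 'a \<Rightarrow> 'a \<Rightarrow> bool" where
  "discriminant_data W M X t s \<longleftrightarrow> (\<exists>C p q k w. finite C \<and> C \<subseteq> W \<and> pairwise orthogonal C \<and> 0 \<notin> C \<and>
     W \<subseteq> span C \<and> card C = p + q \<and> (\<Prod>c\<in>C. c \<bullet> c) = 2 powi k * w \<and>
     (w - (1 - real (p + q) + (t \<bullet> t + s \<bullet> s / 2 + s \<bullet> t))) / 4 \<in> Z2 \<and>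
     (t \<bullet> t - real q) / 2 \<in> Z2 \<and> (s \<bullet> s / 2 - real p) / 2 \<in> Z2 \<and>
     index X M = 2 ^ p \<and> index M ((*\<^sub>R) 2 ` X) = 2 ^ q)"

text \<open>The projection is orthogonal, so a vector of \<open>W'\<close> pairs with
  \<open>u\<close> as it does with \<open>\<pi> u\<close>. Integrality against all of
  \<open>M\<close> or \<open>X\<close> therefore reduces to integrality against the part in
  \<open>W'\<close>.\<close>

lemma dual_pair_split:
  assumes P: "dual_pair W M X"
    and W': "\<And>w. w \<in> W' \<Longrightarrow> w \<in> W" "\<And>w. w \<in> W \<Longrightarrow> \<pi> w \<in> W'" "rat_space W'"
    and piM: "\<And>u. u \<in> M \<Longrightarrow> \<pi> u \<in> M" and piX: "\<And>u. u \<in> X \<Longrightarrow> \<pi> u \<in> X"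
    and orth: "\<And>v w. v \<in> W \<Longrightarrow> w \<in> W' \<Longrightarrow> \<pi> v \<bullet> w = v \<bullet> w"
  shows "dual_pair W' (M \<inter> W') (X \<inter> W')"
proof -
  note D = dual_pairD[OF P]
  have "v \<in> X" if v: "v \<in> W'" "\<And>u. u \<in> M \<inter> W' \<Longrightarrow> v \<bullet> u \<in> Z2" for v
  proof (rule D(10))
    show "v \<in> W" using v W' by auto
    fix u assume u: "u \<in> M"
    have "v \<bullet> \<pi> u \<in> Z2" using u D(2) W'(2) piM v(2) by auto
    then show "v \<bullet> u \<in> Z2" using orth[of u v] u D(2) v(1) by (auto simp: inner_commute)
  qed
  moreover have "v \<in> M" if v: "v \<in> W'" "\<And>u. u \<in> X \<inter> W' \<Longrightarrow> v \<bullet> u \<in> Z2" for v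
  proof (rule D(9))
    show "v \<in> W" using v W' by auto
    fix u assume u: "u \<in> X"
    have "v \<bullet> \<pi> u \<in> Z2" using u D(3) W'(2) piX v(2) by auto
    then show "v \<bullet> u \<in> Z2" using orth[of u v] u D(3) v(1) by (auto simp: inner_commute)
  qed
  moreover have "X \<inter> W' \<subseteq> dual_in W' (M \<inter> W')" "M \<inter> W' \<subseteq> dual_in W' (X \<inter> W')"
    using D(6,7) by (auto simp: dual_in_def)
  ultimately have "X \<inter> W' = dual_in W' (M \<inter> W')" "M \<inter> W' = dual_in W' (X \<inter> W')"
    by (auto simp: dual_in_def)
  moreover have "2 *\<^sub>R x \<in> M \<inter> W'" if "x \<in> X \<inter> W'" for x
    using D(5) that rat_spaceD(4)[OF W'(3), of 2] by auto
  ultimately show ?thesis unfolding dual_pair_def using D(4) W'(3) by blast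
qed

lemma char_pair_split:
  assumes P: "char_pair W M X t s"
    and W': "\<And>w. w \<in> W' \<Longrightarrow> w \<in> W" "\<And>w. w \<in> W \<Longrightarrow> \<pi> w \<in> W'" "rat_space W'"
    and piM: "\<And>u. u \<in> M \<Longrightarrow> \<pi> u \<in> M" and piX: "\<And>u. u \<in> X \<Longrightarrow> \<pi> u \<in> X"
    and orth: "\<And>v w. v \<in> W \<Longrightarrow> w \<in> W' \<Longrightarrow> \<pi> v \<bullet> w = v \<bullet> w"
  shows "char_pair W' (M \<inter> W') (X \<inter> W') (\<pi> t) (\<pi> s)"
proof -
  note C = char_pairD[OF P]
  note D = dual_pairD[OF C(1)]
  have ts: "t \<in> W" "s \<in> W" using C(2,3) D(2) by auto
  show ?thesis
    unfolding char_pair_def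
  proof (intro conjI ballI)
    show "dual_pair W' (M \<inter> W') (X \<inter> W')" by (rule dual_pair_split[OF C(1) W' piM piX orth])
    show "\<pi> t \<in> M \<inter> W'" "\<pi> s \<in> M \<inter> W'" using piM C(2,3) W'(2) ts by auto
    show "(\<pi> t \<bullet> u - u \<bullet> u) / 2 \<in> Z2" if "u \<in> M \<inter> W'" for u
      using C(4)[of u] orth[OF ts(1), of u] that by (simp only: Int_iff)
    show "(\<pi> s \<bullet> u - 2 * (u \<bullet> u)) / 2 \<in> Z2" if "u \<in> X \<inter> W'" for u
      using C(5)[of u] orth[OF ts(2), of u] that by (simp only: Int_iff)
  qed
qed

text \<open>Turns congruence modulo 2 into equality of truth values, so that booleans can label the
  classes modulo \<open>2 X\<close> of a split-off summand.\<close>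

lemma Z2_parity_eq_iff:
  assumes "a \<in> Z2" "b \<in> Z2"
  shows "(a - b) / 2 \<in> Z2 \<longleftrightarrow> (a / 2 \<in> Z2 \<longleftrightarrow> b / 2 \<in> Z2)"
proof -
  have odd: "(1 + 2 * y) / 2 \<notin> Z2" if "y \<in> Z2" for y
  proof
    assume "(1 + 2 * y) / 2 \<in> Z2"
    then have "(1 + 2 * y) / 2 - y \<in> Z2" using that by blast
    then show False using half_notin_Z2 by (simp add: field_simps)
  qed
  show ?thesis
  proof (cases rule: Z2_parity[OF assms(1)]; cases rule: Z2_parity[OF assms(2)])
    fix y z assume y: "y \<in> Z2" "a = 2 * y" and z: "z \<in> Z2" "b = 1 + 2 * z"
    have e: "(a - b) / 2 = (1 + 2 * (y - z - 1)) / 2" "a / 2 = y" "b / 2 = (1 + 2 * z) / 2"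
      using y z by (simp_all add: field_simps)
    have "(1 + 2 * (y - z - 1)) / 2 \<notin> Z2" using y z by (intro odd Z2I)
    then show ?thesis unfolding e using odd[OF z(1)] y(1) by blast
  next
    fix y z assume y: "y \<in> Z2" "a = 1 + 2 * y" and z: "z \<in> Z2" "b = 2 * z"
    have e: "(a - b) / 2 = (1 + 2 * (y - z)) / 2" "a / 2 = (1 + 2 * y) / 2" "b / 2 = z"
      using y z by (simp_all add: field_simps)
    have "(1 + 2 * (y - z)) / 2 \<notin> Z2" using y z by (intro odd Z2I)
    then show ?thesis unfolding e using odd[OF y(1)] z(1) by blast
  next
    fix y z assume y: "y \<in> Z2" "a = 2 * y" and z: "z \<in> Z2" "b = 2 * z"
    have e: "(a - b) / 2 = y - z" "a / 2 = y" "b / 2 = z"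
      using y z by (simp_all add: field_simps)
    have "y - z \<in> Z2" using y z by (intro Z2I)
    then show ?thesis unfolding e using y(1) z(1) by blast
  next
    fix y z assume y: "y \<in> Z2" "a = 1 + 2 * y" and z: "z \<in> Z2" "b = 1 + 2 * z"
    have e: "(a - b) / 2 = y - z" "a / 2 = (1 + 2 * y) / 2" "b / 2 = (1 + 2 * z) / 2"
      using y z by (simp_all add: field_simps)
    have "y - z \<in> Z2" using y z by (intro Z2I)
    then show ?thesis unfolding e using odd[OF y(1)] odd[OF z(1)] by blast
  qed
qed

text \<open>Modulo 2 the terms \<open>t \<bullet> t\<close> and \<open>s \<bullet> s / 2\<close>
  cancel \<open>q\<close> and \<open>p\<close>, and \<open>s \<bullet> t\<close> is even.\<close>

lemma discriminant_unit_odd: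
  assumes "(w - (1 - real (p + q) + (tt + ss / 2 + st))) / 4 \<in> Z2"
    "(tt - real q) / 2 \<in> Z2" "(ss / 2 - real p) / 2 \<in> Z2" "st / 2 \<in> Z2"
  shows "(w - 1) / 2 \<in> Z2"
proof -
  have "2 * ((w - (1 - real (p + q) + (tt + ss / 2 + st))) / 4) + (tt - real q) / 2 +
    (ss / 2 - real p) / 2 + st / 2 \<in> Z2"
    (is "?x \<in> _") using assms by (intro Z2I)
  also have "?x = (w - 1) / 2" by (simp add: field_simps)
  finally show ?thesis .
qed

subsection \<open>Splitting off a line\<close>

text \<open>If \<open>x - \<pi> x\<close> lies in \<open>M\<close> for all \<open>x\<close> in
  \<open>X\<close>, the split-off summand is unimodular and contributes nothing to
  \<open>X / M\<close>. Its whole rank shows up in \<open>M / 2X\<close>, where \<open>h\<close>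
  labels its classes.\<close>

lemma
  assumes P: "dual_pair W M X" and P': "dual_pair W' M' X'" and sub: "M' \<subseteq> M" "X' \<subseteq> X"
    and lin: "linear \<pi>" and piX: "\<And>x. x \<in> X \<Longrightarrow> \<pi> x \<in> X'" and piM: "\<And>u. u \<in> M \<Longrightarrow> \<pi> u \<in> M'"
    and id: "\<And>x. x \<in> X' \<Longrightarrow> \<pi> x = x"
  shows index_split_pair_upper: "(\<And>x. x \<in> X \<Longrightarrow> x - \<pi> x \<in> M) \<Longrightarrow> index X M = index X' M'"
    and index_split_pair_lower: "\<And>h H. (\<And>x. x \<in> M \<Longrightarrow> h x \<in> H) \<Longrightarrow>
      (\<And>x' k. x' \<in> M' \<Longrightarrow> k \<in> H \<Longrightarrow> \<exists>x\<in>M. \<pi> x = x' \<and> h x = k) \<Longrightarrow>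
      (\<And>x y. x \<in> M \<Longrightarrow> y \<in> M \<Longrightarrow> h x = h y \<longleftrightarrow> (y - x) - \<pi> (y - x) \<in> (*\<^sub>R) 2 ` X) \<Longrightarrow>
      index M ((*\<^sub>R) 2 ` X) = card H * index M' ((*\<^sub>R) 2 ` X')"
proof -
  note cl = dual_pair_closed[OF P] and cl' = dual_pair_closed[OF P']
  have MX': "M' \<subseteq> X'" by (rule dual_pairD(4)[OF P'])
  show "index X M = index X' M'" if a: "\<And>x. x \<in> X \<Longrightarrow> x - \<pi> x \<in> M"
  proof -
    have "index X M = card (UNIV :: unit set) * index X' M'"
    proof (rule index_split[where h = "\<lambda>_. ()" and \<pi> = \<pi>])
      show "y - x \<in> M'" if "x - y \<in> M'" for x y using cl'(3)[OF cl'(1) that] by simp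
      show "\<exists>x\<in>X. \<pi> x = x' \<and> () = k" if "x' \<in> X'" for x' k
        using that sub id by auto
      show "y - x \<in> M \<longleftrightarrow> () = () \<and> \<pi> y - \<pi> x \<in> M'" if xy: "x \<in> X" "y \<in> X" for x y
      proof -
        have "\<pi> (y - x) = \<pi> y - \<pi> x" using lin by (rule linear_diff)
        then have e: "y - x = (\<pi> y - \<pi> x) + ((y - x) - \<pi> (y - x))" by simp
        have "(y - x) - \<pi> (y - x) \<in> M" using a cl(7) xy by blast
        then show ?thesis using piM[of "y - x"] sub(1) cl(2) e \<open>\<pi> (y - x) = _\<close> by (metis subsetD)
      qed
    qed (use cl' piX in auto)
    then show ?thesis by simp
  qed
  fix h :: "'a \<Rightarrow> 'c" and H
  assume h: "\<And>x. x \<in> M \<Longrightarrow> h x \<in> H"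
    and surj: "\<And>x' k. x' \<in> M' \<Longrightarrow> k \<in> H \<Longrightarrow> \<exists>x\<in>M. \<pi> x = x' \<and> h x = k"
    and eq: "\<And>x y. x \<in> M \<Longrightarrow> y \<in> M \<Longrightarrow> h x = h y \<longleftrightarrow> (y - x) - \<pi> (y - x) \<in> (*\<^sub>R) 2 ` X"
  show "index M ((*\<^sub>R) 2 ` X) = card H * index M' ((*\<^sub>R) 2 ` X')"
  proof (rule index_split[where h = h and \<pi> = \<pi>])
    fix x y assume "x - y \<in> (*\<^sub>R) 2 ` X'"
    then obtain v where "v \<in> X'" "x - y = 2 *\<^sub>R v" by auto
    then have "y - x = 2 *\<^sub>R (0 - v)" by (simp add: algebra_simps)
    then show "y - x \<in> (*\<^sub>R) 2 ` X'" using cl'(7)[OF cl'(5) \<open>v \<in> X'\<close>] by blast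
  next
    show "0 \<in> (*\<^sub>R) 2 ` X'" using cl'(5) by (intro image_eqI[of _ _ 0]) auto
  next
    fix x y assume "x \<in> (*\<^sub>R) 2 ` X'" "y \<in> (*\<^sub>R) 2 ` X'"
    then obtain u v where "u \<in> X'" "v \<in> X'" "x = 2 *\<^sub>R u" "y = 2 *\<^sub>R v" by auto
    moreover from this have "x + y = 2 *\<^sub>R (u + v)" by (simp add: algebra_simps)
    ultimately show "x + y \<in> (*\<^sub>R) 2 ` X'" using cl'(6) by blast
  next
    fix x y assume xy: "x \<in> M" "y \<in> M"
    have d: "\<pi> (y - x) = \<pi> y - \<pi> x" using lin by (rule linear_diff)
    have s: "\<pi> (2 *\<^sub>R v) = 2 *\<^sub>R \<pi> v" for v using lin by (rule linear_scale)
    show "y - x \<in> (*\<^sub>R) 2 ` X \<longleftrightarrow> h x = h y \<and> \<pi> y - \<pi> x \<in> (*\<^sub>R) 2 ` X'"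
    proof
      assume "y - x \<in> (*\<^sub>R) 2 ` X"
      then obtain v where v: "v \<in> X" "y - x = 2 *\<^sub>R v" by auto
      have "v - \<pi> v \<in> X" using v piX sub(2) cl(7) by blast
      moreover have "(y - x) - \<pi> (y - x) = 2 *\<^sub>R (v - \<pi> v)" unfolding v s by (simp add: algebra_simps)
      ultimately have "h x = h y" using eq[OF xy] by blast
      moreover have "\<pi> y - \<pi> x = 2 *\<^sub>R \<pi> v" unfolding d[symmetric] v s ..
      ultimately show "h x = h y \<and> \<pi> y - \<pi> x \<in> (*\<^sub>R) 2 ` X'" using piX[OF v(1)] by blast
    next
      assume a: "h x = h y \<and> \<pi> y - \<pi> x \<in> (*\<^sub>R) 2 ` X'"
      then obtain v where v: "v \<in> X'" "\<pi> y - \<pi> x = 2 *\<^sub>R v" by auto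
      obtain u where u: "u \<in> X" "(y - x) - \<pi> (y - x) = 2 *\<^sub>R u" using a eq[OF xy] by auto
      have "y - x = ((y - x) - \<pi> (y - x)) + (\<pi> y - \<pi> x)" unfolding d by simp
      also have "\<dots> = 2 *\<^sub>R (u + v)" unfolding u v by (simp add: algebra_simps)
      finally show "y - x \<in> (*\<^sub>R) 2 ` X" using cl(6)[OF u(1) subsetD[OF sub(2) v(1)]] by blast
    qed
  qed (use piM h surj in auto)
qed

text \<open>Here \<open>1 + 2 * h\<close> is the norm of the vector spanning the line,
  \<open>1 + 2 * j\<close> its inverse, and \<open>tc\<close>, \<open>sc\<close> are the products of
  that vector with \<open>t\<close> and \<open>s\<close>. The line adds \<open>1 + 2 * h\<close>
  modulo 4 to the expression, because \<open>2 * \<beta> * \<beta>\<close> from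
  \<open>ss / 2\<close> and \<open>2 * \<beta>\<close> from \<open>st\<close> together give a
  multiple of 4. Multiplying an odd \<open>w\<close> by \<open>1 + 2 * h\<close> adds
  \<open>2 * h\<close> modulo 4, which matches.\<close>

lemma line_discriminant:
  assumes Z: "h \<in> Z2" "j \<in> Z2" "a \<in> Z2" "\<beta> \<in> Z2"
    and inv: "(1 + 2 * h) * (1 + 2 * j) = 1"
    and tc: "tc = 1 + 2 * h + 2 * a" and sc: "sc = 2 * \<beta>"
    and tt: "tt = tt' + tc * tc * (1 + 2 * j)" and ss: "ss = ss' + sc * sc * (1 + 2 * j)"
    and st: "st = st' + sc * tc * (1 + 2 * j)"
  shows "(w - (1 - n + (tt' + ss' / 2 + st'))) / 4 \<in> Z2 \<Longrightarrow> (w - 1) / 2 \<in> Z2 \<Longrightarrow>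
      ((1 + 2 * h) * w - (1 - (n + 1) + (tt + ss / 2 + st))) / 4 \<in> Z2"
    "(tt' - q) / 2 \<in> Z2 \<Longrightarrow> (tt - (q + 1)) / 2 \<in> Z2"
    "(ss' / 2 - p) / 2 \<in> Z2 \<Longrightarrow> (ss / 2 - p) / 2 \<in> Z2"
proof -
  define i where "i = 1 + 2 * j"
  have iZ: "i \<in> Z2" unfolding i_def using Z by (intro Z2I)
  have inv': "(1 + 2 * h) * i = 1" using inv by (simp add: i_def)
  have 1: "tc * tc * i = 1 + 2 * h + 4 * (a + a * a * i)"
    using inv' unfolding tc by algebra
  have 2: "sc * sc * i = 4 * (\<beta> * \<beta> + 2 * (\<beta> * \<beta> * j))"
    unfolding sc i_def by (simp add: algebra_simps)
  have 3: "sc * tc * i = 2 * \<beta> + 4 * (a * \<beta> * i)"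
    using inv' unfolding tc sc by algebra
  show "((1 + 2 * h) * w - (1 - (n + 1) + (tt + ss / 2 + st))) / 4 \<in> Z2"
    if w: "(w - (1 - n + (tt' + ss' / 2 + st'))) / 4 \<in> Z2" "(w - 1) / 2 \<in> Z2"
  proof -
    define z where "z = (w - (1 - n + (tt' + ss' / 2 + st'))) / 4"
    define \<omega> where "\<omega> = (w - 1) / 2"
    \<comment> \<open>This half of a product of consecutive numbers absorbs
      \<open>2 * \<beta> * \<beta> + 2 * \<beta>\<close> as \<open>4 * \<gamma>\<close>.\<close>
    define \<gamma> where "\<gamma> = \<beta> * (\<beta> + 1) / 2"
    have Z': "z \<in> Z2" "\<omega> \<in> Z2" "\<gamma> \<in> Z2"
      using w Z2_consecutive[OF Z(4)] unfolding z_def \<omega>_def \<gamma>_def by blast+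
    have g: "\<beta> * \<beta> = 2 * \<gamma> - \<beta>" by (simp add: \<gamma>_def algebra_simps)
    have wz: "w = 1 - n + (tt' + ss' / 2 + st') + 4 * z" by (simp add: z_def field_simps)
    have w\<omega>: "h * w = h + 2 * (h * \<omega>)" by (simp add: \<omega>_def field_simps)
    have "((1 + 2 * h) * w - (1 - (n + 1) + (tt + ss / 2 + st))) =
        w + 2 * (h * w) + n - (tt + ss / 2 + st)" by (simp add: algebra_simps)
    also have "\<dots> = 4 * (z + h * \<omega> - \<gamma> - (a + a * a * i + \<beta> * \<beta> * j + a * \<beta> * i))"
      unfolding w\<omega> tt ss st i_def[symmetric] 1 2 3 using wz g by argo
    finally have "((1 + 2 * h) * w - (1 - (n + 1) + (tt + ss / 2 + st))) / 4 =
        z + h * \<omega> - \<gamma> - (a + a * a * i + \<beta> * \<beta> * j + a * \<beta> * i)" by simp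
    also have "\<dots> \<in> Z2" using Z Z' iZ by (intro Z2I)
    finally show ?thesis .
  qed
  show "(tt - (q + 1)) / 2 \<in> Z2" if "(tt' - q) / 2 \<in> Z2"
  proof -
    have "(tt - (q + 1)) / 2 = (tt' - q) / 2 + h + 2 * (a + a * a * i)"
      unfolding tt i_def[symmetric] 1 by (simp add: field_simps)
    also have "\<dots> \<in> Z2" using that Z iZ by (intro Z2I)
    finally show ?thesis .
  qed
  show "(ss / 2 - p) / 2 \<in> Z2" if "(ss' / 2 - p) / 2 \<in> Z2"
  proof -
    have "(ss / 2 - p) / 2 = (ss' / 2 - p) / 2 + (\<beta> * \<beta> + 2 * (\<beta> * \<beta> * j))"
      unfolding ss i_def[symmetric] 2 by (simp add: field_simps)
    also have "\<dots> \<in> Z2" using that Z by (intro Z2I)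
    finally show ?thesis .
  qed
qed

lemma rat_space_orthogonal:
  assumes "rat_space W"
  shows "rat_space {w \<in> W. \<forall>c\<in>C. w \<bullet> c = 0}"
  using assms unfolding rat_space_def by (auto simp: inner_add_left)

text \<open>One induction step for lines and planes alike. The set \<open>B\<close> is an orthogonal
  basis of the summand over the rationals only, which even planes also admit; the arithmetic modulo
  4 and 2 is isolated in \<open>num\<close>. The summand is unimodular, so \<open>p\<close> stays
  and \<open>q\<close> grows by \<open>card B\<close>. A vector of \<open>B\<close> witnesses that
  the dimension drops.\<close>

lemma discriminant_data_split:
  fixes \<pi> :: "'a::euclidean_space \<Rightarrow> 'a"
  assumes P: "char_pair W M X t s" and lin: "linear \<pi>"
    and B: "finite B" "B \<subseteq> W" "pairwise orthogonal B" "0 \<notin> B" "B \<noteq> {}"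
    and W': "W' = {w \<in> W. \<forall>b\<in>B. w \<bullet> b = 0}"
    and piW: "\<And>w. w \<in> W \<Longrightarrow> \<pi> w \<in> W'" and id: "\<And>w. w \<in> W' \<Longrightarrow> \<pi> w = w"
    and sp: "\<And>v. v \<in> W \<Longrightarrow> v - \<pi> v \<in> span B" and comp: "\<And>x. x \<in> X \<Longrightarrow> x - \<pi> x \<in> M"
    and h: "\<And>x. x \<in> M \<Longrightarrow> h x \<in> H" "card H = 2 ^ card B"
    and surj: "\<And>x' k. x' \<in> M \<inter> W' \<Longrightarrow> k \<in> H \<Longrightarrow> \<exists>x\<in>M. \<pi> x = x' \<and> h x = k"
    and eq: "\<And>x y. x \<in> M \<Longrightarrow> y \<in> M \<Longrightarrow> h x = h y \<longleftrightarrow> (y - x) - \<pi> (y - x) \<in> (*\<^sub>R) 2 ` X"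
    and num: "\<And>w n. (w - (1 - n + (\<pi> t \<bullet> \<pi> t + \<pi> s \<bullet> \<pi> s / 2 + \<pi> s \<bullet> \<pi> t))) / 4 \<in> Z2 \<Longrightarrow> (w - 1) / 2 \<in> Z2 \<Longrightarrow>
        ((\<Prod>b\<in>B. b \<bullet> b) * w - (1 - (n + real (card B)) + (t \<bullet> t + s \<bullet> s / 2 + s \<bullet> t))) / 4 \<in> Z2"
      "\<And>q. (\<pi> t \<bullet> \<pi> t - q) / 2 \<in> Z2 \<Longrightarrow> (t \<bullet> t - (q + real (card B))) / 2 \<in> Z2"
      "\<And>p. (\<pi> s \<bullet> \<pi> s / 2 - p) / 2 \<in> Z2 \<Longrightarrow> (s \<bullet> s / 2 - p) / 2 \<in> Z2"
    and IH: "\<And>W' M' X' t' s'. char_pair W' M' X' t' s' \<Longrightarrow> W' \<subseteq> W \<Longrightarrow>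
      \<exists>c\<in>W. c \<noteq> 0 \<and> (\<forall>w\<in>W'. w \<bullet> c = 0) \<Longrightarrow> discriminant_data W' M' X' t' s'"
  shows "discriminant_data W M X t s"
proof -
  note CD = char_pairD[OF P]
  note D = dual_pairD[OF CD(1)]
  note cl = dual_pair_closed[OF CD(1)]
  have piM: "\<pi> u \<in> M" if "u \<in> M" for u
    using cl(3)[OF that comp[OF subsetD[OF D(4) that]]] by simp
  have piX: "\<pi> u \<in> X" if "u \<in> X" for u
    using cl(7)[OF that subsetD[OF D(4) comp[OF that]]] by simp
  have orth: "\<pi> v \<bullet> w = v \<bullet> w" if "v \<in> W" "w \<in> W'" for v w
  proof -
    have "orthogonal w (v - \<pi> v)"
      by (rule orthogonal_to_span[OF sp[OF that(1)]]) (use that(2) in \<open>simp add: W' orthogonal_def\<close>)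
    then show ?thesis by (simp add: orthogonal_def inner_diff_right inner_commute[of w])
  qed
  have W'W: "W' \<subseteq> W" "rat_space W'" using rat_space_orthogonal[OF D(1)] by (auto simp: W')
  have P': "char_pair W' (M \<inter> W') (X \<inter> W') (\<pi> t) (\<pi> s)"
    by (rule char_pair_split[OF P]) (use W'W piW piM piX orth in auto)
  have "discriminant_data W' (M \<inter> W') (X \<inter> W') (\<pi> t) (\<pi> s)"
  proof (rule IH[OF P' W'W(1)])
    obtain b where "b \<in> B" using B(5) by blast
    then show "\<exists>c\<in>W. c \<noteq> 0 \<and> (\<forall>w\<in>W'. w \<bullet> c = 0)" using B(2,4) by (intro bexI[of _ b]) (auto simp: W')
  qed
  then obtain C p q k w where C: "finite C" "C \<subseteq> W'" "pairwise orthogonal C" "0 \<notin> C" "W' \<subseteq> span C"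
      "card C = p + q" "(\<Prod>c\<in>C. c \<bullet> c) = 2 powi k * w"
    and w: "(w - (1 - real (p + q) + (\<pi> t \<bullet> \<pi> t + \<pi> s \<bullet> \<pi> s / 2 + \<pi> s \<bullet> \<pi> t))) / 4 \<in> Z2"
    and pq: "(\<pi> t \<bullet> \<pi> t - real q) / 2 \<in> Z2" "(\<pi> s \<bullet> \<pi> s / 2 - real p) / 2 \<in> Z2"
      "index (X \<inter> W') (M \<inter> W') = 2 ^ p" "index (M \<inter> W') ((*\<^sub>R) 2 ` (X \<inter> W')) = 2 ^ q"
    unfolding discriminant_data_def by blast
  have w1: "(w - 1) / 2 \<in> Z2"
    by (rule discriminant_unit_odd[OF w pq(1,2) char_pair_s_even[OF P' char_pairD(2)[OF P']]])
  have P1: "dual_pair W' (M \<inter> W') (X \<inter> W')" by (rule char_pairD(1)[OF P'])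
  have XW': "x \<in> X \<Longrightarrow> \<pi> x \<in> X \<inter> W'" for x using piX piW D(3) by blast
  have MW': "x \<in> M \<Longrightarrow> \<pi> x \<in> M \<inter> W'" for x using piM piW D(2) by blast
  have idX: "x \<in> X \<inter> W' \<Longrightarrow> \<pi> x = x" for x using id by blast
  note split = CD(1) P1 Int_lower1 Int_lower1 lin XW' MW' idX
  have ix: "index X M = index (X \<inter> W') (M \<inter> W')"
    by (rule index_split_pair_upper[OF split comp])
  have ix': "index M ((*\<^sub>R) 2 ` X) = card H * index (M \<inter> W') ((*\<^sub>R) 2 ` (X \<inter> W'))"
    by (rule index_split_pair_lower[OF split h(1) surj eq])
  have CB: "c \<bullet> b = 0" "b \<bullet> c = 0" if "c \<in> C" "b \<in> B" for b c
    using that C(2) by (auto simp: W' inner_commute)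
  have disj: "B \<inter> C = {}" using CB(1) B(4) by force
  show ?thesis unfolding discriminant_data_def
  proof (intro exI conjI)
    show "finite (B \<union> C)" "B \<union> C \<subseteq> W" "0 \<notin> B \<union> C" using B C W'W by auto
    show "pairwise orthogonal (B \<union> C)"
      using B(3) C(3) CB unfolding pairwise_def orthogonal_def by blast
    show "W \<subseteq> span (B \<union> C)"
    proof
      fix v assume v: "v \<in> W"
      have "\<pi> v \<in> span (B \<union> C)" "v - \<pi> v \<in> span (B \<union> C)"
        using piW[OF v] C(5) sp[OF v] span_mono[of B "B \<union> C"] span_mono[of C "B \<union> C"] by auto
      then show "v \<in> span (B \<union> C)" using span_add[of "\<pi> v" _ "v - \<pi> v"] by simp
    qed
    show "card (B \<union> C) = p + (q + card B)" using card_Un_disjoint[OF B(1) C(1) disj] C(6) by simp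
    show "(\<Prod>c\<in>B \<union> C. c \<bullet> c) = 2 powi k * ((\<Prod>b\<in>B. b \<bullet> b) * w)"
      using prod.union_disjoint[OF B(1) C(1) disj, of "\<lambda>c. c \<bullet> c"] C(7) by simp
    show "((\<Prod>b\<in>B. b \<bullet> b) * w - (1 - real (p + (q + card B)) + (t \<bullet> t + s \<bullet> s / 2 + s \<bullet> t))) / 4 \<in> Z2"
      using num(1)[OF w w1] by (simp add: algebra_simps)
    show "(t \<bullet> t - real (q + card B)) / 2 \<in> Z2" using num(2)[OF pq(1)] by simp
    show "(s \<bullet> s / 2 - real p) / 2 \<in> Z2" by (rule num(3)[OF pq(2)])
    show "index X M = 2 ^ p" using ix pq(3) by simp
    show "index M ((*\<^sub>R) 2 ` X) = 2 ^ (q + card B)" using ix' pq(4) h(2) by (simp add: power_add)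
  qed
qed

text \<open>The coefficient \<open>v \<bullet> c * i\<close> is integral even for \<open>v\<close>
  in \<open>X\<close>, since \<open>c\<close> lies in \<open>M\<close> and its norm is a unit; so
  the line splits off both lattices at once. Its two classes modulo \<open>2 X\<close> are told
  apart by the parity of this coefficient.\<close>

lemma discriminant_data_split_line:
  fixes c :: "'a::euclidean_space"
  assumes P: "char_pair W M X t s" and c: "c \<in> M" "(c \<bullet> c - 1) / 2 \<in> Z2"
    and IH: "\<And>W' M' X' t' s'. char_pair W' M' X' t' s' \<Longrightarrow> W' \<subseteq> W \<Longrightarrow>
      \<exists>c\<in>W. c \<noteq> 0 \<and> (\<forall>w\<in>W'. w \<bullet> c = 0) \<Longrightarrow> discriminant_data W' M' X' t' s'"
  shows "discriminant_data W M X t s"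
proof -
  note CD = char_pairD[OF P]
  note D = dual_pairD[OF CD(1)]
  note cl = dual_pair_closed[OF CD(1)]
  define h where "h = (c \<bullet> c - 1) / 2"
  have h: "h \<in> Z2" "c \<bullet> c = 1 + 2 * h" using c by (auto simp: h_def field_simps)
  obtain j where j: "j \<in> Z2" "(1 + 2 * h) * (1 + 2 * j) = 1" using Z2_inverse[OF h(1)] by blast
  define i where "i = 1 + 2 * j"
  have i: "i \<in> Z2" unfolding i_def using j(1) by (intro Z2I)
  have i: "i \<in> Z2" "c \<bullet> c * i = 1" using i j(2) unfolding h(2) i_def by blast+
  have cW: "c \<in> W" and cX: "c \<in> X" using c(1) D(2,4) by blast+
  have c0: "c \<noteq> 0" using i(2) by auto
  define \<pi> where "\<pi> v = v - (v \<bullet> c * i) *\<^sub>R c" for v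
  have lin: "linear \<pi>" unfolding \<pi>_def
    by (intro linearI) (auto simp: inner_add_left algebra_simps)
  have coef: "x \<bullet> c * i \<in> Z2" if "x \<in> X" for x using D(6)[OF that c(1)] i(1) by blast
  have ip: "u \<bullet> v = \<pi> u \<bullet> \<pi> v + (u \<bullet> c) * (v \<bullet> c) * i" for u v
  proof -
    have "\<pi> u \<bullet> \<pi> v = u \<bullet> v - (u \<bullet> c) * (v \<bullet> c) * i - (u \<bullet> c) * (v \<bullet> c) * i +
        (u \<bullet> c) * (v \<bullet> c) * i * (c \<bullet> c * i)"
      by (simp add: \<pi>_def inner_diff_left inner_diff_right inner_commute algebra_simps)
    then show ?thesis unfolding i(2) by simp
  qed
  define a where "a = (t \<bullet> c - c \<bullet> c) / 2"
  define \<beta> where "\<beta> = s \<bullet> c / 2"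
  have ab: "a \<in> Z2" "\<beta> \<in> Z2" "t \<bullet> c = 1 + 2 * h + 2 * a" "s \<bullet> c = 2 * \<beta>"
    using CD(4)[OF c(1)] char_pair_s_even[OF P c(1)] h(2) by (auto simp: a_def \<beta>_def field_simps)
  note L = line_discriminant[OF h(1) j(1) ab(1,2) j(2) ab(3,4)
      ip[of t t, unfolded i_def] ip[of s s, unfolded i_def] ip[of s t, unfolded i_def]]
  show ?thesis
  proof (rule discriminant_data_split[OF P lin, where B = "{c}" and h = "\<lambda>v. v \<bullet> c * i / 2 \<in> Z2" and H = UNIV
        and W' = "{w \<in> W. \<forall>b\<in>{c}. w \<bullet> b = 0}"])
    show "finite {c}" "{c} \<subseteq> W" "pairwise orthogonal {c}" "0 \<notin> {c}" "{c} \<noteq> {}"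
      using cW c0 by (auto simp: pairwise_def)
    show "card (UNIV :: bool set) = 2 ^ card {c}" by simp
    show "\<pi> w \<in> {w \<in> W. \<forall>b\<in>{c}. w \<bullet> b = 0}" if "w \<in> W" for w
    proof -
      have "w \<bullet> c * i \<in> \<rat>" using that rat_spaceD(3)[OF D(1) that cW] padic_ints_Rats[OF i(1)] by auto
      moreover have "(w - (w \<bullet> c * i) *\<^sub>R c) \<bullet> c = w \<bullet> c - w \<bullet> c * (c \<bullet> c * i)"
        by (simp add: inner_diff_left)
      ultimately show ?thesis
        using that cW rat_spaceD(4)[OF D(1)] rat_space_diff[OF D(1)] i(2) by (auto simp: \<pi>_def)
    qed
    show "\<pi> w = w" if "w \<in> {w \<in> W. \<forall>b\<in>{c}. w \<bullet> b = 0}" for w using that by (simp add: \<pi>_def)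
    show "v - \<pi> v \<in> span {c}" for v by (simp add: \<pi>_def span_scale span_base)
    show "x - \<pi> x \<in> M" if "x \<in> X" for x using cl(4)[OF coef[OF that] c(1)] by (simp add: \<pi>_def)
    show "\<exists>x\<in>M. \<pi> x = x' \<and> (x \<bullet> c * i / 2 \<in> Z2) = k" if x': "x' \<in> M \<inter> {w \<in> W. \<forall>b\<in>{c}. w \<bullet> b = 0}" for x' k
    proof -
      \<comment> \<open>Adding 0 or 1 times \<open>c\<close> produces either parity without changing
        the projection.\<close>
      define e where "e = (if k then 0 else 1 :: real)"
      have e: "e \<in> Z2" "e / 2 \<in> Z2 \<longleftrightarrow> k" using half_notin_Z2 by (auto simp: e_def)
      have "(x' + e *\<^sub>R c) \<bullet> c * i = x' \<bullet> c * i + e * (c \<bullet> c * i)" by (simp add: algebra_simps)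
      then have xc: "(x' + e *\<^sub>R c) \<bullet> c * i = e" using x' i(2) by simp
      show ?thesis
      proof (rule bexI)
        show "\<pi> (x' + e *\<^sub>R c) = x' \<and> ((x' + e *\<^sub>R c) \<bullet> c * i / 2 \<in> Z2) = k"
          unfolding xc e(2) by (simp only: \<pi>_def xc) simp
        show "x' + e *\<^sub>R c \<in> M" using x' c(1) e(1) cl(2,4) by blast
      qed
    qed
    show "(x \<bullet> c * i / 2 \<in> Z2) = (y \<bullet> c * i / 2 \<in> Z2) \<longleftrightarrow> (y - x) - \<pi> (y - x) \<in> (*\<^sub>R) 2 ` X"
      if xy: "x \<in> M" "y \<in> M" for x y
    proof -
      define d where "d = y \<bullet> c * i - x \<bullet> c * i"
      have xZ: "x \<bullet> c * i \<in> Z2" "y \<bullet> c * i \<in> Z2" using coef xy D(4) by auto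
      have e: "(y - x) - \<pi> (y - x) = d *\<^sub>R c"
        by (simp add: \<pi>_def d_def inner_diff_left algebra_simps)
      have "d / 2 \<in> Z2 \<longleftrightarrow> d *\<^sub>R c \<in> (*\<^sub>R) 2 ` X"
      proof
        assume "d / 2 \<in> Z2"
        then have "(d / 2) *\<^sub>R c \<in> X" using cX cl(8) by blast
        moreover have "d *\<^sub>R c = 2 *\<^sub>R (d / 2) *\<^sub>R c" by simp
        ultimately show "d *\<^sub>R c \<in> (*\<^sub>R) 2 ` X" by blast
      next
        assume "d *\<^sub>R c \<in> (*\<^sub>R) 2 ` X"
        then obtain v where v: "v \<in> X" "d *\<^sub>R c = 2 *\<^sub>R v" by auto
        have "d * (c \<bullet> c * i) = (d *\<^sub>R c) \<bullet> c * i" by simp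
        also have "\<dots> = 2 * (v \<bullet> c * i)" unfolding v by simp
        finally have "d / 2 = v \<bullet> c * i" using i(2) by simp
        then show "d / 2 \<in> Z2" using coef[OF v(1)] by simp
      qed
      then show ?thesis
        unfolding e using Z2_parity_eq_iff[OF xZ(2,1)] unfolding d_def by blast
    qed
    show "((\<Prod>b\<in>{c}. b \<bullet> b) * w - (1 - (n + real (card {c})) + (t \<bullet> t + s \<bullet> s / 2 + s \<bullet> t))) / 4 \<in> Z2"
      if "(w - (1 - n + (\<pi> t \<bullet> \<pi> t + \<pi> s \<bullet> \<pi> s / 2 + \<pi> s \<bullet> \<pi> t))) / 4 \<in> Z2" "(w - 1) / 2 \<in> Z2" for w n
      using L(1)[OF that] by (simp add: h(2))
    show "(t \<bullet> t - (q + real (card {c}))) / 2 \<in> Z2" if "(\<pi> t \<bullet> \<pi> t - q) / 2 \<in> Z2" for q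
      using L(2)[OF that] by simp
    show "(s \<bullet> s / 2 - p) / 2 \<in> Z2" if "(\<pi> s \<bullet> \<pi> s / 2 - p) / 2 \<in> Z2" for p
      using L(3)[OF that] .
  qed (rule refl UNIV_I IH; assumption)+
qed

subsection \<open>Splitting off a plane\<close>

text \<open>The Gram determinant is -1 modulo 4, so the unit changes sign; for odd \<open>w\<close>
  this is subtraction of 2 modulo 4, exactly the effect of raising \<open>n\<close> by 2. The plane
  changes \<open>tt\<close>, \<open>ss / 2\<close> and \<open>st\<close> only by multiples of
  4.\<close>

lemma plane_discriminant:
  assumes Z: "A \<in> Z2" "B \<in> Z2" "\<kappa> \<in> Z2" "x \<in> Z2" "y \<in> Z2" "z' \<in> Z2"
    and tt: "tt = tt' + 8 * x" and ss: "ss = ss' + 8 * y" and st: "st = st' + 4 * z'"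
  shows "(w - (1 - n + (tt' + ss' / 2 + st'))) / 4 \<in> Z2 \<Longrightarrow> (w - 1) / 2 \<in> Z2 \<Longrightarrow>
      ((2 * A * (2 * B) - (1 + 2 * \<kappa>) * (1 + 2 * \<kappa>)) * w - (1 - (n + 2) + (tt + ss / 2 + st))) / 4 \<in> Z2"
    "(tt' - q) / 2 \<in> Z2 \<Longrightarrow> (tt - (q + 2)) / 2 \<in> Z2"
    "(ss' / 2 - p) / 2 \<in> Z2 \<Longrightarrow> (ss / 2 - p) / 2 \<in> Z2"
proof -
  let ?D = "2 * A * (2 * B) - (1 + 2 * \<kappa>) * (1 + 2 * \<kappa>)"
  show "(?D * w - (1 - (n + 2) + (tt + ss / 2 + st))) / 4 \<in> Z2"
    if w: "(w - (1 - n + (tt' + ss' / 2 + st'))) / 4 \<in> Z2" "(w - 1) / 2 \<in> Z2"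
  proof -
    define z where "z = (w - (1 - n + (tt' + ss' / 2 + st'))) / 4"
    define \<omega> where "\<omega> = (w - 1) / 2"
    have Z': "z \<in> Z2" "\<omega> \<in> Z2" using w unfolding z_def \<omega>_def by blast+
    have wz: "w = 1 - n + (tt' + ss' / 2 + st') + 4 * z" by (simp add: z_def field_simps)
    have w\<omega>: "w = 1 + 2 * \<omega>" by (simp add: \<omega>_def field_simps)
    have "?D * w = 4 * ((A * B - \<kappa> - \<kappa> * \<kappa>) * w) - w" by (simp add: algebra_simps)
    then have "?D * w - (1 - (n + 2) + (tt + ss / 2 + st)) =
        4 * (z - \<omega> + (A * B - \<kappa> - \<kappa> * \<kappa>) * w - 2 * x - y - z')"
      unfolding tt ss st using wz w\<omega> by argo
    then have "(?D * w - (1 - (n + 2) + (tt + ss / 2 + st))) / 4 =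
        z - \<omega> + (A * B - \<kappa> - \<kappa> * \<kappa>) * (1 + 2 * \<omega>) - 2 * x - y - z'"
      using w\<omega> by simp
    also have "\<dots> \<in> Z2" using Z Z' by (intro Z2I)
    finally show ?thesis .
  qed
  show "(tt - (q + 2)) / 2 \<in> Z2" if "(tt' - q) / 2 \<in> Z2"
  proof -
    have "(tt - (q + 2)) / 2 = (tt' - q) / 2 + 4 * x - 1" unfolding tt by (simp add: field_simps)
    also have "\<dots> \<in> Z2" using that Z by (intro Z2I)
    finally show ?thesis .
  qed
  show "(ss / 2 - p) / 2 \<in> Z2" if "(ss' / 2 - p) / 2 \<in> Z2"
  proof -
    have "(ss / 2 - p) / 2 = (ss' / 2 - p) / 2 + 2 * y" unfolding ss by (simp add: field_simps)
    also have "\<dots> \<in> Z2" using that Z by (intro Z2I)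
    finally show ?thesis .
  qed
qed

text \<open>Two vectors of even norm with odd inner product have a unit as Gram determinant, so the
  plane they span splits off both lattices, although no vector in it has unit norm.\<close>

lemma discriminant_data_split_plane:
  fixes a b :: "'a::euclidean_space"
  assumes P: "char_pair W M X t s" and ab: "a \<in> M" "b \<in> M"
    and even: "a \<bullet> a / 2 \<in> Z2" "b \<bullet> b / 2 \<in> Z2" and odd: "(a \<bullet> b - 1) / 2 \<in> Z2"
    and IH: "\<And>W' M' X' t' s'. char_pair W' M' X' t' s' \<Longrightarrow> W' \<subseteq> W \<Longrightarrow> 
      \<exists>c\<in>W. c \<noteq> 0 \<and> (\<forall>w\<in>W'. w \<bullet> c = 0) \<Longrightarrow> discriminant_data W' M' X' t' s'"
  shows "discriminant_data W M X t s"
proof -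
  note CD = char_pairD[OF P]
  note D = dual_pairD[OF CD(1)]
  note cl = dual_pair_closed[OF CD(1)]
  define A B \<kappa> where "A = a \<bullet> a / 2" and "B = b \<bullet> b / 2" and "\<kappa> = (a \<bullet> b - 1) / 2"
  have AB: "A \<in> Z2" "B \<in> Z2" "\<kappa> \<in> Z2" using even odd by (auto simp: A_def B_def \<kappa>_def)
  have g: "a \<bullet> a = 2 * A" "b \<bullet> b = 2 * B" "a \<bullet> b = 1 + 2 * \<kappa>" "b \<bullet> a = 1 + 2 * \<kappa>"
    by (auto simp: A_def B_def \<kappa>_def inner_commute field_simps)
  define Dt where "Dt = 2 * A * (2 * B) - (1 + 2 * \<kappa>) * (1 + 2 * \<kappa>)"
  have "2 * A * B - 1 - 2 * \<kappa> - 2 * \<kappa> * \<kappa> \<in> Z2" (is "?e \<in> _") using AB by (intro Z2I)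
  moreover have Dt: "Dt = 1 + 2 * ?e" by (simp add: Dt_def algebra_simps)
  ultimately obtain j where j: "j \<in> Z2" "Dt * (1 + 2 * j) = 1" using Z2_inverse by metis
  define \<delta> where "\<delta> = 1 + 2 * j"
  have \<delta>: "\<delta> \<in> Z2" unfolding \<delta>_def using j(1) by (intro Z2I)
  have \<delta>: "\<delta> \<in> Z2" "Dt * \<delta> = 1" using \<delta> j(2) unfolding \<delta>_def by blast+
  have aW: "a \<in> W" "b \<in> W" and aX: "a \<in> X" "b \<in> X" using ab D(2,4) by blast+
  \<comment> \<open>Cramer's rule: \<open>\<alpha>\<close> and \<open>\<beta>\<close> are the
    coordinates of the projection to the plane, \<open>\<delta>\<close> being the inverse of the
    Gram determinant.\<close>
  define \<alpha> where "\<alpha> v = (v \<bullet> a * (2 * B) - v \<bullet> b * (1 + 2 * \<kappa>)) * \<delta>" for v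
  define \<beta> where "\<beta> v = (v \<bullet> b * (2 * A) - v \<bullet> a * (1 + 2 * \<kappa>)) * \<delta>" for v
  define \<pi> where "\<pi> v = v - (\<alpha> v *\<^sub>R a + \<beta> v *\<^sub>R b)" for v
  have a0: "a \<noteq> 0" using Z2_odd_neq_0[OF AB(3)] g(3) by auto
  have lin\<alpha>: "\<alpha> (u + v) = \<alpha> u + \<alpha> v" "\<alpha> (u - v) = \<alpha> u - \<alpha> v" "\<alpha> (r *\<^sub>R v) = r * \<alpha> v" for u v r
    by (auto simp: \<alpha>_def inner_add_left inner_diff_left algebra_simps)
  have lin\<beta>: "\<beta> (u + v) = \<beta> u + \<beta> v" "\<beta> (u - v) = \<beta> u - \<beta> v" "\<beta> (r *\<^sub>R v) = r * \<beta> v" for u v r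
    by (auto simp: \<beta>_def inner_add_left inner_diff_left algebra_simps)
  have lin: "linear \<pi>" unfolding \<pi>_def
    by (intro linearI) (auto simp: lin\<alpha> lin\<beta> algebra_simps)
  have \<alpha>ab: "\<alpha> a = 1" "\<alpha> b = 0" "\<beta> a = 0" "\<beta> b = 1"
    using \<delta>(2) by (auto simp: \<alpha>_def \<beta>_def g Dt_def algebra_simps)
  have pi_orth: "\<pi> v \<bullet> a = 0" "\<pi> v \<bullet> b = 0" for v
  proof -
    have "\<pi> v \<bullet> a = v \<bullet> a - v \<bullet> a * (Dt * \<delta>)"
      unfolding \<pi>_def \<alpha>_def \<beta>_def Dt_def inner_diff_left inner_add_left inner_scaleR_left g by algebra
    moreover have "\<pi> v \<bullet> b = v \<bullet> b - v \<bullet> b * (Dt * \<delta>)"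
      unfolding \<pi>_def \<alpha>_def \<beta>_def Dt_def inner_diff_left inner_add_left inner_scaleR_left g by algebra
    ultimately show "\<pi> v \<bullet> a = 0" "\<pi> v \<bullet> b = 0" using \<delta>(2) by auto
  qed
  have coef: "\<alpha> x \<in> Z2" "\<beta> x \<in> Z2" if "x \<in> X" for x
    using D(6)[OF that ab(1)] D(6)[OF that ab(2)] \<delta>(1) AB unfolding \<alpha>_def \<beta>_def by (auto intro!: Z2I)
  have dec: "v = \<pi> v + (\<alpha> v *\<^sub>R a + \<beta> v *\<^sub>R b)" for v by (simp add: \<pi>_def)
  have ip: "u \<bullet> v = \<pi> u \<bullet> \<pi> v + (\<alpha> u * \<alpha> v * (2 * A) + (\<alpha> u * \<beta> v + \<beta> u * \<alpha> v) * (1 + 2 * \<kappa>) +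
      \<beta> u * \<beta> v * (2 * B))" for u v
    by (subst dec[of u], subst dec[of v])
       (simp add: inner_add_left inner_add_right pi_orth inner_commute[of a "\<pi> v"]
         inner_commute[of b "\<pi> v"] g algebra_simps)
  have even_coef: "\<alpha> v / 2 \<in> Z2 \<and> \<beta> v / 2 \<in> Z2" if "v \<bullet> a / 2 \<in> Z2" "v \<bullet> b / 2 \<in> Z2" for v
  proof -
    have "(v \<bullet> a / 2 * (2 * B) - v \<bullet> b / 2 * (1 + 2 * \<kappa>)) * \<delta> \<in> Z2"
      "(v \<bullet> b / 2 * (2 * A) - v \<bullet> a / 2 * (1 + 2 * \<kappa>)) * \<delta> \<in> Z2"
      using that AB \<delta>(1) by (intro Z2I; simp)+
    then show ?thesis unfolding \<alpha>_def \<beta>_def by (simp add: algebra_simps diff_divide_distrib add_divide_distrib)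
  qed
  \<comment> \<open>On vectors of even norm a characteristic vector has even products. Hence both
    coordinates of \<open>t\<close> in the plane are even, as are those of \<open>s\<close>; this is
    the source of the factors 8 and 4 below.\<close>
  have t_even: "t \<bullet> a / 2 \<in> Z2" "t \<bullet> b / 2 \<in> Z2"
  proof -
    have "(t \<bullet> a - a \<bullet> a) / 2 + a \<bullet> a / 2 \<in> Z2" "(t \<bullet> b - b \<bullet> b) / 2 + b \<bullet> b / 2 \<in> Z2"
      using CD(4)[OF ab(1)] CD(4)[OF ab(2)] even by blast+
    then show "t \<bullet> a / 2 \<in> Z2" "t \<bullet> b / 2 \<in> Z2" by (simp_all add: diff_divide_distrib)
  qed
  define t1 t2 s1 s2 where "t1 = \<alpha> t / 2" and "t2 = \<beta> t / 2" and "s1 = \<alpha> s / 2" and "s2 = \<beta> s / 2"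
  have ts: "t1 \<in> Z2" "t2 \<in> Z2" "s1 \<in> Z2" "s2 \<in> Z2"
    using even_coef[OF t_even] even_coef[OF char_pair_s_even[OF P ab(1)] char_pair_s_even[OF P ab(2)]]
    by (auto simp: t1_def t2_def s1_def s2_def)
  have ts': "\<alpha> t = 2 * t1" "\<beta> t = 2 * t2" "\<alpha> s = 2 * s1" "\<beta> s = 2 * s2"
    by (auto simp: t1_def t2_def s1_def s2_def)
  have tt: "t \<bullet> t = \<pi> t \<bullet> \<pi> t + 8 * (t1 * t1 * A + t1 * t2 * (1 + 2 * \<kappa>) + t2 * t2 * B)"
    using ip[of t t] unfolding ts' by (simp add: algebra_simps)
  have ss: "s \<bullet> s = \<pi> s \<bullet> \<pi> s + 8 * (s1 * s1 * A + s1 * s2 * (1 + 2 * \<kappa>) + s2 * s2 * B)"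
    using ip[of s s] unfolding ts' by (simp add: algebra_simps)
  have st: "s \<bullet> t = \<pi> s \<bullet> \<pi> t + 4 * (s1 * t1 * (2 * A) + (s1 * t2 + s2 * t1) * (1 + 2 * \<kappa>) + s2 * t2 * (2 * B))"
    using ip[of s t] unfolding ts' by (simp add: algebra_simps)
  have xyz: "t1 * t1 * A + t1 * t2 * (1 + 2 * \<kappa>) + t2 * t2 * B \<in> Z2"
     "s1 * s1 * A + s1 * s2 * (1 + 2 * \<kappa>) + s2 * s2 * B \<in> Z2"
     "s1 * t1 * (2 * A) + (s1 * t2 + s2 * t1) * (1 + 2 * \<kappa>) + s2 * t2 * (2 * B) \<in> Z2"
    using ts AB by (intro Z2I; simp)+
  note L = plane_discriminant[OF AB xyz tt ss st]
  \<comment> \<open>Gram-Schmidt over the rationals. The coefficient has an even denominator, but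
    only an orthogonal basis of the rational plane is wanted, and the norms still multiply to the
    Gram determinant.\<close>
  define b' where "b' = b - ((1 + 2 * \<kappa>) / (2 * A)) *\<^sub>R a"
  have A0: "2 * A \<noteq> 0" using a0 g(1) by (metis inner_eq_zero_iff)
  have b'a: "b' \<bullet> a = 0" using A0 by (simp add: b'_def inner_diff_left g)
  have b'b: "b' \<bullet> b' = 2 * B - (1 + 2 * \<kappa>) * (1 + 2 * \<kappa>) / (2 * A)"
  proof -
    have "b' \<bullet> b' = b' \<bullet> b" using b'a by (subst (2) b'_def) (simp add: inner_diff_right)
    also have "\<dots> = 2 * B - (1 + 2 * \<kappa>) * (1 + 2 * \<kappa>) / (2 * A)"
      by (simp add: b'_def inner_diff_left g)
    finally show ?thesis .
  qed
  have nn: "(a \<bullet> a) * (b' \<bullet> b') = Dt" unfolding b'b g Dt_def using A0 by (simp add: field_simps)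
  have b'0: "b' \<noteq> 0" using nn \<delta>(2) by auto
  have b'W: "b' \<in> W"
  proof -
    have "(1 + 2 * \<kappa>) / (2 * A) \<in> \<rat>" using AB padic_ints_Rats by (auto intro!: Rats_divide Rats_add Rats_mult)
    then show ?thesis unfolding b'_def using aW rat_spaceD(4)[OF D(1)] rat_space_diff[OF D(1)] by blast
  qed
  have ab': "a \<noteq> b'" "a \<bullet> b' = 0" using b'a b'0 by (auto simp: inner_commute)
  define W' where "W' = {w \<in> W. \<forall>x\<in>{a, b'}. w \<bullet> x = 0}"
  have bb': "b = b' + ((1 + 2 * \<kappa>) / (2 * A)) *\<^sub>R a" by (simp add: b'_def)
  have sp: "a \<in> span {a, b'}" "b \<in> span {a, b'}"
    by (simp_all add: bb' span_base span_add span_scale)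
  have W'ab: "w \<bullet> a = 0" "w \<bullet> b = 0" if "w \<in> W'" for w
    using that by (simp_all add: W'_def bb' inner_add_right)
  have \<alpha>W': "\<alpha> x = 0" "\<beta> x = 0" if "x \<in> W'" for x using W'ab[OF that] by (simp_all add: \<alpha>_def \<beta>_def)
  have card2: "card {a, b'} = 2" using ab'(1) by simp
  have prod2: "(\<Prod>x\<in>{a, b'}. x \<bullet> x) = 2 * A * (2 * B) - (1 + 2 * \<kappa>) * (1 + 2 * \<kappa>)"
    using nn ab'(1) by (simp add: Dt_def)
  show ?thesis
  proof (rule discriminant_data_split[OF P lin, where B = "{a, b'}" and W' = W'
        and h = "\<lambda>v. (\<alpha> v / 2 \<in> Z2, \<beta> v / 2 \<in> Z2)" and H = UNIV])
    show "finite {a, b'}" "{a, b'} \<subseteq> W" "0 \<notin> {a, b'}" "{a, b'} \<noteq> {}" using aW b'W a0 b'0 by auto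
    show "pairwise orthogonal {a, b'}" using ab'(2) b'a by (simp add: pairwise_insert orthogonal_def)
    show "W' = {w \<in> W. \<forall>x\<in>{a, b'}. w \<bullet> x = 0}" by (rule W'_def)
    show "card (UNIV :: (bool \<times> bool) set) = 2 ^ card {a, b'}" unfolding card2 by (simp add: card_UNIV_bool card_prod)
    show "\<pi> w \<in> W'" if "w \<in> W" for w
    proof -
      have "w \<bullet> a \<in> \<rat>" "w \<bullet> b \<in> \<rat>" using that rat_spaceD(3)[OF D(1) that] aW by auto
      moreover have "A \<in> \<rat>" "B \<in> \<rat>" "\<kappa> \<in> \<rat>" "\<delta> \<in> \<rat>" using AB \<delta> padic_ints_Rats by auto
      ultimately have "\<alpha> w \<in> \<rat>" "\<beta> w \<in> \<rat>" unfolding \<alpha>_def \<beta>_def by auto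
      then have "\<pi> w \<in> W" unfolding \<pi>_def
        using that aW rat_spaceD(2,4)[OF D(1)] rat_space_diff[OF D(1)] by auto
      then show ?thesis using pi_orth[of w] by (simp add: W'_def b'_def inner_diff_right)
    qed
    show "\<pi> w = w" if "w \<in> W'" for w using \<alpha>W'[OF that] by (simp add: \<pi>_def)
    show "v - \<pi> v \<in> span {a, b'}" for v using sp by (simp add: \<pi>_def span_add span_scale)
    show "x - \<pi> x \<in> M" if "x \<in> X" for x
      using cl(2)[OF cl(4)[OF coef(1)[OF that] ab(1)] cl(4)[OF coef(2)[OF that] ab(2)]] by (simp add: \<pi>_def add.commute)
    show "\<exists>x\<in>M. \<pi> x = x' \<and> (\<alpha> x / 2 \<in> Z2, \<beta> x / 2 \<in> Z2) = k" if x': "x' \<in> M \<inter> W'" for x' k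
    proof -
      define e f where "e = (if fst k then 0 else 1 :: real)" and "f = (if snd k then 0 else 1 :: real)"
      have e: "e \<in> Z2" "e / 2 \<in> Z2 \<longleftrightarrow> fst k" "f \<in> Z2" "f / 2 \<in> Z2 \<longleftrightarrow> snd k"
        using half_notin_Z2 by (auto simp: e_def f_def)
      let ?x = "x' + (e *\<^sub>R a + f *\<^sub>R b)"
      have "?x \<in> M" using x' by (intro cl(2) cl(4) e ab) blast
      moreover have \<alpha>x: "\<alpha> ?x = e" "\<beta> ?x = f" using \<alpha>W'[of x'] x' by (auto simp: lin\<alpha> lin\<beta> \<alpha>ab)
      moreover have "\<pi> ?x = x'" by (simp only: \<pi>_def \<alpha>x) simp
      ultimately show ?thesis
        using e(2,4) by (intro bexI[of _ ?x]) (auto simp: prod_eq_iff)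
    qed
    show "(\<alpha> x / 2 \<in> Z2, \<beta> x / 2 \<in> Z2) = (\<alpha> y / 2 \<in> Z2, \<beta> y / 2 \<in> Z2) \<longleftrightarrow>
        (y - x) - \<pi> (y - x) \<in> (*\<^sub>R) 2 ` X" if xy: "x \<in> M" "y \<in> M" for x y
    proof -
      have xZ: "\<alpha> x \<in> Z2" "\<alpha> y \<in> Z2" "\<beta> x \<in> Z2" "\<beta> y \<in> Z2" using coef xy D(4) by auto
      define d f where "d = \<alpha> y - \<alpha> x" and "f = \<beta> y - \<beta> x"
      have e: "(y - x) - \<pi> (y - x) = d *\<^sub>R a + f *\<^sub>R b"
        by (simp add: \<pi>_def d_def f_def lin\<alpha> lin\<beta>)
      have "d / 2 \<in> Z2 \<and> f / 2 \<in> Z2 \<longleftrightarrow> d *\<^sub>R a + f *\<^sub>R b \<in> (*\<^sub>R) 2 ` X"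
      proof
        assume "d / 2 \<in> Z2 \<and> f / 2 \<in> Z2"
        then have "(d / 2) *\<^sub>R a + (f / 2) *\<^sub>R b \<in> X" by (intro cl(6) cl(8) aX) blast+
        moreover have "d *\<^sub>R a + f *\<^sub>R b = 2 *\<^sub>R ((d / 2) *\<^sub>R a + (f / 2) *\<^sub>R b)"
          by (simp add: scaleR_add_right)
        ultimately show "d *\<^sub>R a + f *\<^sub>R b \<in> (*\<^sub>R) 2 ` X" by blast
      next
        assume "d *\<^sub>R a + f *\<^sub>R b \<in> (*\<^sub>R) 2 ` X"
        then obtain v where v: "v \<in> X" "d *\<^sub>R a + f *\<^sub>R b = 2 *\<^sub>R v" by auto
        have "d = \<alpha> (d *\<^sub>R a + f *\<^sub>R b)" "f = \<beta> (d *\<^sub>R a + f *\<^sub>R b)" by (auto simp: lin\<alpha> lin\<beta> \<alpha>ab)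
        then have "d = 2 * \<alpha> v" "f = 2 * \<beta> v" unfolding v by (auto simp: lin\<alpha> lin\<beta>)
        then show "d / 2 \<in> Z2 \<and> f / 2 \<in> Z2" using coef[OF v(1)] by simp
      qed
      then show ?thesis
        unfolding e using Z2_parity_eq_iff[OF xZ(2,1)] Z2_parity_eq_iff[OF xZ(4,3)]
        unfolding d_def f_def prod.inject by blast
    qed
    show "((\<Prod>x\<in>{a, b'}. x \<bullet> x) * w - (1 - (n + real (card {a, b'})) + (t \<bullet> t + s \<bullet> s / 2 + s \<bullet> t))) / 4 \<in> Z2"
      if "(w - (1 - n + (\<pi> t \<bullet> \<pi> t + \<pi> s \<bullet> \<pi> s / 2 + \<pi> s \<bullet> \<pi> t))) / 4 \<in> Z2" "(w - 1) / 2 \<in> Z2" for w n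
      unfolding prod2 card2 using L(1)[OF that] by simp
    show "(t \<bullet> t - (q + real (card {a, b'}))) / 2 \<in> Z2" if "(\<pi> t \<bullet> \<pi> t - q) / 2 \<in> Z2" for q
      unfolding card2 using L(2)[OF that] by simp
    show "(s \<bullet> s / 2 - p) / 2 \<in> Z2" if "(\<pi> s \<bullet> \<pi> s / 2 - p) / 2 \<in> Z2" for p
      using L(3)[OF that] .
  qed (rule UNIV_I IH; assumption)+
qed

subsection \<open>Rescaled duality and the discriminant modulo 4\<close>

lemma dual_inI: "v \<in> W \<Longrightarrow> (\<And>u. u \<in> S \<Longrightarrow> v \<bullet> u \<in> Z2) \<Longrightarrow> v \<in> dual_in W S"
  by (auto simp: dual_in_def)

lemma dual_inD: "v \<in> dual_in W S \<Longrightarrow> v \<in> W" "v \<in> dual_in W S \<Longrightarrow> u \<in> S \<Longrightarrow> v \<bullet> u \<in> Z2"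
  by (auto simp: dual_in_def)

text \<open>Multiplying vectors by \<open>sqrt 2\<close> doubles the form, which makes
  \<open>X\<close> integral and its 2-modular constituent unimodular. Up to scaling,
  \<open>t\<close> and \<open>s\<close> change places, and
  \<open>t \<bullet> t + s \<bullet> s / 2 + s \<bullet> t\<close> keeps its value. The space is
  scaled as well because \<open>sqrt 2\<close> is irrational.\<close>

lemma char_pair_dual:
  fixes M X :: "'a::euclidean_space set"
  assumes P: "char_pair W M X t s" and r: "r = sqrt 2"
  shows "char_pair ((*\<^sub>R) r ` W) ((*\<^sub>R) r ` X) ((*\<^sub>R) (1 / r) ` M) ((1 / r) *\<^sub>R s) (r *\<^sub>R t)"
proof -
  note CD = char_pairD[OF P]
  note D = dual_pairD[OF CD(1)]
  note cl = dual_pair_closed[OF CD(1)]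
  have r0: "r \<noteq> 0" and rr: "r * r = 2" unfolding r by simp_all
  have rr': "r * (r * x) = 2 * x" for x using rr by (metis mult.assoc)
  have half: "(1 / r) *\<^sub>R v = r *\<^sub>R ((1 / 2) *\<^sub>R v)" for v :: 'a
    using rr r0 by (simp add: field_simps)
  have cancel: "(1 / r) *\<^sub>R r *\<^sub>R v = v" "r *\<^sub>R (1 / r) *\<^sub>R v = v" for v :: 'a using r0 by simp_all
  have iR: "(r *\<^sub>R u) \<bullet> (r *\<^sub>R v) = 2 * (u \<bullet> v)" for u v :: 'a using rr by (simp add: mult.assoc[symmetric])
  have iM: "(r *\<^sub>R u) \<bullet> ((1 / r) *\<^sub>R v) = u \<bullet> v" "((1 / r) *\<^sub>R u) \<bullet> (r *\<^sub>R v) = u \<bullet> v" for u v :: 'a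
    using r0 by simp_all
  have hW: "(1 / 2) *\<^sub>R v \<in> W" if "v \<in> W" for v using rat_spaceD(4)[OF D(1) _ that] by simp
  have h2: "2 *\<^sub>R (1 / 2) *\<^sub>R v = v" for v :: 'a by simp
  have P': "dual_pair ((*\<^sub>R) r ` W) ((*\<^sub>R) r ` X) ((*\<^sub>R) (1 / r) ` M)"
    unfolding dual_pair_def
  proof (intro conjI ballI)
    show "rat_space ((*\<^sub>R) r ` W)"
      unfolding rat_space_def
    proof (intro conjI ballI)
      show "0 \<in> (*\<^sub>R) r ` W" using rat_spaceD(1)[OF D(1)] by (intro image_eqI[of _ _ 0]) simp_all
      fix u v assume "u \<in> (*\<^sub>R) r ` W" "v \<in> (*\<^sub>R) r ` W"
      then obtain x y where xy: "x \<in> W" "y \<in> W" "u = r *\<^sub>R x" "v = r *\<^sub>R y" by blast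
      show "u + v \<in> (*\<^sub>R) r ` W"
        using rat_spaceD(2)[OF D(1) xy(1,2)] xy(3,4) by (metis image_eqI scaleR_add_right)
      show "u \<bullet> v \<in> \<rat>" unfolding xy iR using rat_spaceD(3)[OF D(1) xy(1,2)] by simp
    next
      fix q :: real and v assume "q \<in> \<rat>" "v \<in> (*\<^sub>R) r ` W"
      then obtain y where y: "y \<in> W" "v = r *\<^sub>R y" by blast
      have "q *\<^sub>R v = r *\<^sub>R (q *\<^sub>R y)" unfolding y by simp
      then show "q *\<^sub>R v \<in> (*\<^sub>R) r ` W" using rat_spaceD(4)[OF D(1) \<open>q \<in> \<rat>\<close> y(1)] by blast
    qed
    show "(*\<^sub>R) (1 / r) ` M = dual_in ((*\<^sub>R) r ` W) ((*\<^sub>R) r ` X)"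
    proof (intro equalityI subsetI)
      fix v assume "v \<in> (*\<^sub>R) (1 / r) ` M"
      then obtain u where u: "u \<in> M" "v = (1 / r) *\<^sub>R u" by blast
      have "v \<in> (*\<^sub>R) r ` W" unfolding u(2) half using hW u(1) D(2) by blast
      moreover have "v \<bullet> x \<in> Z2" if "x \<in> (*\<^sub>R) r ` X" for x
        using that u D(7) iM(2) by auto
      ultimately show "v \<in> dual_in ((*\<^sub>R) r ` W) ((*\<^sub>R) r ` X)" by (rule dual_inI)
    next
      fix v assume v: "v \<in> dual_in ((*\<^sub>R) r ` W) ((*\<^sub>R) r ` X)"
      then obtain w where w: "w \<in> W" "v = r *\<^sub>R w" using dual_inD(1) by blast
      have "2 *\<^sub>R w \<in> M"
      proof (rule D(9))
        show "2 *\<^sub>R w \<in> W" using rat_spaceD(4)[OF D(1) _ w(1)] by simp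
        fix x assume "x \<in> X"
        then have "v \<bullet> (r *\<^sub>R x) \<in> Z2" using dual_inD(2)[OF v] by blast
        then show "2 *\<^sub>R w \<bullet> x \<in> Z2" unfolding w iR by simp
      qed
      moreover have "v = (1 / r) *\<^sub>R (2 *\<^sub>R w)" unfolding half w by simp
      ultimately show "v \<in> (*\<^sub>R) (1 / r) ` M" by blast
    qed
    show "(*\<^sub>R) r ` X = dual_in ((*\<^sub>R) r ` W) ((*\<^sub>R) (1 / r) ` M)"
    proof (intro equalityI subsetI)
      fix v assume "v \<in> (*\<^sub>R) r ` X"
      then obtain x where x: "x \<in> X" "v = r *\<^sub>R x" by blast
      have "v \<bullet> y \<in> Z2" if "y \<in> (*\<^sub>R) (1 / r) ` M" for y
        using that x D(6) iM(1) by auto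
      then show "v \<in> dual_in ((*\<^sub>R) r ` W) ((*\<^sub>R) (1 / r) ` M)" using x D(3) by (intro dual_inI) blast
    next
      fix v assume v: "v \<in> dual_in ((*\<^sub>R) r ` W) ((*\<^sub>R) (1 / r) ` M)"
      then obtain w where w: "w \<in> W" "v = r *\<^sub>R w" using dual_inD(1) by blast
      have "w \<in> X"
      proof (rule D(10)[OF w(1)])
        fix u assume "u \<in> M"
        then have "v \<bullet> ((1 / r) *\<^sub>R u) \<in> Z2" using dual_inD(2)[OF v] by blast
        then show "w \<bullet> u \<in> Z2" unfolding w iM .
      qed
      then show "v \<in> (*\<^sub>R) r ` X" using w(2) by blast
    qed
    show "(*\<^sub>R) r ` X \<subseteq> (*\<^sub>R) (1 / r) ` M"
    proof
      fix v assume "v \<in> (*\<^sub>R) r ` X"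
      then obtain x where x: "x \<in> X" "v = r *\<^sub>R x" by blast
      have "v = (1 / r) *\<^sub>R (2 *\<^sub>R x)" unfolding half x by simp
      then show "v \<in> (*\<^sub>R) (1 / r) ` M" using D(5)[OF x(1)] by blast
    qed
    fix v assume "v \<in> (*\<^sub>R) (1 / r) ` M"
    then obtain u where u: "u \<in> M" "v = (1 / r) *\<^sub>R u" by blast
    have "2 *\<^sub>R v = r *\<^sub>R u" unfolding u half by simp
    then show "2 *\<^sub>R v \<in> (*\<^sub>R) r ` X" using u(1) D(4) by blast
  qed
  have sX: "(1 / 2) *\<^sub>R s \<in> X"
  proof (rule D(10))
    show "(1 / 2) *\<^sub>R s \<in> W" using hW CD(3) D(2) by blast
    show "(1 / 2) *\<^sub>R s \<bullet> u \<in> Z2" if "u \<in> M" for u using char_pair_s_even[OF P that] by simp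
  qed
  show ?thesis unfolding char_pair_def
  proof (intro conjI ballI P')
    show "(1 / r) *\<^sub>R s \<in> (*\<^sub>R) r ` X" unfolding half using sX by blast
    show "r *\<^sub>R t \<in> (*\<^sub>R) r ` X" using CD(2) D(4) by blast
    show "((1 / r) *\<^sub>R s \<bullet> u - u \<bullet> u) / 2 \<in> Z2" if u: "u \<in> (*\<^sub>R) r ` X" for u
    proof -
      obtain x where x: "x \<in> X" "u = r *\<^sub>R x" using u by blast
      show ?thesis unfolding x(2) iM iR by (rule CD(5)[OF x(1)])
    qed
    show "(r *\<^sub>R t \<bullet> u - 2 * (u \<bullet> u)) / 2 \<in> Z2" if u: "u \<in> (*\<^sub>R) (1 / r) ` M" for u
    proof -
      obtain x where x: "x \<in> M" "u = (1 / r) *\<^sub>R x" using u by blast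
      have "2 * (u \<bullet> u) = x \<bullet> x" unfolding x(2) using rr r0 by (simp add: field_simps)
      then show ?thesis unfolding x(2) iM using CD(4)[OF x(1)] by simp
    qed
  qed
qed

text \<open>Undoes the exchange: \<open>p\<close> and \<open>q\<close> swap back, and dividing the
  basis vectors by \<open>r\<close> divides the product of norms by a power of 2, which the exponent
  \<open>k\<close> absorbs.\<close>

lemma discriminant_data_dual:
  fixes M X :: "'a::euclidean_space set"
  assumes r: "r = sqrt 2"
    and data: "discriminant_data ((*\<^sub>R) r ` W) ((*\<^sub>R) r ` X) ((*\<^sub>R) (1 / r) ` M) ((1 / r) *\<^sub>R s) (r *\<^sub>R t)"
  shows "discriminant_data W M X t s"
proof -
  have r0: "r \<noteq> 0" and rr: "r * r = 2" unfolding r by simp_all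
  have iR: "(r *\<^sub>R u) \<bullet> (r *\<^sub>R v) = 2 * (u \<bullet> v)" for u v :: 'a using rr by (simp add: mult.assoc[symmetric])
  have iM: "(r *\<^sub>R u) \<bullet> ((1 / r) *\<^sub>R v) = u \<bullet> v" for u v :: 'a
    using r0 by simp
  have iH: "((1 / r) *\<^sub>R u) \<bullet> ((1 / r) *\<^sub>R v) = u \<bullet> v / 2" for u v :: 'a using rr r0 by (simp add: field_simps)
  from data obtain C p q k w where C: "finite C" "C \<subseteq> (*\<^sub>R) r ` W" "pairwise orthogonal C" "0 \<notin> C"
      "(*\<^sub>R) r ` W \<subseteq> span C" "card C = p + q" "(\<Prod>c\<in>C. c \<bullet> c) = 2 powi k * w"
    and w: "(w - (1 - real (p + q) + (s \<bullet> s / 2 + 2 * (t \<bullet> t) / 2 + t \<bullet> s))) / 4 \<in> Z2"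
    and pq: "(s \<bullet> s / 2 - real q) / 2 \<in> Z2" "(2 * (t \<bullet> t) / 2 - real p) / 2 \<in> Z2"
      "index ((*\<^sub>R) (1 / r) ` M) ((*\<^sub>R) r ` X) = 2 ^ p"
      "index ((*\<^sub>R) r ` X) ((*\<^sub>R) 2 ` ((*\<^sub>R) (1 / r) ` M)) = 2 ^ q"
    unfolding discriminant_data_def iR iM iH by blast
  let ?f = "(*\<^sub>R) (1 / r) :: 'a \<Rightarrow> 'a"
  have inj: "inj_on ?f C" using r0 by (intro inj_onI) simp
  have two: "2 / r = r" using rr r0 by (simp add: field_simps)
  have e1: "(*\<^sub>R) 2 ` ((*\<^sub>R) (1 / r) ` M) = (*\<^sub>R) r ` M"
    unfolding image_image by (simp add: two)
  have e2: "(*\<^sub>R) r ` X = (*\<^sub>R) (1 / r) ` ((*\<^sub>R) 2 ` X)"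
    unfolding image_image by (simp add: two)
  have r1: "1 / r \<noteq> 0" using r0 by simp
  have ix: "index X M = 2 ^ q" using pq(4) unfolding e1 index_scale[OF r0] .
  have ix': "index M ((*\<^sub>R) 2 ` X) = 2 ^ p" using pq(3) unfolding e2 index_scale[OF r1] .
  show ?thesis unfolding discriminant_data_def
  proof (intro exI conjI)
    show "finite (?f ` C)" using C(1) by simp
    show "?f ` C \<subseteq> W" using C(2) r0 by auto
    show "pairwise orthogonal (?f ` C)"
      using C(3) by (auto simp: pairwise_def orthogonal_def)
    show "0 \<notin> ?f ` C" using C(4) r0 by auto
    show "W \<subseteq> span (?f ` C)"
    proof
      fix v assume "v \<in> W"
      then have "r *\<^sub>R v \<in> span C" using C(5) by blast
      also have "span C = span (?f ` C)"
        using span_image_scale[OF C(1), of "\<lambda>_. 1 / r"] r0 by simp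
      finally have "(1 / r) *\<^sub>R r *\<^sub>R v \<in> span (?f ` C)" by (rule span_scale)
      then show "v \<in> span (?f ` C)" using r0 by simp
    qed
    show "card (?f ` C) = q + p" using C(6) card_image[OF inj] by simp
    have "(\<Prod>c\<in>?f ` C. c \<bullet> c) = (\<Prod>c\<in>C. c \<bullet> c / 2)"
      by (subst prod.reindex[OF inj]) (simp only: o_def iH)
    also have "\<dots> = 2 powi k * w / 2 ^ card C" by (simp add: prod_dividef C(7))
    also have "\<dots> = 2 powi (k - int (card C)) * w" by (simp add: power_int_diff)
    finally show "(\<Prod>c\<in>?f ` C. c \<bullet> c) = 2 powi (k - int (card C)) * w" .
    have e: "s \<bullet> s / 2 + 2 * (t \<bullet> t) / 2 + t \<bullet> s = t \<bullet> t + s \<bullet> s / 2 + s \<bullet> t"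
      by (simp add: inner_commute)
    show "(w - (1 - real (q + p) + (t \<bullet> t + s \<bullet> s / 2 + s \<bullet> t))) / 4 \<in> Z2"
      using w unfolding e by (simp only: add.commute[of q p])
    show "(t \<bullet> t - real p) / 2 \<in> Z2" "(s \<bullet> s / 2 - real q) / 2 \<in> Z2" using pq by simp_all
    show "index X M = 2 ^ q" by (rule ix)
    show "index M ((*\<^sub>R) 2 ` X) = 2 ^ p" by (rule ix')
  qed
qed

text \<open>By duality the hypothesis on \<open>X\<close> gives \<open>X \<subseteq> M\<close>, and
  the one on \<open>M\<close> puts half of each vector of \<open>M\<close> into \<open>X\<close>. So
  \<open>M\<close> is divisible by 2, its norms are infinitely divisible, and everything
  vanishes.\<close>

lemma discriminant_data_trivial:
  fixes W :: "'a::euclidean_space set"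
  assumes P: "char_pair W M X t s"
    and M: "\<And>a b. a \<in> M \<Longrightarrow> b \<in> M \<Longrightarrow> a \<bullet> b / 2 \<in> Z2"
    and X: "\<And>x y. x \<in> X \<Longrightarrow> y \<in> X \<Longrightarrow> x \<bullet> y \<in> Z2"
  shows "discriminant_data W M X t s"
proof -
  note CD = char_pairD[OF P]
  note D = dual_pairD[OF CD(1)]
  note cl = dual_pair_closed[OF CD(1)]
  have XM: "X \<subseteq> M" using D(9) D(3) X by blast
  have half: "(1 / 2) *\<^sub>R u \<in> M" if "u \<in> M" for u
  proof -
    have "(1 / 2) *\<^sub>R u \<in> X"
    proof (rule D(10))
      show "(1 / 2) *\<^sub>R u \<in> W" using rat_spaceD(4)[OF D(1)] that D(2) by auto
      show "(1 / 2) *\<^sub>R u \<bullet> v \<in> Z2" if "v \<in> M" for v using M[OF \<open>u \<in> M\<close> that] by simp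
    qed
    then show ?thesis using XM by blast
  qed
  have "(1 / 2 ^ k) *\<^sub>R u \<in> M" if "u \<in> M" for u k
  proof (induction k)
    case (Suc k)
    have "(1 / 2 ^ Suc k) *\<^sub>R u = (1 / 2) *\<^sub>R (1 / 2 ^ k) *\<^sub>R u" by simp
    then show ?case using half[OF Suc.IH] by simp
  qed (use that in simp)
  then have "u \<bullet> u / 2 ^ k \<in> Z2" if "u \<in> M" for u k
    using D(8)[OF that, of "(1 / 2 ^ k) *\<^sub>R u"] that by simp
  then have "u \<bullet> u = 0" if "u \<in> M" for u using Z2_infinitely_divisible that by blast
  then have M0: "M = {0}" using cl(1) by auto
  then have X0: "X = {0}" using XM cl(5) by auto
  have W0: "W \<subseteq> {0}"
  proof
    fix w assume "w \<in> W"
    then have "w \<in> M" by (rule D(9)) (simp add: X0)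
    then show "w \<in> {0}" using M0 by simp
  qed
  have ts: "t = 0" "s = 0" using CD(2,3) M0 by auto
  show ?thesis unfolding discriminant_data_def
    by (rule exI[of _ "{}"], rule exI[of _ 0], rule exI[of _ 0], rule exI[of _ 0], rule exI[of _ 1])
       (use W0 in \<open>auto simp: ts M0 X0 index_def\<close>)
qed

lemma dim_orthogonal_less:
  fixes W :: "'a::euclidean_space set"
  assumes "W' \<subseteq> W" "c \<in> W" "c \<noteq> 0" "\<And>w. w \<in> W' \<Longrightarrow> w \<bullet> c = 0"
  shows "dim W' < dim W"
proof -
  have "c \<notin> span W'"
  proof
    assume "c \<in> span W'"
    then have "orthogonal c c"
      by (rule orthogonal_to_span) (simp add: orthogonal_def inner_commute[of c] assms(4))
    then show False using assms(3) by (simp add: orthogonal_def)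
  qed
  then have "dim (insert c W') = dim W' + 1" by (simp add: dim_insert)
  moreover have "dim (insert c W') \<le> dim W" using assms(1,2) by (intro dim_subset) auto
  ultimately show ?thesis by simp
qed

text \<open>An odd norm in \<open>M\<close> yields a line, an odd inner product without odd norms an
  even plane. If all products in \<open>M\<close> are even, the same is tried on the rescaled dual;
  if that fails too, the lattice is zero.\<close>

lemma discriminant_data_exists:
  fixes W :: "'a::euclidean_space set"
  assumes "char_pair W M X t s"
  shows "discriminant_data W M X t s"
  using assms
proof (induction "dim W" arbitrary: W M X t s rule: less_induct)
  case less
  note P = less.prems
  \<comment> \<open>Stated for any space of dimension at most \<open>dim W\<close>, since it is also
    applied to the rescaled dual, which lives in \<open>sqrt 2\<close> times
    \<open>W\<close>.\<close>
  have step: "discriminant_data V N Y t' s'"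
    if Q: "char_pair V N Y t' s'" and dim: "dim V \<le> dim W" and ab: "a \<in> N" "b \<in> N" "a \<bullet> b / 2 \<notin> Z2"
    for V N Y :: "'a set" and t' s' a b
  proof -
    note D = dual_pairD[OF char_pairD(1)[OF Q]]
    have IH: "discriminant_data W' M' X' t'' s''" if R: "char_pair W' M' X' t'' s''" "W' \<subseteq> V"
      "\<exists>c\<in>V. c \<noteq> 0 \<and> (\<forall>w\<in>W'. w \<bullet> c = 0)" for W' M' X' t'' s''
    proof (rule less.hyps[OF _ R(1)])
      obtain c where c: "c \<in> V" "c \<noteq> 0" "\<forall>w\<in>W'. w \<bullet> c = 0" using R(3) by blast
      have "dim W' < dim V" using dim_orthogonal_less[OF R(2) c(1,2)] c(3) by blast
      then show "dim W' < dim W" using dim by simp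
    qed
    have par: "(x \<bullet> y - 1) / 2 \<in> Z2" if xy: "x \<in> N" "y \<in> N" "x \<bullet> y / 2 \<notin> Z2" for x y
    proof (cases rule: Z2_parity[OF D(8)[OF xy(1,2)]])
      case (1 z)
      then show ?thesis using xy(3) by simp
    next
      case (2 z)
      then show ?thesis by simp
    qed
    show ?thesis
    proof (cases "\<exists>c\<in>N. c \<bullet> c / 2 \<notin> Z2")
      case True
      then obtain c where "c \<in> N" "c \<bullet> c / 2 \<notin> Z2" by blast
      then show ?thesis using discriminant_data_split_line[OF Q _ _ IH] par by blast
    next
      case False
      then show ?thesis using discriminant_data_split_plane[OF Q ab(1,2) _ _ par[OF ab] IH] ab by blast
    qed
  qed
  show ?case
  proof (cases "\<exists>a\<in>M. \<exists>b\<in>M. a \<bullet> b / 2 \<notin> Z2")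
    case True
    then show ?thesis using step[OF P order_refl] by blast
  next
    case M: False
    show ?thesis
    proof (cases "\<exists>x\<in>X. \<exists>y\<in>X. x \<bullet> y \<notin> Z2")
      case True
      then obtain x y where xy: "x \<in> X" "y \<in> X" "x \<bullet> y \<notin> Z2" by blast
      define r where "r = sqrt 2"
      have rr: "r * (r * z) = 2 * z" for z by (simp add: r_def mult.assoc[symmetric])
      have "dim ((*\<^sub>R) r ` W) \<le> dim (span W)"
        by (intro dim_subset) (auto intro: span_scale span_base)
      then have d: "dim ((*\<^sub>R) r ` W) \<le> dim W" by simp
      \<comment> \<open>A non-integral product in \<open>X\<close> becomes an odd one after
        rescaling.\<close>
      have i: "r *\<^sub>R x \<bullet> r *\<^sub>R y / 2 = x \<bullet> y" by (simp add: rr)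
      show ?thesis
        by (rule discriminant_data_dual[OF r_def], rule step[OF char_pair_dual[OF P r_def] d imageI[OF xy(1)] imageI[OF xy(2)]])
           (unfold i, rule xy(3))
    next
      case False
      then show ?thesis using discriminant_data_trivial[OF P] M by blast
    qed
  qed
qed

subsection \<open>The square class of the discriminant and the oddity\<close>

lemma orthogonal_expansion:
  fixes C :: "'a::euclidean_space set"
  assumes C: "finite C" "pairwise orthogonal C" "0 \<notin> C" and v: "v \<in> span C"
  shows "v = (\<Sum>c\<in>C. (v \<bullet> c / (c \<bullet> c)) *\<^sub>R c)"
proof -
  define w where "w = v - (\<Sum>c\<in>C. (v \<bullet> c / (c \<bullet> c)) *\<^sub>R c)"
  have "w \<bullet> d = 0" if d: "d \<in> C" for d
  proof -
    have "(\<Sum>c\<in>C. (v \<bullet> c / (c \<bullet> c)) *\<^sub>R c) \<bullet> d = (\<Sum>c\<in>C. if c = d then v \<bullet> d else 0)"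
      unfolding inner_sum_left
    proof (rule sum.cong[OF refl])
      fix c assume "c \<in> C"
      then show "(v \<bullet> c / (c \<bullet> c)) *\<^sub>R c \<bullet> d = (if c = d then v \<bullet> d else 0)"
        using C(2,3) d by (cases "c = d") (auto simp: pairwise_def orthogonal_def)
    qed
    then show ?thesis using C(1) d by (simp add: w_def inner_diff_left)
  qed
  then have "orthogonal w x" if "x \<in> span C" for x
    using that by (intro orthogonal_to_span[OF that]) (simp add: orthogonal_def)
  moreover have "w \<in> span C" unfolding w_def
    using v by (intro span_diff span_sum span_scale) (auto intro: span_base)
  ultimately have "w = 0" using orthogonal_self by blast
  then show ?thesis by (simp add: w_def)
qed

lemma rat_space_sum:
  "rat_space W \<Longrightarrow> (\<And>i. i \<in> I \<Longrightarrow> f i \<in> W) \<Longrightarrow> sum f I \<in> W"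
  by (induction I rule: infinite_finite_induct) (auto simp: rat_spaceD)

text \<open>The coefficients of the orthogonal expansion are quotients of rationals. This places the
  characteristic vector, which is first obtained over the reals, in the rational space.\<close>

lemma rat_space_orthogonal_basis_mem:
  assumes W: "rat_space W" and C: "finite C" "C \<subseteq> W" "pairwise orthogonal C" "0 \<notin> C" "span C = UNIV"
    and v: "\<And>c. c \<in> C \<Longrightarrow> v \<bullet> c \<in> \<rat>"
  shows "v \<in> W"
proof -
  have "v = (\<Sum>c\<in>C. (v \<bullet> c / (c \<bullet> c)) *\<^sub>R c)" using C by (intro orthogonal_expansion) auto
  also have "\<dots> \<in> W"
    using C(2) v rat_spaceD(3)[OF W] by (intro rat_space_sum[OF W] rat_spaceD(4)[OF W]) auto
  finally show ?thesis .
qed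

lemma span_insert_diff:
  fixes b u :: "'a::real_vector"
  assumes "u \<in> span B"
  shows "span (insert (b - u) B) = span (insert b B)"
proof (rule antisym)
  have "u \<in> span (insert b B)" "u \<in> span (insert (b - u) B)"
    using assms span_mono[of B "insert b B"] span_mono[of B "insert (b - u) B"] by auto
  moreover have "b \<in> span (insert b B)" "b - u \<in> span (insert (b - u) B)" by (simp_all add: span_base)
  ultimately have "b - u \<in> span (insert b B)" "b \<in> span (insert (b - u) B)"
    using span_diff[of b "insert b B" u] span_add[of "b - u" "insert (b - u) B" u] by simp_all
  moreover have "B \<subseteq> span (insert b B)" "B \<subseteq> span (insert (b - u) B)" by (auto intro: span_base)
  ultimately show "span (insert (b - u) B) \<subseteq> span (insert b B)" "span (insert b B) \<subseteq> span (insert (b - u) B)"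
    by (simp_all add: span_minimal)
qed

lemma rational_gram_schmidt:
  fixes B :: "'a::euclidean_space set"
  assumes W: "rat_space W" and B: "finite B" "B \<subseteq> W"
  shows "\<exists>C. finite C \<and> C \<subseteq> W \<and> pairwise orthogonal C \<and> 0 \<notin> C \<and> span C = span B"
  using B
proof (induction B)
  case empty
  show ?case by (rule exI[of _ "{}"]) simp
next
  case (insert b B)
  then obtain C where C: "finite C" "C \<subseteq> W" "pairwise orthogonal C" "0 \<notin> C" "span C = span B" by auto
  define u where "u = (\<Sum>c\<in>C. (b \<bullet> c / (c \<bullet> c)) *\<^sub>R c)"
  have u: "u \<in> span C" unfolding u_def by (intro span_sum span_scale) (auto intro: span_base)
  have uW: "u \<in> W" unfolding u_def
    using C(2) insert.prems rat_spaceD(3)[OF W] by (intro rat_space_sum[OF W] rat_spaceD(4)[OF W]) auto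
  have orth: "(b - u) \<bullet> d = 0" if d: "d \<in> C" for d
  proof -
    have "u \<bullet> d = (\<Sum>c\<in>C. if c = d then b \<bullet> d else 0)"
      unfolding u_def inner_sum_left
    proof (rule sum.cong[OF refl])
      fix c assume "c \<in> C"
      then show "(b \<bullet> c / (c \<bullet> c)) *\<^sub>R c \<bullet> d = (if c = d then b \<bullet> d else 0)"
        using C(3,4) d by (cases "c = d") (auto simp: pairwise_def orthogonal_def)
    qed
    then show ?thesis using C(1) d by (simp add: inner_diff_left)
  qed
  have sp: "span (insert (b - u) C) = span (insert b B)"
  proof -
    have "u \<in> span B" using u C(5) by simp
    then have "span (insert (b - u) B) = span (insert b B)"
      by (rule span_insert_diff)
    then show ?thesis using C(5) by (simp add: span_insert)
  qed
  show ?case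
  proof (cases "b - u = 0")
    case True
    then have "b \<in> span B" using u C(5) by simp
    then have "span C = span (insert b B)" using C(5) by (simp add: span_redundant)
    then show ?thesis using C by blast
  next
    case False
    have "pairwise orthogonal (insert (b - u) C)"
      using C(3) orth by (intro pairwise_orthogonal_insert) (auto simp: orthogonal_def)
    moreover have "b - u \<in> W" using rat_space_diff[OF W _ uW] insert.prems by simp
    ultimately show ?thesis using C sp False by (intro exI[of _ "insert (b - u) C"]) simp
  qed
qed

lemma span_orthogonal_breakdown:
  fixes v :: "'a::euclidean_space"
  assumes "v \<in> span (insert b B)" "\<And>x. x \<in> B \<Longrightarrow> b \<bullet> x = 0" "b \<noteq> 0"
  shows "v - (v \<bullet> b / (b \<bullet> b)) *\<^sub>R b \<in> span B"
proof -
  obtain k where k: "v - k *\<^sub>R b \<in> span B" using assms(1) by (auto simp: span_breakdown_eq)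
  then have "orthogonal b (v - k *\<^sub>R b)"
    by (rule orthogonal_to_span) (simp add: orthogonal_def assms(2))
  then have "b \<bullet> v = k * (b \<bullet> b)" by (simp add: orthogonal_def inner_diff_right)
  then have "k = v \<bullet> b / (b \<bullet> b)" using assms(3) by (simp add: inner_commute)
  then show ?thesis using k by simp
qed

text \<open>Exchanging one vector at a time yields the invariance of the discriminant up to squares
  without Gram matrices or base changes. The vector is split along \<open>b\<close>; the remainder
  \<open>v1\<close> is exchanged into \<open>B\<close> by induction, and then only the plane of
  \<open>b\<close> and \<open>v1\<close> needs a new basis.\<close>

lemma orthogonal_basis_exchange:
  fixes B :: "'a::euclidean_space set"
  assumes W: "rat_space W" and "finite B" "B \<subseteq> W" "pairwise orthogonal B" "0 \<notin> B"
    and "v \<in> W" "v \<in> span B" "v \<noteq> 0"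
  shows "\<exists>B'. finite B' \<and> B' \<subseteq> W \<and> v \<notin> B' \<and> pairwise orthogonal (insert v B') \<and> 0 \<notin> B' \<and>
     span (insert v B') = span B \<and>
     (\<exists>q\<in>\<rat>. q \<noteq> 0 \<and> (v \<bullet> v) * (\<Prod>b\<in>B'. b \<bullet> b) = q\<^sup>2 * (\<Prod>b\<in>B. b \<bullet> b))"
  using assms(2-)
proof (induction B arbitrary: v)
  case empty
  then show ?case by simp
next
  case (insert b B)
  have "pairwise orthogonal B" using insert.prems(2) by (simp add: pairwise_insert)
  then have b: "b \<in> W" "b \<noteq> 0" and B: "B \<subseteq> W" "pairwise orthogonal B" "0 \<notin> B"
    and bB: "\<And>x. x \<in> B \<Longrightarrow> b \<bullet> x = 0"
    using insert.prems insert.hyps by (auto simp: pairwise_insert orthogonal_def)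
  have bb: "b \<bullet> b > 0" using b(2) by simp
  define q where "q = v \<bullet> b / (b \<bullet> b)"
  define v1 where "v1 = v - q *\<^sub>R b"
  have q: "q \<in> \<rat>" unfolding q_def using rat_spaceD(3)[OF W] insert.prems b(1) by auto
  have v1: "v1 \<in> W" unfolding v1_def
    using rat_space_diff[OF W] rat_spaceD(4)[OF W q b(1)] insert.prems by blast
  have v1B: "v1 \<in> span B" unfolding v1_def q_def
    by (rule span_orthogonal_breakdown) (use insert.prems bB b in auto)
  have orthB: "b \<bullet> x = 0" if "x \<in> span B" for x
    using orthogonal_to_span[OF that, of b] bB by (simp add: orthogonal_def)
  have v: "v = q *\<^sub>R b + v1" by (simp add: v1_def)
  show ?case
  proof (cases "v1 = 0")
    case True
    then have vq: "v = q *\<^sub>R b" using v by simp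
    then have q0: "q \<noteq> 0" using insert.prems by auto
    have "v \<notin> B" using bB[of v] vq q0 bb by auto
    moreover have "pairwise orthogonal (insert v B)"
      using B(2) bB by (intro pairwise_orthogonal_insert) (auto simp: vq orthogonal_def)
    moreover have "span (insert v B) = span (insert b B)"
    proof (rule span_unique[symmetric])
      have "b = (1 / q) *\<^sub>R v" using vq q0 by simp
      then have "b \<in> span (insert v B)" by (metis insertI1 span_base span_scale)
      then show "insert b B \<subseteq> span (insert v B)" by (auto intro: span_base)
      show "span (insert v B) \<subseteq> S'" if "insert b B \<subseteq> S'" "subspace S'" for S'
        using that vq by (intro span_minimal) (auto intro: subspace_scale)
    qed (rule subspace_span)
    moreover have "(v \<bullet> v) * (\<Prod>b\<in>B. b \<bullet> b) = q\<^sup>2 * (\<Prod>b\<in>insert b B. b \<bullet> b)"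
      using insert.hyps by (simp add: vq power2_eq_square)
    ultimately show ?thesis using insert.hyps B q q0 by blast
  next
    case False
    obtain B1 q1 where B1: "finite B1" "B1 \<subseteq> W" "v1 \<notin> B1" "pairwise orthogonal (insert v1 B1)" "0 \<notin> B1"
       "span (insert v1 B1) = span B" and q1: "q1 \<in> \<rat>" "q1 \<noteq> 0"
       "(v1 \<bullet> v1) * (\<Prod>b\<in>B1. b \<bullet> b) = q1\<^sup>2 * (\<Prod>b\<in>B. b \<bullet> b)"
      using insert.IH[OF B v1 v1B False] by blast
    define n1 where "n1 = v1 \<bullet> v1"
    define nb where "nb = b \<bullet> b"
    have n: "n1 > 0" "nb > 0" "n1 \<in> \<rat>" "nb \<in> \<rat>"
      using False bb rat_spaceD(3)[OF W v1 v1] rat_spaceD(3)[OF W b(1) b(1)] by (auto simp: n1_def nb_def)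
    have bv1: "b \<bullet> v1 = 0" "v1 \<bullet> b = 0" using orthB[OF v1B] by (auto simp: inner_commute)
    have bB1: "b \<bullet> x = 0" "x \<bullet> b = 0" "v1 \<bullet> x = 0" "x \<bullet> v1 = 0" if "x \<in> B1" for x
    proof -
      have "x \<in> span (insert v1 B1)" using that by (simp add: span_base)
      then show "b \<bullet> x = 0" using orthB B1(6) by simp
      then show "x \<bullet> b = 0" by (simp add: inner_commute)
      show "v1 \<bullet> x = 0" using B1(3,4) that by (auto simp: pairwise_insert orthogonal_def)
      then show "x \<bullet> v1 = 0" by (simp add: inner_commute)
    qed
    define N where "N = q\<^sup>2 * nb + n1"
    have N: "N > 0" "N \<in> \<rat>" using n q by (auto simp: N_def add_nonneg_pos)
    \<comment> \<open>Spans the orthogonal complement of \<open>v\<close> in the plane of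
      \<open>b\<close> and \<open>v1\<close>. Its norm is \<open>n1 * nb * N\<close>, so the product
      of the two norms passes from \<open>nb * n1\<close> to
      \<open>N\<^sup>2 * nb * n1\<close>.\<close>
    define b' where "b' = n1 *\<^sub>R b - (q * nb) *\<^sub>R v1"
    have vb': "v \<bullet> b' = 0"
      by (simp add: v b'_def inner_add_left inner_diff_right bv1 flip: n1_def nb_def)
    have vv: "v \<bullet> v = N"
      by (simp add: v inner_add_left inner_add_right bv1 N_def power2_eq_square flip: n1_def nb_def)
    have b'b': "b' \<bullet> b' = n1 * nb * N"
      by (simp add: b'_def inner_diff_left inner_diff_right bv1 N_def power2_eq_square algebra_simps flip: n1_def nb_def)
    have b'B1: "b' \<bullet> x = 0" "v \<bullet> x = 0" if "x \<in> B1" for x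
      using bB1[OF that] by (simp_all add: b'_def v inner_diff_left inner_add_left)
    have b'0: "b' \<bullet> b' > 0" using b'b' n N by simp
    have b'W: "b' \<in> W" unfolding b'_def
      using rat_space_diff[OF W] rat_spaceD(4)[OF W] b(1) v1 n(3,4) q by (metis Rats_mult)
    have nin: "b' \<notin> B1" "v \<notin> insert b' B1" using b'0 b'B1[of b'] b'B1[of v] vb' vv N(1) by auto
    have "pairwise orthogonal (insert v (insert b' B1))"
      using B1(4) b'B1 vb' by (intro pairwise_orthogonal_insert) (auto simp: orthogonal_def pairwise_insert)
    moreover have "span (insert v (insert b' B1)) = span (insert b B)" (is "?L = ?R")
    proof (rule antisym)
      have "span B \<subseteq> ?R" by (intro span_mono) auto
      then have "v1 \<in> ?R" "B1 \<subseteq> ?R" using v1B B1(6) span_superset[of "insert v1 B1"] by auto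
      moreover have "b \<in> ?R" by (simp add: span_base)
      ultimately have "insert v (insert b' B1) \<subseteq> ?R"
        unfolding v b'_def by (auto intro!: span_add span_diff span_scale)
      then show "?L \<subseteq> ?R" by (intro span_minimal) auto
    next
      have L: "v \<in> ?L" "b' \<in> ?L" "B1 \<subseteq> ?L" by (auto intro: span_base)
      have "N *\<^sub>R b = (q * nb) *\<^sub>R v + b'"
        by (simp add: v b'_def N_def power2_eq_square algebra_simps)
      then have "N *\<^sub>R b \<in> ?L" using L by (simp add: span_add span_scale)
      then have "(1 / N) *\<^sub>R N *\<^sub>R b \<in> ?L" by (rule span_scale)
      then have bL: "b \<in> ?L" using N by simp
      then have "v1 \<in> ?L" unfolding v1_def using L by (intro span_diff span_scale)
      then have "span (insert v1 B1) \<subseteq> ?L" using L by (intro span_minimal) auto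
      then have "B \<subseteq> ?L" using B1(6) span_superset[of B] by auto
      then show "?R \<subseteq> ?L" using bL by (intro span_minimal) auto
    qed
    moreover have "(v \<bullet> v) * (\<Prod>b\<in>insert b' B1. b \<bullet> b) = (N * q1)\<^sup>2 * (\<Prod>b\<in>insert b B. b \<bullet> b)"
    proof -
      have "(v \<bullet> v) * (\<Prod>b\<in>insert b' B1. b \<bullet> b) = N * (n1 * nb * N) * (\<Prod>b\<in>B1. b \<bullet> b)"
        using nin(1) B1(1) by (simp add: vv b'b')
      also have "\<dots> = N\<^sup>2 * nb * (n1 * (\<Prod>b\<in>B1. b \<bullet> b))" by (simp add: power2_eq_square)
      also have "\<dots> = (N * q1)\<^sup>2 * (nb * (\<Prod>b\<in>B. b \<bullet> b))"
        using q1(3) by (simp add: n1_def power_mult_distrib)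
      finally show ?thesis using insert.hyps by (simp add: nb_def)
    qed
    moreover have "N * q1 \<in> \<rat>" "N * q1 \<noteq> 0" using N q1 by auto
    moreover have "0 \<notin> insert b' B1" "insert b' B1 \<subseteq> W" "finite (insert b' B1)"
      using b'0 B1 b'W by auto
    ultimately show ?thesis using nin(2) by blast
  qed
qed

text \<open>Once \<open>c\<close> has been exchanged into \<open>B\<close>, the remaining vectors on
  both sides are orthogonal to \<open>c\<close> and have the same span, so the induction hypothesis
  compares them.\<close>

lemma discriminant_square_class:
  fixes B C :: "'a::euclidean_space set"
  assumes W: "rat_space W" and "finite C" "C \<subseteq> W" "pairwise orthogonal C" "0 \<notin> C"
    and "finite B" "B \<subseteq> W" "pairwise orthogonal B" "0 \<notin> B" and "span B = span C"
  shows "\<exists>q\<in>\<rat>. q \<noteq> 0 \<and> (\<Prod>c\<in>C. c \<bullet> c) = q\<^sup>2 * (\<Prod>b\<in>B. b \<bullet> b)"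
  using assms(2-)
proof (induction C arbitrary: B)
  case empty
  then have "B = {}" using span_superset[of B] by auto
  then show ?case by (intro bexI[of _ 1]) auto
next
  case (insert c C)
  have "pairwise orthogonal C" using insert.prems(2) by (simp add: pairwise_insert)
  then have c: "c \<in> W" "c \<noteq> 0" and C: "C \<subseteq> W" "pairwise orthogonal C" "0 \<notin> C"
    and cC: "\<And>x. x \<in> C \<Longrightarrow> c \<bullet> x = 0"
    using insert.prems insert.hyps by (auto simp: pairwise_insert orthogonal_def)
  have "c \<in> span B" using insert.prems by (simp add: span_base)
  then obtain B' q where B': "finite B'" "B' \<subseteq> W" "c \<notin> B'" "pairwise orthogonal (insert c B')" "0 \<notin> B'"
     "span (insert c B') = span B" and q: "q \<in> \<rat>" "q \<noteq> 0"
     "(c \<bullet> c) * (\<Prod>b\<in>B'. b \<bullet> b) = q\<^sup>2 * (\<Prod>b\<in>B. b \<bullet> b)"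
    using orthogonal_basis_exchange[OF W insert.prems(4-7) c(1) _ c(2)] by blast
  have cB': "\<And>x. x \<in> B' \<Longrightarrow> c \<bullet> x = 0" and B'p: "pairwise orthogonal B'"
    using B' by (auto simp: pairwise_insert orthogonal_def)
  have sub: "S \<subseteq> span T" if S: "\<And>x. x \<in> S \<Longrightarrow> c \<bullet> x = 0" "S \<subseteq> span (insert c T)"
      and T: "\<And>x. x \<in> T \<Longrightarrow> c \<bullet> x = 0" for S T
  proof
    fix x assume x: "x \<in> S"
    have "x - (x \<bullet> c / (c \<bullet> c)) *\<^sub>R c \<in> span T"
      by (rule span_orthogonal_breakdown) (use x S(2) T c in auto)
    then show "x \<in> span T" using S(1)[OF x] by (simp add: inner_commute)
  qed
  have spans: "span (insert c B') = span (insert c C)" using B'(6) insert.prems(8) by simp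
  have "B' \<subseteq> span (insert c C)" "C \<subseteq> span (insert c B')"
    using span_superset[of "insert c B'"] span_superset[of "insert c C"] unfolding spans by blast+
  then have "B' \<subseteq> span C" "C \<subseteq> span B'" using sub[of B' C] sub[of C B'] cB' cC by blast+
  then have "span B' = span C" by (intro antisym span_minimal subspace_span)
  then obtain r where r: "r \<in> \<rat>" "r \<noteq> 0" "(\<Prod>c\<in>C. c \<bullet> c) = r\<^sup>2 * (\<Prod>b\<in>B'. b \<bullet> b)"
    using insert.IH[OF C B'(1,2) B'p B'(5)] by blast
  have "(\<Prod>c\<in>insert c C. c \<bullet> c) = (c \<bullet> c) * (r\<^sup>2 * (\<Prod>b\<in>B'. b \<bullet> b))"
    using insert.hyps r(3) by simp
  also have "\<dots> = r\<^sup>2 * ((c \<bullet> c) * (\<Prod>b\<in>B'. b \<bullet> b))" by simp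
  also have "\<dots> = (r * q)\<^sup>2 * (\<Prod>b\<in>B. b \<bullet> b)" unfolding q(3) by (simp add: power_mult_distrib)
  finally show ?case using r q by (intro bexI[of _ "r * q"]) auto
qed

section \<open>Unit parts of rational numbers and the oddity\<close>

lemma int_odd_part:
  assumes "(n::int) \<noteq> 0"
  shows "\<exists>k m. n = 2 ^ k * (1 + 2 * m)"
  using assms
proof (induction "nat \<bar>n\<bar>" arbitrary: n rule: less_induct)
  case less
  show ?case
  proof (cases "even n")
    case True
    then obtain l where l: "n = 2 * l" by blast
    have "l \<noteq> 0" "nat \<bar>l\<bar> < nat \<bar>n\<bar>" using l less.prems by auto
    then obtain k m where "l = 2 ^ k * (1 + 2 * m)" using less.hyps[of l] by blast
    then have "n = 2 ^ Suc k * (1 + 2 * m)" using l by simp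
    then show ?thesis by blast
  next
    case False
    then obtain m where "n = 2 * m + 1" by (rule oddE)
    then have "n = 2 ^ 0 * (1 + 2 * m)" by simp
    then show ?thesis by blast
  qed
qed

lemma Z2_unit_mult:
  assumes "y \<in> Z2" "z \<in> Z2"
  shows "\<exists>x\<in>Z2. (1 + 2 * y) * (1 + 2 * z) = 1 + 2 * x"
proof (rule bexI)
  show "(1 + 2 * y) * (1 + 2 * z) = 1 + 2 * (y + z + 2 * y * z)" by (simp add: algebra_simps)
  show "y + z + 2 * y * z \<in> Z2" using assms by (intro Z2I)
qed

lemma Rats_unit_part:
  assumes "(q::real) \<in> \<rat>" "q \<noteq> 0"
  shows "\<exists>(j::int) y. y \<in> Z2 \<and> q = 2 powi j * (1 + 2 * y)"
proof -
  obtain a b :: int where ab: "b > 0" "q = of_int a / of_int b"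
    using assms(1) Rats_cases' by metis
  have "a \<noteq> 0" "b \<noteq> 0" using ab assms(2) by auto
  then obtain k m k' m' where km: "a = 2 ^ k * (1 + 2 * m)" "b = 2 ^ k' * (1 + 2 * m')"
    using int_odd_part by metis
  obtain z where z: "z \<in> Z2" "(1 + 2 * real_of_int m') * (1 + 2 * z) = 1"
    using Z2_inverse[OF Z2I(1)[of m']] by auto
  obtain y where y: "y \<in> Z2" "(1 + 2 * real_of_int m) * (1 + 2 * z) = 1 + 2 * y"
    using Z2_unit_mult[OF Z2I(1) z(1)] by blast
  have "1 + 2 * real_of_int m' \<noteq> 0" using z(2) by auto
  then have "1 / (1 + 2 * real_of_int m') = 1 + 2 * z" using z(2) by (simp add: field_simps)
  then have "q = 2 ^ k / 2 ^ k' * ((1 + 2 * real_of_int m) * (1 + 2 * z))"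
    unfolding ab km by (simp flip: \<open>1 / (1 + 2 * real_of_int m') = 1 + 2 * z\<close>)
  also have "\<dots> = 2 powi (int k - int k') * (1 + 2 * y)"
    unfolding y(2) by (simp add: power_int_diff)
  finally show ?thesis using y(1) by blast
qed

text \<open>Uniqueness of the 2-adic valuation: a positive exponent would put \<open>1 / 2\<close>
  into \<open>Z2\<close>, and a negative one becomes positive when the two units are
  exchanged.\<close>

lemma Z2_unit_powi:
  assumes "y \<in> Z2" "z \<in> Z2" "2 powi d * (1 + 2 * y) = 1 + 2 * z"
  shows "d = 0"
proof -
  have not_pos: "\<not> d > 0" if "y \<in> Z2" "z \<in> Z2" "2 powi d * (1 + 2 * y) = 1 + 2 * z" for y z d
  proof
    assume "d > 0"
    then have "(2::real) powi d = 2 * 2 ^ (nat d - 1)"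
      by (metis (no_types) Suc_diff_1 int_nat_eq less_le power_Suc power_int_of_nat zero_less_nat_eq)
    then have "1 / 2 = 2 ^ (nat d - 1) * (1 + 2 * y) - z" using that(3) by simp
    also have "\<dots> \<in> Z2" using that(1,2) by (intro Z2I)
    finally show False using half_notin_Z2 by simp
  qed
  have "2 powi (- d) * (1 + 2 * z) = 1 + 2 * y"
    unfolding assms(3)[symmetric] by (simp add: power_int_minus)
  from not_pos[OF assms(2,1) this] not_pos[OF assms] show ?thesis by simp
qed

text \<open>By uniqueness of the valuation the powers of 2 agree, and \<open>w\<close> is
  \<open>u\<close> times the square of an odd unit, which is
  \<open>1 + 4 * y * (y + 1)\<close>.\<close>

lemma unit_square_class_mod_4:
  assumes q: "q \<in> \<rat>" "q \<noteq> 0" and w: "(w - 1) / 2 \<in> Z2" and u: "(u - 1) / 2 \<in> Z2"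
    and eq: "2 powi k * w = q\<^sup>2 * (2 powi l * u)"
  shows "(w - u) / 4 \<in> Z2"
proof -
  obtain j y where y: "y \<in> Z2" "q = 2 powi j * (1 + 2 * y)" using Rats_unit_part[OF q] by blast
  define y2 where "y2 = 2 * y * (y + 1)"
  have y2: "y2 \<in> Z2" "(1 + 2 * y)\<^sup>2 = 1 + 2 * y2" using y by (auto simp: y2_def power2_eq_square algebra_simps)
  define w' u' where "w' = (w - 1) / 2" and "u' = (u - 1) / 2"
  have wu: "w = 1 + 2 * w'" "u = 1 + 2 * u'" by (auto simp: w'_def u'_def field_simps)
  obtain x where x: "x \<in> Z2" "(1 + 2 * y2) * (1 + 2 * u') = 1 + 2 * x"
    using Z2_unit_mult[OF y2(1), of u'] u by (auto simp: u'_def)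
  have "2 powi k * (1 + 2 * w') = 2 powi (2 * j + l) * (1 + 2 * x)"
  proof -
    have "(2 powi j)\<^sup>2 = (2::real) powi (2 * j)" by (simp add: power2_eq_square flip: power_int_add)
    then show ?thesis
      using eq unfolding wu y(2) power_mult_distrib y2(2) x(2)[symmetric]
      by (simp add: power_int_add mult_ac)
  qed
  then have "2 powi (k - (2 * j + l)) * (1 + 2 * w') = 1 + 2 * x"
    by (simp add: power_int_diff field_simps)
  then have "k - (2 * j + l) = 0" by (rule Z2_unit_powi[rotated 2]) (use w x in \<open>auto simp: w'_def\<close>)
  then have "w = (1 + 2 * y2) * u"
    using \<open>2 powi (k - (2 * j + l)) * (1 + 2 * w') = 1 + 2 * x\<close> x(2) wu by simp
  then have "(w - u) / 4 = y * (y + 1) * u" by (simp add: y2_def field_simps)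
  also have "y * (y + 1) * (1 + 2 * u') \<in> Z2" using y(1) u unfolding u'_def by (intro Z2I)
  then have "y * (y + 1) * u \<in> Z2" unfolding wu(2) .
  finally show ?thesis .
qed

text \<open>Three binary digits, peeled off one after the other, form the residue.\<close>

lemma Z2_mod_8:
  assumes "x \<in> Z2"
  shows "\<exists>a::int. (x - of_int a) / 8 \<in> Z2"
proof -
  have *: "\<exists>(e::int) y. y \<in> Z2 \<and> x = of_int e + 2 * y" if "x \<in> Z2" for x
    by (rule Z2_parity[OF that]) (metis add_0 of_int_0, metis of_int_1)
  obtain e0 x1 where 0: "x1 \<in> Z2" "x = of_int e0 + 2 * x1" using *[OF assms] by blast
  obtain e1 x2 where 1: "x2 \<in> Z2" "x1 = of_int e1 + 2 * x2" using *[OF 0(1)] by blast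
  obtain e2 x3 where 2: "x3 \<in> Z2" "x2 = of_int e2 + 2 * x3" using *[OF 1(1)] by blast
  have "(x - of_int (e0 + 2 * e1 + 4 * e2)) / 8 = x3" unfolding 0 1 2 by (simp add: field_simps)
  then show ?thesis using 2(1) by (intro exI[of _ "e0 + 2 * e1 + 4 * e2"]) simp
qed

lemma odd_iff_Z2: "odd a \<longleftrightarrow> (real_of_int a - 1) / 2 \<in> Z2"
proof
  assume "odd a"
  then obtain m where "a = 2 * m + 1" by (rule oddE)
  then show "(real_of_int a - 1) / 2 \<in> Z2" by simp
next
  assume a: "(real_of_int a - 1) / 2 \<in> Z2"
  show "odd a"
  proof
    assume "even a"
    then obtain m where "a = 2 * m" by blast
    then have "1 / 2 = of_int m - (real_of_int a - 1) / 2" by (simp add: field_simps)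
    also have "\<dots> \<in> Z2" using a by (intro Z2I)
    finally show False using half_notin_Z2 by simp
  qed
qed

text \<open>As \<open>(1 + 2 m) (1 + 2 n) = 1 + 2 m + 2 n + 4 m n\<close>, the deviations from 1 add
  up modulo 4. This is the passage from the sum in the oddity to the product in the
  discriminant.\<close>

lemma prod_odd_mod_4:
  fixes a :: "'b \<Rightarrow> int"
  assumes "finite B" "\<And>b. b \<in> B \<Longrightarrow> odd (a b)"
  shows "odd (\<Prod>b\<in>B. a b) \<and> 4 dvd (\<Prod>b\<in>B. a b) - 1 - ((\<Sum>b\<in>B. a b) - int (card B))"
  using assms
proof (induction B)
  case (insert b B)
  define P S where "P = (\<Prod>b\<in>B. a b)" and "S = (\<Sum>b\<in>B. a b)"
  have IH: "odd P" "4 dvd P - 1 - (S - int (card B))" using insert by (auto simp: P_def S_def)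
  obtain m n where mn: "a b = 2 * m + 1" "P = 2 * n + 1" using IH(1) insert.prems[of b] by (metis insertI1 oddE)
  have eq: "a b * P - 1 - (a b + S - (1 + int (card B))) = (P - 1 - (S - int (card B))) + 4 * (m * n)"
    unfolding mn by (simp add: algebra_simps)
  have "4 dvd (P - 1 - (S - int (card B))) + 4 * (m * n)" using IH(2) by (intro dvd_add) auto
  then have "4 dvd a b * P - 1 - (a b + S - (1 + int (card B)))" unfolding eq .
  then show ?case using insert IH(1) by (simp add: P_def S_def)
qed simp

lemma prod_Z2_cong:
  assumes "finite B" "\<And>b. b \<in> B \<Longrightarrow> (u b - of_int (a b)) / 8 \<in> Z2"
  shows "((\<Prod>b\<in>B. u b) - of_int (\<Prod>b\<in>B. a b)) / 8 \<in> Z2"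
  using assms
proof (induction B)
  case (insert b B)
  define P U where "P = (\<Prod>b\<in>B. a b)" and "U = (\<Prod>b\<in>B. u b)"
  have IH: "(U - of_int P) / 8 \<in> Z2" and b: "(u b - of_int (a b)) / 8 \<in> Z2" using insert by (auto simp: P_def U_def)
  have eq: "(u b * U - of_int (a b * P)) / 8 = (u b - of_int (a b)) / 8 * U + of_int (a b) * ((U - of_int P) / 8)"
    by (simp add: field_simps)
  have "U \<in> Z2"
  proof -
    have "8 * ((U - of_int P) / 8) + of_int P \<in> Z2" (is "?x \<in> _") using IH by (intro Z2I)
    also have "?x = U" by (simp add: field_simps)
    finally show ?thesis .
  qed
  then have "(u b * U - of_int (a b * P)) / 8 \<in> Z2" unfolding eq using IH b by (intro Z2I)
  then show ?case using insert by (simp add: P_def U_def)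
qed simp

text \<open>Modulo 4 the antisquare correction disappears, so in dimension divisible by 4 the oddity
  only sees the unit part of the discriminant modulo 4.\<close>

lemma oddity_unit_part:
  fixes B :: "'a::euclidean_space set"
  assumes B: "finite B" "4 dvd card B"
    and a: "\<And>b. b \<in> B \<Longrightarrow> odd (a b) \<and> (\<exists>u. b \<bullet> b = 2 powi e b * u \<and> (u - of_int (a b)) / 8 \<in> Z2)"
    and k: "4 dvd ((\<Sum>b\<in>B. a b) + 4 * int n) mod 8"
  shows "\<exists>l u. (\<Prod>b\<in>B. b \<bullet> b) = 2 powi l * u \<and> (u - 1) / 4 \<in> Z2"
proof -
  obtain u where u: "\<And>b. b \<in> B \<Longrightarrow> b \<bullet> b = 2 powi e b * u b" "\<And>b. b \<in> B \<Longrightarrow> (u b - of_int (a b)) / 8 \<in> Z2"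
    using a by metis
  define U where "U = (\<Prod>b\<in>B. u b)"
  define P where "P = (\<Prod>b\<in>B. a b)"
  have "(\<Prod>b\<in>B. (2::real) powi e b) = 2 powi (\<Sum>b\<in>B. e b)"
    using B(1) by (induction B) (auto simp: power_int_add)
  then have "(\<Prod>b\<in>B. b \<bullet> b) = 2 powi (\<Sum>b\<in>B. e b) * U"
    using u(1) by (simp add: U_def prod.distrib)
  moreover have "(U - 1) / 4 \<in> Z2"
  proof -
    have "4 dvd (\<Sum>b\<in>B. a b) + 4 * int n" using k by (simp add: dvd_mod_iff)
    then have "4 dvd (\<Sum>b\<in>B. a b)" by (simp add: dvd_add_left_iff)
    moreover have "4 dvd P - 1 - ((\<Sum>b\<in>B. a b) - int (card B))"
      using prod_odd_mod_4[OF B(1)] a unfolding P_def by blast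
    moreover have "4 dvd int (card B)" using B(2) by presburger
    ultimately have "4 dvd P - 1" by presburger
    then obtain m where m: "P - 1 = 4 * m" by blast
    have "(U - of_int P) / 8 \<in> Z2" unfolding U_def P_def using B(1) u(2) by (rule prod_Z2_cong)
    then have mem: "2 * ((U - of_int P) / 8) + of_int m \<in> Z2" by (intro Z2I)
    moreover have "real_of_int P = 1 + 4 * of_int m" using m by (metis add.commute diff_add_cancel of_int_1 of_int_add of_int_mult of_int_numeral)
    ultimately have "2 * ((U - of_int P) / 8) + of_int m = (U - 1) / 4" by (simp add: field_simps)
    then show ?thesis using mem by metis
  qed
  ultimately show ?thesis by blast
qed

subsection \<open>Lattices and their localizations\<close>

lemma add_subgroup_sum:
  "add_subgroup S \<Longrightarrow> (\<And>i. i \<in> I \<Longrightarrow> f i \<in> S) \<Longrightarrow> sum f I \<in> S"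
  by (induction I rule: infinite_finite_induct) (auto simp: add_subgroupD)

definition zspan :: "'a::real_vector set \<Rightarrow> 'a set" where
  "zspan B = {\<Sum>b\<in>B. of_int (c b) *\<^sub>R b | c :: 'a \<Rightarrow> int. True}"

lemma is_lattice_iff: "is_lattice M \<longleftrightarrow> (\<exists>B. independent B \<and> span B = UNIV \<and> M = zspan B)"
  by (simp add: is_lattice_def zspan_def)

lemma zspanI: "(\<Sum>b\<in>B. of_int (c b) *\<^sub>R b) \<in> zspan B"
  by (auto simp: zspan_def)

lemma zspanE: "v \<in> zspan B \<Longrightarrow> (\<And>c. v = (\<Sum>b\<in>B. of_int (c b) *\<^sub>R b) \<Longrightarrow> thesis) \<Longrightarrow> thesis"
  by (auto simp: zspan_def)

lemma add_subgroup_zspan: "add_subgroup (zspan B)"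
  unfolding add_subgroup_def
proof (intro conjI ballI)
  show "0 \<in> zspan B" using zspanI[where c = "\<lambda>_. 0" and B = B] by simp
  fix u v assume "u \<in> zspan B" "v \<in> zspan B"
  then obtain c d where "u = (\<Sum>b\<in>B. of_int (c b) *\<^sub>R b)" "v = (\<Sum>b\<in>B. of_int (d b) *\<^sub>R b)"
    by (metis zspanE)
  then have "u - v = (\<Sum>b\<in>B. of_int (c b - d b) *\<^sub>R b)" by (simp add: sum_subtractf algebra_simps)
  then show "u - v \<in> zspan B" using zspanI[where c = "\<lambda>b. c b - d b"] by simp
qed

lemma zspan_base: "finite B \<Longrightarrow> b \<in> B \<Longrightarrow> b \<in> zspan B"
  using zspanI[where c = "\<lambda>x. if x = b then 1 else 0" and B = B]
  by (simp add: if_distrib[of "\<lambda>x. of_int x *\<^sub>R _"] cong: if_cong)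

lemma zspan_subset_span: "zspan B \<subseteq> span B"
  by (auto elim!: zspanE intro!: span_sum span_scale intro: span_base)

lemma zspan_minimal: "add_subgroup S \<Longrightarrow> B \<subseteq> S \<Longrightarrow> zspan B \<subseteq> S"
  by (auto elim!: zspanE intro!: add_subgroup_sum add_subgroupD(4))

lemma zspan_insert:
  "finite B \<Longrightarrow> b \<notin> B \<Longrightarrow> v \<in> zspan (insert b B) \<longleftrightarrow> (\<exists>n. v - of_int n *\<^sub>R b \<in> zspan B)"
proof
  assume B: "finite B" "b \<notin> B" and "v \<in> zspan (insert b B)"
  then obtain c where "v = (\<Sum>x\<in>insert b B. of_int (c x) *\<^sub>R x)" by (metis zspanE)
  then have "v - of_int (c b) *\<^sub>R b = (\<Sum>x\<in>B. of_int (c x) *\<^sub>R x)" using B by simp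
  then show "\<exists>n. v - of_int n *\<^sub>R b \<in> zspan B" using zspanI by metis
next
  assume B: "finite B" "b \<notin> B" and "\<exists>n. v - of_int n *\<^sub>R b \<in> zspan B"
  then obtain n where n: "v - of_int n *\<^sub>R b \<in> zspan B" by blast
  have G: "add_subgroup (zspan (insert b B))" by (rule add_subgroup_zspan)
  have "zspan B \<subseteq> zspan (insert b B)"
    using B by (intro zspan_minimal[OF G]) (auto intro!: zspan_base)
  moreover have "b \<in> zspan (insert b B)" using B by (auto intro!: zspan_base)
  ultimately have "(v - of_int n *\<^sub>R b) + of_int n *\<^sub>R b \<in> zspan (insert b B)"
    using n by (intro add_subgroupD(3,4)[OF G]) auto
  then show "v \<in> zspan (insert b B)" by simp
qed

text \<open>The coordinate along \<open>b\<close> takes on \<open>S\<close> the values of an ideal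
  of the integers. A vector attaining its generator, together with a basis of the kernel, is a basis
  of \<open>S\<close>.\<close>

lemma subgroup_of_zspan:
  fixes B :: "'a::euclidean_space set"
  assumes "finite B" "independent B" "add_subgroup S" "S \<subseteq> zspan B"
  shows "\<exists>B'. finite B' \<and> independent B' \<and> S = zspan B'"
  using assms
proof (induction B arbitrary: S)
  case empty
  have "zspan {} = {0::'a}" by (auto simp: zspan_def)
  then have "S = zspan {}" using empty add_subgroupD(1)[OF empty(2)] by auto
  then show ?case by (intro exI[of _ "{}"]) (simp add: independent_empty)
next
  case (insert b B)
  note S = add_subgroupD[OF insert.prems(2)]
  have indB: "independent B" and bB: "b \<notin> span B"
    using insert.prems(1) insert.hyps by (simp_all add: independent_insert split: if_splits)
  obtain f :: "'a \<Rightarrow> real" where f: "linear f" "\<And>x. x \<in> insert b B \<Longrightarrow> f x = (if x = b then 1 else 0)"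
    using linear_independent_extend[OF insert.prems(1), of "\<lambda>x. if x = b then 1 else 0"] by blast
  have fB: "f x = 0" if "x \<in> span B" for x
    using linear_eq_0_on_span[OF f(1) _ that] f(2) insert.hyps by fastforce
  have fS: "\<exists>n. f v = of_int n \<and> v - of_int n *\<^sub>R b \<in> zspan B" if v: "v \<in> S" for v
  proof -
    obtain n where n: "v - of_int n *\<^sub>R b \<in> zspan B"
      using v insert.prems(3) zspan_insert[OF insert.hyps] by blast
    then have "f (v - of_int n *\<^sub>R b) = 0" using fB zspan_subset_span by blast
    then have "f v = of_int n" using f by (simp add: linear_diff[OF f(1)] linear_scale[OF f(1)])
    then show ?thesis using n by blast
  qed
  show ?case
  proof (cases "\<exists>v\<in>S. f v \<noteq> 0")
    case False
    have "S \<subseteq> zspan B"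
    proof
      fix v assume v: "v \<in> S"
      then have "f v = 0" using False by blast
      then show "v \<in> zspan B" using fS[OF v] by auto
    qed
    then show ?thesis using insert.IH[OF indB insert.prems(2)] by blast
  next
    case True
    define P where "P n \<longleftrightarrow> 0 < n \<and> (\<exists>v\<in>S. f v = of_nat n)" for n
    obtain v0 n0 where v0: "v0 \<in> S" "f v0 = of_int n0" "n0 \<noteq> 0" using True fS by force
    have "P (nat \<bar>n0\<bar>)"
    proof (cases "n0 > 0")
      case True
      then show ?thesis using v0 by (auto simp: P_def)
    next
      case False
      have "0 - v0 \<in> S" using S(1,2) v0(1) by blast
      then show ?thesis using v0 False linear_neg[OF f(1), of v0] by (auto simp: P_def intro!: bexI[of _ "- v0"])
    qed
    then have PL: "P (LEAST n. P n)" by (rule LeastI)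
    define d where "d = (LEAST n. P n)"
    obtain v where v: "v \<in> S" "f v = of_nat d" and d: "d > 0" using PL by (auto simp: P_def d_def)
    define S0 where "S0 = {u \<in> S. f u = 0}"
    have S0: "add_subgroup S0" unfolding add_subgroup_def S0_def
      using S(1,2) linear_0[OF f(1)] linear_diff[OF f(1)] by auto
    have "S0 \<subseteq> zspan B"
    proof
      fix u assume "u \<in> S0"
      then have "u \<in> S" "f u = 0" by (auto simp: S0_def)
      then show "u \<in> zspan B" using fS[of u] by auto
    qed
    then obtain B0 where B0: "finite B0" "independent B0" "S0 = zspan B0"
      using insert.IH[OF indB S0] by blast
    have B0S: "B0 \<subseteq> S0" using B0 zspan_base by blast
    have f0: "f x = 0" if "x \<in> span B0" for x
      using linear_eq_0_on_span[OF f(1) _ that] B0S by (auto simp: S0_def)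
    have vB0: "v \<notin> span B0" using f0 v(2) d by force
    have vB0': "v \<notin> B0" using vB0 span_base by blast
    have "S = zspan (insert v B0)"
    proof (intro equalityI subsetI)
      fix u assume u: "u \<in> S"
      obtain n where n: "f u = of_int n" using fS[OF u] by blast
      \<comment> \<open>Division with remainder: the new coordinate lies between 0 and
        \<open>d - 1\<close>, so minimality of \<open>d\<close> makes it 0.\<close>
      have u': "u - of_int (n div int d) *\<^sub>R v \<in> S" using S(2,4) u v(1) by blast
      have fu': "f (u - of_int (n div int d) *\<^sub>R v) = of_int (n mod int d)"
        by (simp add: linear_diff[OF f(1)] linear_scale[OF f(1)] n v(2) minus_div_mult_eq_mod[symmetric])
      have "0 \<le> n mod int d" "n mod int d < int d" using d by auto
      moreover have "\<not> P (nat (n mod int d))"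
        using calculation not_less_Least[of "nat (n mod int d)" P, folded d_def] by linarith
      ultimately have "n mod int d = 0" using u' fu' by (force simp: P_def)
      then have "u - of_int (n div int d) *\<^sub>R v \<in> zspan B0" using u' fu' B0(3) by (auto simp: S0_def)
      then show "u \<in> zspan (insert v B0)" using zspan_insert[OF B0(1) vB0'] by blast
    next
      fix u assume "u \<in> zspan (insert v B0)"
      moreover have "insert v B0 \<subseteq> S" using v(1) B0S by (auto simp: S0_def)
      ultimately show "u \<in> S" using zspan_minimal[OF insert.prems(2)] by blast
    qed
    moreover have "independent (insert v B0)" using B0(2) vB0 by (simp add: independent_insert)
    ultimately show ?thesis using B0(1) by blast
  qed
qed

lemma is_latticeE:
  fixes M :: "'a::euclidean_space set"
  assumes "is_lattice M"
  obtains B where "finite B" "independent B" "span B = UNIV" "M = zspan B" "B \<subseteq> M"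
proof -
  obtain B where B: "independent B" "span B = UNIV" "M = zspan B" using assms is_lattice_iff by blast
  then have "finite B" by (simp add: independent_imp_finite)
  then show thesis using that B zspan_base by blast
qed

lemma is_lattice_subgroup: "is_lattice M \<Longrightarrow> add_subgroup M"
  by (auto elim!: is_latticeE intro: add_subgroup_zspan)

lemma is_lattice_scale:
  fixes M :: "'a::euclidean_space set"
  assumes M: "is_lattice M" and c: "(c::real) \<noteq> 0"
  shows "is_lattice ((*\<^sub>R) c ` M)"
proof -
  obtain B where B: "finite B" "independent B" "span B = UNIV" "M = zspan B" using M by (rule is_latticeE)
  have inj: "inj ((*\<^sub>R) c :: 'a \<Rightarrow> 'a)" using c by (simp add: inj_def)
  then have "independent ((*\<^sub>R) c ` B)"
    using B(2) inj_on_subset[OF inj subset_UNIV] by (intro linear_independent_injective_image linear_scaleR)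
  moreover have "span ((*\<^sub>R) c ` B) = UNIV"
    using span_image_scale[OF B(1), of "\<lambda>_. c"] B(3) c by simp
  moreover have "(*\<^sub>R) c ` M = zspan ((*\<^sub>R) c ` B)"
  proof -
    have e: "c *\<^sub>R (\<Sum>b\<in>B. of_int (n b) *\<^sub>R b) = (\<Sum>b\<in>(*\<^sub>R) c ` B. of_int (n ((1 / c) *\<^sub>R b)) *\<^sub>R b)" for n
      using c by (subst sum.reindex) (auto simp: inj_on_subset[OF inj] scaleR_sum_right mult.commute)
    have e': "(\<Sum>b\<in>(*\<^sub>R) c ` B. of_int (n b) *\<^sub>R b) = c *\<^sub>R (\<Sum>b\<in>B. of_int (n (c *\<^sub>R b)) *\<^sub>R b)" for n
      using c by (subst sum.reindex) (auto simp: inj_on_subset[OF inj] scaleR_sum_right mult.commute)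
    show ?thesis
    proof (intro equalityI subsetI)
      fix v assume "v \<in> (*\<^sub>R) c ` M"
      then obtain n where "v = c *\<^sub>R (\<Sum>b\<in>B. of_int (n b) *\<^sub>R b)" unfolding B(4) by (auto elim!: zspanE)
      then show "v \<in> zspan ((*\<^sub>R) c ` B)" unfolding e using zspanI by metis
    next
      fix v assume "v \<in> zspan ((*\<^sub>R) c ` B)"
      then obtain n where "v = (\<Sum>b\<in>(*\<^sub>R) c ` B. of_int (n b) *\<^sub>R b)" by (rule zspanE)
      then show "v \<in> (*\<^sub>R) c ` M" unfolding e' B(4) using zspanI[of "\<lambda>b. n (c *\<^sub>R b)" B] by blast
    qed
  qed
  ultimately show ?thesis using is_lattice_iff by blast
qed

text \<open>Recognizes duals and even sublattices as lattices without exhibiting a basis: the upper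
  bound makes \<open>S\<close> free of finite rank, the lower bound makes it span.\<close>

lemma is_lattice_sandwich:
  fixes M S :: "'a::euclidean_space set"
  assumes M: "is_lattice M" and S: "add_subgroup S"
    and k: "k \<noteq> 0" "\<And>v. v \<in> M \<Longrightarrow> k *\<^sub>R v \<in> S" and D: "D \<noteq> 0" "\<And>v. v \<in> S \<Longrightarrow> D *\<^sub>R v \<in> M"
  shows "is_lattice S"
proof -
  have "is_lattice ((*\<^sub>R) (1 / D) ` M)" using is_lattice_scale[OF M] D(1) by simp
  then obtain B where B: "finite B" "independent B" "(*\<^sub>R) (1 / D) ` M = zspan B" by (rule is_latticeE)
  have "S \<subseteq> zspan B"
  proof
    fix v assume "v \<in> S"
    moreover have "v = (1 / D) *\<^sub>R D *\<^sub>R v" using D(1) by simp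
    ultimately show "v \<in> zspan B" unfolding B(3)[symmetric] using D(2) by blast
  qed
  then obtain B' where B': "finite B'" "independent B'" "S = zspan B'"
    using subgroup_of_zspan[OF B(1,2) S] by blast
  obtain A where A: "span A = UNIV" "A \<subseteq> M" using M by (rule is_latticeE)
  have "a \<in> span B'" if "a \<in> A" for a
  proof -
    have "k *\<^sub>R a \<in> span B'" using k(2) that A(2) B'(3) zspan_subset_span by blast
    then have "(1 / k) *\<^sub>R k *\<^sub>R a \<in> span B'" by (rule span_scale)
    then show ?thesis using k(1) by simp
  qed
  then have "span B' = UNIV" using A(1) span_minimal[of A "span B'"] by auto
  then show ?thesis using B' is_lattice_iff by blast
qed

lemma integral_latticeD:
  assumes "integral_lattice M"
  shows "is_lattice M" "add_subgroup M" "u \<in> M \<Longrightarrow> v \<in> M \<Longrightarrow> u \<bullet> v \<in> \<int>"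
  using assms is_lattice_subgroup by (auto simp: integral_lattice_def)

section \<open>Rational spaces and common denominators\<close>

lemma rational_space_base: "u \<in> M \<Longrightarrow> u \<in> rational_space M"
  unfolding rational_space_def by (auto intro!: exI[of _ 1] exI[of _ u])

lemma rational_space_denominator:
  assumes "add_subgroup M" "v \<in> rational_space M"
  obtains n :: int where "n > 0" "of_int n *\<^sub>R v \<in> M"
proof -
  obtain q u where q: "q \<in> \<rat>" "u \<in> M" "v = q *\<^sub>R u" using assms(2) by (auto simp: rational_space_def)
  obtain a b :: int where ab: "b > 0" "q = of_int a / of_int b" using q(1) Rats_cases' by metis
  have "of_int b *\<^sub>R v = of_int a *\<^sub>R u" unfolding q ab using ab(1) by simp
  then show thesis using that[OF ab(1)] add_subgroupD(4)[OF assms(1) q(2)] by simp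
qed

lemma rational_spaceI:
  assumes "of_int n *\<^sub>R v \<in> M" "n \<noteq> 0"
  shows "v \<in> rational_space M"
proof -
  have "v = (1 / of_int n) *\<^sub>R of_int n *\<^sub>R v" using assms(2) by simp
  moreover have "1 / real_of_int n \<in> \<rat>" by simp
  ultimately show ?thesis using assms(1) unfolding rational_space_def by blast
qed

lemma rat_space_rational_space:
  fixes M :: "'a::euclidean_space set"
  assumes M: "integral_lattice M"
  shows "rat_space (rational_space M)"
  unfolding rat_space_def
proof (intro conjI ballI)
  note MD = integral_latticeD[OF M]
  show "0 \<in> rational_space M" using rational_space_base add_subgroupD(1)[OF MD(2)] by blast
  fix u v assume uv: "u \<in> rational_space M" "v \<in> rational_space M"
  obtain m where m: "m > 0" "of_int m *\<^sub>R u \<in> M" using rational_space_denominator[OF MD(2) uv(1)] by blast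
  obtain n where n: "n > 0" "of_int n *\<^sub>R v \<in> M" using rational_space_denominator[OF MD(2) uv(2)] by blast
  have "of_int (m * n) *\<^sub>R (u + v) = of_int n *\<^sub>R of_int m *\<^sub>R u + of_int m *\<^sub>R of_int n *\<^sub>R v"
    by (simp add: algebra_simps)
  also have "\<dots> \<in> M" using add_subgroupD(3,4)[OF MD(2)] m(2) n(2) by blast
  finally show "u + v \<in> rational_space M" by (rule rational_spaceI) (use m n in simp)
  have "(of_int m *\<^sub>R u) \<bullet> (of_int n *\<^sub>R v) \<in> \<int>" using MD(3)[OF m(2) n(2)] .
  then have "of_int (m * n) * (u \<bullet> v) \<in> \<int>" by (simp add: mult_ac)
  then obtain k where "of_int (m * n) * (u \<bullet> v) = of_int k" by (auto elim: Ints_cases)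
  then have "u \<bullet> v = of_int k / of_int (m * n)" using m n by (simp add: field_simps)
  then show "u \<bullet> v \<in> \<rat>" by simp
next
  fix q :: real and v assume "q \<in> \<rat>" "v \<in> rational_space M"
  then obtain r u where "r \<in> \<rat>" "u \<in> M" "v = r *\<^sub>R u" by (auto simp: rational_space_def)
  then have "q *\<^sub>R v = (q * r) *\<^sub>R u" "q * r \<in> \<rat>" using \<open>q \<in> \<rat>\<close> by auto
  then show "q *\<^sub>R v \<in> rational_space M" using \<open>u \<in> M\<close> unfolding rational_space_def by blast
qed

lemma rational_space_orthogonal_basis:
  fixes M :: "'a::euclidean_space set"
  assumes "integral_lattice M"
  obtains C where "finite C" "C \<subseteq> rational_space M" "pairwise orthogonal C" "0 \<notin> C" "span C = UNIV"
proof -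
  obtain B where B: "finite B" "span B = UNIV" "B \<subseteq> M"
    using is_latticeE[OF integral_latticeD(1)[OF assms]] by metis
  have "B \<subseteq> rational_space M" using B(3) rational_space_base by blast
  then show thesis
    using rational_gram_schmidt[OF rat_space_rational_space[OF assms] B(1)] B(2) that by metis
qed

lemma common_denominator:
  assumes "add_subgroup M" "finite E" "E \<subseteq> rational_space M"
  shows "\<exists>D::int. D \<noteq> 0 \<and> (\<forall>v\<in>E. of_int D *\<^sub>R v \<in> M)"
  using assms(2,3)
proof (induction E)
  case empty
  then show ?case by (intro exI[of _ 1]) simp
next
  case (insert e E)
  then obtain D where D: "D \<noteq> 0" "\<forall>v\<in>E. of_int D *\<^sub>R v \<in> M" by auto
  obtain n where n: "n > 0" "of_int n *\<^sub>R e \<in> M"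
    using rational_space_denominator[OF assms(1)] insert.prems by blast
  have "of_int (n * D) *\<^sub>R v \<in> M" if "v \<in> insert e E" for v
  proof (cases "v = e")
    case True
    have "of_int (n * D) *\<^sub>R e = of_int D *\<^sub>R of_int n *\<^sub>R e" by (simp add: mult.commute)
    then show ?thesis unfolding True using add_subgroupD(4)[OF assms(1) n(2), of D] by (simp only:)
  next
    case False
    then have "of_int D *\<^sub>R v \<in> M" using that D by blast
    then show ?thesis using add_subgroupD(4)[OF assms(1), of "of_int D *\<^sub>R v" n] by simp
  qed
  then show ?case using D n by (intro exI[of _ "n * D"]) simp
qed

lemma dual_lattice_denominator:
  fixes M :: "'a::euclidean_space set"
  assumes M: "integral_lattice M"
  shows "\<exists>D::int. D \<noteq> 0 \<and> (\<forall>v\<in>dual_lattice M. of_int D *\<^sub>R v \<in> M)"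
proof -
  note MD = integral_latticeD[OF M]
  have W: "rat_space (rational_space M)" by (rule rat_space_rational_space[OF M])
  obtain C where C: "finite C" "C \<subseteq> rational_space M" "pairwise orthogonal C" "0 \<notin> C" "span C = UNIV"
    using rational_space_orthogonal_basis[OF M] by blast
  obtain N :: int where N: "N \<noteq> 0" "\<forall>c\<in>C. of_int N *\<^sub>R c \<in> M" using common_denominator[OF MD(2) C(1,2)] by blast
  \<comment> \<open>With respect to these finitely many vectors the coefficients of \<open>v\<close>
    are the integers \<open>v \<bullet> (N c)\<close>. Clearing the denominators of the vectors
    therefore clears those of every \<open>v\<close> in the dual.\<close>
  have "(\<lambda>c. (1 / (of_int N * (c \<bullet> c))) *\<^sub>R c) ` C \<subseteq> rational_space M"
    using C(2) rat_spaceD(3,4)[OF W] by auto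
  then obtain D :: int where D: "D \<noteq> 0" "\<And>c. c \<in> C \<Longrightarrow> of_int D *\<^sub>R (1 / (of_int N * (c \<bullet> c))) *\<^sub>R c \<in> M"
    using common_denominator[OF MD(2) finite_imageI[OF C(1)]] by (metis (no_types, lifting) imageI)
  have "of_int D *\<^sub>R v \<in> M" if v: "v \<in> dual_lattice M" for v
  proof -
    have "v = (\<Sum>c\<in>C. (v \<bullet> c / (c \<bullet> c)) *\<^sub>R c)" using C by (intro orthogonal_expansion) auto
    then have "of_int D *\<^sub>R v = of_int D *\<^sub>R (\<Sum>c\<in>C. (v \<bullet> c / (c \<bullet> c)) *\<^sub>R c)"
      by (rule arg_cong)
    also have "\<dots> = (\<Sum>c\<in>C. (v \<bullet> (of_int N *\<^sub>R c)) *\<^sub>R of_int D *\<^sub>R (1 / (of_int N * (c \<bullet> c))) *\<^sub>R c)"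
      unfolding scaleR_sum_right by (intro sum.cong refl) (use N(1) in simp)
    also have "\<dots> \<in> M"
    proof (rule add_subgroup_sum[OF MD(2)])
      fix c assume c: "c \<in> C"
      have "v \<bullet> (of_int N *\<^sub>R c) \<in> \<int>" using v N(2) c unfolding dual_lattice_def by blast
      then obtain k where "v \<bullet> (of_int N *\<^sub>R c) = of_int k" by (auto elim: Ints_cases)
      then show "(v \<bullet> (of_int N *\<^sub>R c)) *\<^sub>R of_int D *\<^sub>R (1 / (of_int N * (c \<bullet> c))) *\<^sub>R c \<in> M"
        using add_subgroupD(4)[OF MD(2) D(2)[OF c]] by metis
    qed
    finally show ?thesis .
  qed
  then show ?thesis using D(1) by blast
qed

section \<open>Localizations at a prime and local duals\<close>

definition loc :: "nat \<Rightarrow> 'a::real_vector set \<Rightarrow> 'a set" where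
  "loc p M = {v. \<exists>c::int. \<not> int p dvd c \<and> of_int c *\<^sub>R v \<in> M}"

lemma locI: "\<not> int p dvd c \<Longrightarrow> of_int c *\<^sub>R v \<in> M \<Longrightarrow> v \<in> loc p M"
  by (auto simp: loc_def)

lemma locE: "v \<in> loc p M \<Longrightarrow> (\<And>c. \<not> int p dvd c \<Longrightarrow> of_int c *\<^sub>R v \<in> M \<Longrightarrow> thesis) \<Longrightarrow> thesis"
  by (auto simp: loc_def)

lemma loc_base: "prime p \<Longrightarrow> v \<in> M \<Longrightarrow> v \<in> loc p M"
  by (rule locI[of p 1]) (auto simp: not_prime_unit)

lemma loc_subset_rational_space: "loc p M \<subseteq> rational_space M"
proof
  fix v assume "v \<in> loc p M"
  then obtain c where "\<not> int p dvd c" "of_int c *\<^sub>R v \<in> M" by (rule locE)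
  moreover from this have "c \<noteq> 0" by auto
  ultimately show "v \<in> rational_space M" by (intro rational_spaceI[of c])
qed

lemma in_subgroup_if_loc:
  assumes "add_subgroup M" "\<And>p. prime p \<Longrightarrow> v \<in> loc p M"
  shows "v \<in> M"
  using assms by (intro in_subgroup_if_locally[of M v]) (auto simp: loc_def)

lemma add_subgroup_loc:
  assumes p: "prime p" and M: "add_subgroup M"
  shows "add_subgroup (loc p M)"
  unfolding add_subgroup_def
proof (intro conjI ballI)
  show "0 \<in> loc p M" using loc_base[OF p add_subgroupD(1)[OF M]] .
  fix u v assume "u \<in> loc p M" "v \<in> loc p M"
  then obtain a b where ab: "\<not> int p dvd a" "of_int a *\<^sub>R u \<in> M" "\<not> int p dvd b" "of_int b *\<^sub>R v \<in> M"
    by (metis locE)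
  have "of_int (a * b) *\<^sub>R (u - v) = of_int b *\<^sub>R of_int a *\<^sub>R u - of_int a *\<^sub>R of_int b *\<^sub>R v"
    by (simp add: algebra_simps)
  also have "\<dots> \<in> M" using add_subgroupD(2,4)[OF M] ab by blast
  finally show "u - v \<in> loc p M" using not_dvd_mult_int[OF p ab(1,3)] by (intro locI)
qed

lemma loc_scaleE:
  assumes "prime p" "\<not> int p dvd c" "of_int c *\<^sub>R v \<in> loc p M"
  shows "v \<in> loc p M"
proof -
  obtain b where b: "\<not> int p dvd b" "of_int b *\<^sub>R of_int c *\<^sub>R v \<in> M" using assms(3) by (rule locE)
  then have "of_int (b * c) *\<^sub>R v \<in> M" by simp
  then show ?thesis using not_dvd_mult_int[OF assms(1) b(1) assms(2)] by (intro locI)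
qed

lemma padic_inner_loc:
  assumes p: "prime p" and u: "u \<in> loc p M" and v: "\<And>u. u \<in> M \<Longrightarrow> v \<bullet> u \<in> padic_ints p"
  shows "v \<bullet> u \<in> padic_ints p"
proof -
  obtain c where "\<not> int p dvd c" "of_int c *\<^sub>R u \<in> M" using u by (rule locE)
  then show ?thesis using v[of "of_int c *\<^sub>R u"] padic_ints_divide[OF p, of c "v \<bullet> u"] by simp
qed

lemma loc_inner_integral:
  assumes M: "integral_lattice M" and p: "prime p" and "u \<in> loc p M" "v \<in> loc p M"
  shows "u \<bullet> v \<in> padic_ints p"
proof (rule padic_inner_loc[OF p assms(4)])
  fix w assume w: "w \<in> M"
  have "w \<bullet> u \<in> padic_ints p"
    by (rule padic_inner_loc[OF p assms(3)]) (use integral_latticeD(3)[OF M w] padic_ints_Ints[OF p] in blast)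
  then show "u \<bullet> w \<in> padic_ints p" by (simp add: inner_commute)
qed

lemma padic_common_denominator:
  assumes p: "prime p" and "finite B" "\<And>b. b \<in> B \<Longrightarrow> r b \<in> padic_ints p"
  shows "\<exists>c::int. \<not> int p dvd c \<and> (\<forall>b\<in>B. of_int c * r b \<in> \<int>)"
  using assms(2,3)
proof (induction B)
  case empty
  then show ?case using p by (intro exI[of _ 1]) (auto simp: not_prime_unit)
next
  case (insert b B)
  then obtain c where c: "\<not> int p dvd c" "\<forall>b\<in>B. of_int c * r b \<in> \<int>" by auto
  obtain d where d: "\<not> int p dvd d" "of_int d * r b \<in> \<int>" using insert.prems[of b] padic_ints_iff[OF p] by auto
  have "of_int (c * d) * r x \<in> \<int>" if "x \<in> insert b B" for x
  proof (cases "x = b")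
    case True
    have "of_int c * (of_int d * r b) \<in> \<int>" by (rule Ints_mult[OF Ints_of_int d(2)])
    then show ?thesis using True by (simp add: mult.assoc)
  next
    case False
    then have "of_int c * r x \<in> \<int>" using c(2) that by blast
    then have "of_int d * (of_int c * r x) \<in> \<int>" by (rule Ints_mult[OF Ints_of_int])
    then show ?thesis by (simp add: mult_ac)
  qed
  then show ?case using not_dvd_mult_int[OF p c(1) d(1)] by blast
qed

text \<open>Biduality after localization: the coordinates of \<open>v\<close> in a basis are its
  products with the dual basis, and finitely many of them share a denominator prime to
  \<open>p\<close>. Hence the condition in \<open>pi_dual\<close> at a prime outside the given set
  means membership in the localization.\<close>

lemma loc_iff_dual_lattice:
  fixes M :: "'a::euclidean_space set"
  assumes M: "is_lattice M" and p: "prime p"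
  shows "v \<in> loc p M \<longleftrightarrow> (\<forall>u\<in>dual_lattice M. v \<bullet> u \<in> padic_ints p)"
proof
  assume v: "v \<in> loc p M"
  show "\<forall>u\<in>dual_lattice M. v \<bullet> u \<in> padic_ints p"
  proof
    fix u assume "u \<in> dual_lattice M"
    then have "u \<bullet> v \<in> padic_ints p"
      using padic_inner_loc[OF p v, of u] padic_ints_Ints[OF p] by (auto simp: dual_lattice_def)
    then show "v \<bullet> u \<in> padic_ints p" by (simp add: inner_commute)
  qed
next
  assume v: "\<forall>u\<in>dual_lattice M. v \<bullet> u \<in> padic_ints p"
  obtain B where B: "finite B" "independent B" "span B = UNIV" "M = zspan B" using M by (rule is_latticeE)
  have "\<exists>d. \<forall>x\<in>B. d \<bullet> x = (if x = b then 1 else 0)" for b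
  proof -
    obtain f :: "'a \<Rightarrow> real" where f: "linear f" "\<And>x. x \<in> B \<Longrightarrow> f x = (if x = b then 1 else 0)"
      using linear_independent_extend[OF B(2), of "\<lambda>x. if x = b then 1 else 0"] by blast
    \<comment> \<open>The adjoint of a real functional, evaluated at 1, is the vector that
      represents it; this gives the dual basis.\<close>
    have "adjoint f 1 \<bullet> x = f x" for x using adjoint_works[OF f(1), of x 1] by (simp add: inner_commute)
    then show ?thesis using f(2) by metis
  qed
  then obtain d where d: "\<And>b x. x \<in> B \<Longrightarrow> d b \<bullet> x = (if x = b then 1 else 0)" by metis
  have dual: "d b \<bullet> (\<Sum>x\<in>B. r x *\<^sub>R x) = r b" if "b \<in> B" for b r
  proof -
    have "d b \<bullet> (\<Sum>x\<in>B. r x *\<^sub>R x) = (\<Sum>x\<in>B. if x = b then r b else 0)"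
      unfolding inner_sum_right by (intro sum.cong refl) (simp add: d)
    then show ?thesis using B(1) that by simp
  qed
  have "d b \<in> dual_lattice M" if "b \<in> B" for b
    unfolding dual_lattice_def B(4) using dual[OF that] by (auto elim!: zspanE)
  then have vd: "v \<bullet> d b \<in> padic_ints p" if "b \<in> B" for b using v that by blast
  have "v \<in> span B" using B(3) by simp
  then obtain r where r: "v = (\<Sum>x\<in>B. r x *\<^sub>R x)" unfolding span_finite[OF B(1)] by blast
  have "r b \<in> padic_ints p" if "b \<in> B" for b
    using vd[OF that] dual[OF that, of r] r by (simp add: inner_commute)
  then obtain c where c: "\<not> int p dvd c" "\<forall>b\<in>B. of_int c * r b \<in> \<int>"
    using padic_common_denominator[OF p B(1), of r] by blast
  define n where "n b = \<lfloor>of_int c * r b\<rfloor>" for b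
  have n: "of_int c * r b = of_int (n b)" if "b \<in> B" for b
    using c(2) that by (auto simp: n_def elim: Ints_cases)
  have "of_int c *\<^sub>R v = (\<Sum>x\<in>B. of_int c *\<^sub>R r x *\<^sub>R x)"
    using arg_cong[OF r, of "(*\<^sub>R) (of_int c)"] unfolding scaleR_sum_right .
  also have "\<dots> = (\<Sum>x\<in>B. of_int (n x) *\<^sub>R x)"
  proof (rule sum.cong[OF refl])
    fix x assume "x \<in> B"
    then show "of_int c *\<^sub>R r x *\<^sub>R x = of_int (n x) *\<^sub>R x" using n by (metis scaleR_scaleR)
  qed
  also have "\<dots> \<in> M" unfolding B(4) by (rule zspanI)
  finally have "of_int c *\<^sub>R v \<in> M" .
  then show "v \<in> loc p M" using c(1) by (intro locI)
qed

text \<open>Anticipates the localization of \<open>pi_dual P M\<close> at \<open>p\<close>, so that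
  modularity can be examined one prime at a time.\<close>

definition local_dual :: "nat set \<Rightarrow> nat \<Rightarrow> 'a::euclidean_space set \<Rightarrow> 'a set" where
  "local_dual P p M =
     (if p \<in> P then {v \<in> rational_space M. \<forall>u\<in>M. v \<bullet> u \<in> padic_ints p} else loc p M)"

lemma pi_dual_iff_local:
  assumes "integral_lattice M"
  shows "v \<in> pi_dual P M \<longleftrightarrow> v \<in> rational_space M \<and> (\<forall>p. prime p \<longrightarrow> v \<in> local_dual P p M)"
  unfolding pi_dual_def local_dual_def
  using loc_iff_dual_lattice[OF integral_latticeD(1)[OF assms]] by auto

lemma loc_subset_local_dual:
  assumes M: "integral_lattice M" and p: "prime p"
  shows "loc p M \<subseteq> local_dual P p M"
proof -
  have "v \<bullet> u \<in> padic_ints p" if "v \<in> loc p M" "u \<in> M" for u v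
    using loc_inner_integral[OF M p that(1) loc_base[OF p that(2)]] .
  then show ?thesis unfolding local_dual_def using loc_subset_rational_space[of p M] by auto
qed

lemma add_subgroup_local_dual:
  assumes M: "integral_lattice M" and p: "prime p"
  shows "add_subgroup (local_dual P p M)"
proof (cases "p \<in> P")
  case True
  then show ?thesis
    using rat_spaceD(1)[OF rat_space_rational_space[OF M]] rat_space_diff[OF rat_space_rational_space[OF M]] p
    by (auto simp: add_subgroup_def local_dual_def inner_diff_left)
next
  case False
  then show ?thesis using add_subgroup_loc[OF p] integral_latticeD(2)[OF M] by (simp add: local_dual_def)
qed

lemma local_dual_scaleE:
  assumes M: "integral_lattice M" and p: "prime p" and c: "\<not> int p dvd c" "of_int c *\<^sub>R v \<in> local_dual P p M"
  shows "v \<in> local_dual P p M"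
proof (cases "p \<in> P")
  case True
  have "c \<noteq> 0" using c(1) by auto
  then have "v = (1 / of_int c) *\<^sub>R of_int c *\<^sub>R v" by simp
  moreover have "1 / real_of_int c \<in> \<rat>" by simp
  ultimately have "v \<in> rational_space M"
    using rat_spaceD(4)[OF rat_space_rational_space[OF M]] c(2) True unfolding local_dual_def
    by (metis (no_types, lifting) mem_Collect_eq)
  moreover have "v \<bullet> u \<in> padic_ints p" if "u \<in> M" for u
    using c(2) that True padic_ints_divide[OF p c(1), of "v \<bullet> u"] by (auto simp: local_dual_def)
  ultimately show ?thesis using True by (simp add: local_dual_def)
next
  case False
  then show ?thesis using loc_scaleE[OF p c(1)] c(2) by (simp add: local_dual_def)
qed

lemma loc_pi_dual:
  fixes M :: "'a::euclidean_space set"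
  assumes M: "integral_lattice M" and p: "prime p"
  shows "loc p (pi_dual P M) = local_dual P p M"
proof (intro equalityI subsetI)
  fix v assume "v \<in> loc p (pi_dual P M)"
  then obtain c where c: "\<not> int p dvd c" "of_int c *\<^sub>R v \<in> pi_dual P M" by (rule locE)
  then show "v \<in> local_dual P p M" using local_dual_scaleE[OF M p c(1)] pi_dual_iff_local[OF M] p by blast
next
  fix v assume v: "v \<in> local_dual P p M"
  note MD = integral_latticeD[OF M]
  have vQ: "v \<in> rational_space M"
    using v loc_subset_rational_space[of p M] by (auto simp: local_dual_def split: if_splits)
  obtain N where N: "N > 0" "of_int N *\<^sub>R v \<in> M" by (rule rational_space_denominator[OF MD(2) vQ])
  \<comment> \<open>Multiplying \<open>v\<close> by the part \<open>c\<close> of its denominator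
    that is prime to \<open>p\<close> leaves only a power of \<open>p\<close> as denominator. This
    is harmless at every prime other than \<open>p\<close>, and \<open>c\<close> is a unit at
    \<open>p\<close>.\<close>
  obtain k c where c: "N = int p ^ k * c" "\<not> int p dvd c"
    using multiplicity_decompose'[of N "int p"] N(1) p by (metis less_irrefl not_prime_unit prime_int_nat_transfer prime_nat_int_transfer)
  have "of_int c *\<^sub>R v \<in> pi_dual P M" unfolding pi_dual_iff_local[OF M]
  proof (intro conjI allI impI)
    show "of_int c *\<^sub>R v \<in> rational_space M" using rat_spaceD(4)[OF rat_space_rational_space[OF M]] vQ by simp
    fix q :: nat assume q: "prime q"
    show "of_int c *\<^sub>R v \<in> local_dual P q M"
    proof (cases "q = p")
      case True
      then show ?thesis using add_subgroupD(4)[OF add_subgroup_local_dual[OF M p] v] by simp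
    next
      case False
      then have "\<not> int q dvd int p ^ k" using p q
        by (metis of_nat_dvd_iff of_nat_power prime_dvd_power primes_dvd_imp_eq)
      moreover have "of_int (int p ^ k) *\<^sub>R of_int c *\<^sub>R v \<in> M" using N(2) unfolding c(1) by simp
      ultimately have "of_int c *\<^sub>R v \<in> loc q M" by (rule locI)
      then show ?thesis using loc_subset_local_dual[OF M q] by blast
    qed
  qed
  then show "v \<in> loc p (pi_dual P M)" using c(2) by (intro locI)
qed

lemma pi_dual_lattice:
  fixes M :: "'a::euclidean_space set"
  assumes M: "integral_lattice M"
  shows "M \<subseteq> pi_dual P M" "add_subgroup (pi_dual P M)" "is_lattice (pi_dual P M)"
    "rational_space (pi_dual P M) = rational_space M"
proof -
  note MD = integral_latticeD[OF M]
  show sub: "M \<subseteq> pi_dual P M"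
  proof
    fix v assume v: "v \<in> M"
    show "v \<in> pi_dual P M" unfolding pi_dual_iff_local[OF M]
      using rational_space_base[OF v] subsetD[OF loc_subset_local_dual[OF M] loc_base[OF _ v]] by blast
  qed
  note W = rat_space_rational_space[OF M]
  show sg: "add_subgroup (pi_dual P M)"
    unfolding add_subgroup_def
  proof (intro conjI ballI)
    show "0 \<in> pi_dual P M" using sub add_subgroupD(1)[OF MD(2)] by blast
    show "u - v \<in> pi_dual P M" if "u \<in> pi_dual P M" "v \<in> pi_dual P M" for u v
      using that rat_space_diff[OF W] add_subgroupD(2)[OF add_subgroup_local_dual[OF M]]
      unfolding pi_dual_iff_local[OF M] by blast
  qed
  obtain D :: int where D: "D \<noteq> 0" "\<forall>v\<in>dual_lattice M. of_int D *\<^sub>R v \<in> M"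
    using dual_lattice_denominator[OF M] by blast
  have "pi_dual P M \<subseteq> dual_lattice M"
  proof
    fix v assume v: "v \<in> pi_dual P M"
    have "v \<bullet> u \<in> padic_ints p" if "prime p" "u \<in> M" for u p
    proof -
      have "v \<in> local_dual P p M" using v pi_dual_iff_local[OF M] that(1) by blast
      then show ?thesis
        using that loc_inner_integral[OF M that(1) _ loc_base[OF that], of v]
        by (auto simp: local_dual_def split: if_splits)
    qed
    then show "v \<in> dual_lattice M" unfolding dual_lattice_def using Ints_if_padic_ints by blast
  qed
  then show "is_lattice (pi_dual P M)"
    using sub D by (intro is_lattice_sandwich[OF MD(1) sg, of 1 "of_int D"]) auto
  show "rational_space (pi_dual P M) = rational_space M"
  proof
    show "rational_space M \<subseteq> rational_space (pi_dual P M)" using sub by (auto simp: rational_space_def)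
    show "rational_space (pi_dual P M) \<subseteq> rational_space M"
    proof
      fix v assume "v \<in> rational_space (pi_dual P M)"
      then obtain q u where "q \<in> \<rat>" "u \<in> pi_dual P M" "v = q *\<^sub>R u" by (auto simp: rational_space_def)
      then show "v \<in> rational_space M"
        using rat_spaceD(4)[OF rat_space_rational_space[OF M]] pi_dual_iff_local[OF M] by blast
    qed
  qed
qed

lemma in_even_sublattice_iff: "u \<in> even_sublattice M \<longleftrightarrow> u \<in> M \<and> u \<bullet> u / 2 \<in> Z2"
  unfolding even_sublattice_def by (auto intro!: bexI[of _ "u \<bullet> u / 2"])

text \<open>The even sublattice contains \<open>2 M\<close>, so nothing changes at odd primes; at 2
  the parity of a norm is not affected by odd denominators.\<close>

lemma even_sublattice_lattice:
  fixes M :: "'a::euclidean_space set"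
  assumes M: "integral_lattice M"
  shows "integral_lattice (even_sublattice M)" "rational_space (even_sublattice M) = rational_space M"
    "prime p \<Longrightarrow> p \<noteq> 2 \<Longrightarrow> loc p (even_sublattice M) = loc p M"
    "loc 2 (even_sublattice M) = {v \<in> loc 2 M. v \<bullet> v / 2 \<in> Z2}"
proof -
  note MD = integral_latticeD[OF M]
  have mem: "of_int n *\<^sub>R u \<in> even_sublattice M" if "u \<in> M" "even n" for u n
  proof -
    obtain k where "n = 2 * k" using \<open>even n\<close> by blast
    then have "(of_int n *\<^sub>R u) \<bullet> (of_int n *\<^sub>R u) / 2 = of_int (2 * k * k) * (u \<bullet> u)" by simp
    also have "\<dots> \<in> Z2" using padic_ints_Ints[OF two_is_prime_nat MD(3)[OF that(1) that(1)]] by blast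
    finally show ?thesis unfolding in_even_sublattice_iff using add_subgroupD(4)[OF MD(2) that(1)] by blast
  qed
  have sg: "add_subgroup (even_sublattice M)" unfolding add_subgroup_def
  proof (intro conjI ballI)
    show "0 \<in> even_sublattice M" using add_subgroupD(1)[OF MD(2)] by (simp add: in_even_sublattice_iff)
    fix u v assume "u \<in> even_sublattice M" "v \<in> even_sublattice M"
    then have uv: "u \<in> M" "v \<in> M" "u \<bullet> u / 2 \<in> Z2" "v \<bullet> v / 2 \<in> Z2" by (auto simp: in_even_sublattice_iff)
    have "u \<bullet> v \<in> Z2" using padic_ints_Ints[OF two_is_prime_nat MD(3)[OF uv(1,2)]] .
    then have "u \<bullet> u / 2 + v \<bullet> v / 2 - u \<bullet> v \<in> Z2" using uv by (intro Z2I)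
    also have "u \<bullet> u / 2 + v \<bullet> v / 2 - u \<bullet> v = (u - v) \<bullet> (u - v) / 2"
      by (simp add: inner_diff_left inner_diff_right inner_commute field_simps)
    finally show "u - v \<in> even_sublattice M" unfolding in_even_sublattice_iff using add_subgroupD(2)[OF MD(2)] uv by blast
  qed
  have sub: "even_sublattice M \<subseteq> M" by (auto simp: in_even_sublattice_iff)
  have "2 *\<^sub>R v \<in> even_sublattice M" if "v \<in> M" for v using mem[OF that, of 2] by simp
  then have "is_lattice (even_sublattice M)"
    using sub by (intro is_lattice_sandwich[OF MD(1) sg, of 2 1]) auto
  then show "integral_lattice (even_sublattice M)" unfolding integral_lattice_def using sub MD(3) by blast
  show "rational_space (even_sublattice M) = rational_space M"
  proof
    show "rational_space (even_sublattice M) \<subseteq> rational_space M" using sub by (auto simp: rational_space_def)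
    show "rational_space M \<subseteq> rational_space (even_sublattice M)"
    proof
      fix v assume "v \<in> rational_space M"
      then obtain n where n: "n > 0" "of_int n *\<^sub>R v \<in> M" by (rule rational_space_denominator[OF MD(2)])
      have "of_int (2 * n) *\<^sub>R v \<in> even_sublattice M" using mem[OF n(2), of 2] by simp
      then show "v \<in> rational_space (even_sublattice M)" by (rule rational_spaceI) (use n in simp)
    qed
  qed
  show "loc p (even_sublattice M) = loc p M" if p: "prime p" "p \<noteq> 2"
  proof (intro equalityI subsetI)
    fix v assume "v \<in> loc p (even_sublattice M)"
    then show "v \<in> loc p M" using sub by (auto simp: loc_def)
  next
    fix v assume "v \<in> loc p M"
    then obtain c where c: "\<not> int p dvd c" "of_int c *\<^sub>R v \<in> M" by (rule locE)
    have "\<not> int p dvd 2" using p primes_dvd_imp_eq[of p 2] two_is_prime_nat by (metis of_nat_dvd_iff of_nat_numeral)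
    then have "\<not> int p dvd 2 * c" using not_dvd_mult_int[OF p(1) _ c(1)] by simp
    moreover have "of_int (2 * c) *\<^sub>R v \<in> even_sublattice M" using mem[OF c(2), of 2] by simp
    ultimately show "v \<in> loc p (even_sublattice M)" by (rule locI)
  qed
  have sq: "v \<bullet> v / 2 \<in> Z2 \<longleftrightarrow> (of_int c *\<^sub>R v) \<bullet> (of_int c *\<^sub>R v) / 2 \<in> Z2" if "odd c" for c v
  proof
    assume "v \<bullet> v / 2 \<in> Z2"
    then have "of_int c * of_int c * (v \<bullet> v / 2) \<in> Z2" by blast
    then show "(of_int c *\<^sub>R v) \<bullet> (of_int c *\<^sub>R v) / 2 \<in> Z2" by (simp add: mult.assoc)
  next
    assume "(of_int c *\<^sub>R v) \<bullet> (of_int c *\<^sub>R v) / 2 \<in> Z2"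
    then have "of_int (c * c) * (v \<bullet> v / 2) \<in> Z2" by (simp add: mult.assoc)
    then show "v \<bullet> v / 2 \<in> Z2" by (rule padic_ints_divide[OF two_is_prime_nat, rotated]) (use that in simp)
  qed
  show "loc 2 (even_sublattice M) = {v \<in> loc 2 M. v \<bullet> v / 2 \<in> Z2}"
  proof (intro equalityI subsetI)
    fix v assume "v \<in> loc 2 (even_sublattice M)"
    then obtain c where c: "\<not> int 2 dvd c" "of_int c *\<^sub>R v \<in> even_sublattice M" by (rule locE)
    then have "odd c" by simp
    show "v \<in> {v \<in> loc 2 M. v \<bullet> v / 2 \<in> Z2}"
      using c sub sq[OF \<open>odd c\<close>] by (auto simp: in_even_sublattice_iff loc_def)
  next
    fix v assume v: "v \<in> {v \<in> loc 2 M. v \<bullet> v / 2 \<in> Z2}"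
    then obtain c where c: "\<not> int 2 dvd c" "of_int c *\<^sub>R v \<in> M" by (auto elim: locE)
    then have "odd c" by simp
    have "v \<bullet> v / 2 \<in> Z2" using v by blast
    then have "(of_int c *\<^sub>R v) \<bullet> (of_int c *\<^sub>R v) / 2 \<in> Z2" by (rule iffD1[OF sq[OF \<open>odd c\<close>]])
    then have "of_int c *\<^sub>R v \<in> even_sublattice M" unfolding in_even_sublattice_iff using c(2) by blast
    then show "v \<in> loc 2 (even_sublattice M)" using c(1) by (intro locI)
  qed
qed

section \<open>Modularity tested prime by prime\<close>

lemma loc_linear_image:
  assumes lin: "linear f" and inj: "inj f"
  shows "loc p (f ` S) = f ` loc p S"
proof (intro equalityI subsetI)
  fix v assume "v \<in> loc p (f ` S)"
  then obtain c u where c: "\<not> int p dvd c" "of_int c *\<^sub>R v = f u" "u \<in> S" by (auto elim: locE)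
  then have c0: "c \<noteq> 0" by auto
  have "v = (1 / of_int c) *\<^sub>R of_int c *\<^sub>R v" using c0 by simp
  also have "\<dots> = f ((1 / of_int c) *\<^sub>R u)" unfolding c(2) by (simp only: linear_scale[OF lin])
  finally have v: "v = f ((1 / of_int c) *\<^sub>R u)" .
  have "of_int c *\<^sub>R (1 / of_int c) *\<^sub>R u \<in> S" using c0 c(3) by simp
  then have "(1 / of_int c) *\<^sub>R u \<in> loc p S" using c(1) by (intro locI)
  then show "v \<in> f ` loc p S" using v by blast
next
  fix v assume "v \<in> f ` loc p S"
  then obtain u c where "\<not> int p dvd c" "of_int c *\<^sub>R u \<in> S" "v = f u" by (auto elim: locE)
  then show "v \<in> loc p (f ` S)" by (intro locI[of p c]) (auto simp flip: linear_scale[OF lin])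
qed

lemma rational_space_linear_image:
  assumes lin: "linear f"
  shows "rational_space (f ` S) = f ` rational_space S"
  unfolding rational_space_def using linear_scale[OF lin] by (auto simp: image_iff) metis+

text \<open>Membership in a lattice is a local condition. Injectivity guarantees that the preimages
  found at the different primes are one and the same vector.\<close>

lemma pi_dual_image_iff_local:
  fixes M :: "'a::euclidean_space set"
  assumes M: "integral_lattice M" and lin: "linear \<sigma>" and inj: "inj \<sigma>"
  shows "\<sigma> ` pi_dual P M = M \<longleftrightarrow> (\<forall>p. prime p \<longrightarrow> \<sigma> ` local_dual P p M = loc p M)"
proof
  assume a: "\<sigma> ` pi_dual P M = M"
  show "\<forall>p. prime p \<longrightarrow> \<sigma> ` local_dual P p M = loc p M"
    using loc_linear_image[OF lin inj, of _ "pi_dual P M"] loc_pi_dual[OF M] unfolding a by auto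
next
  assume a: "\<forall>p. prime p \<longrightarrow> \<sigma> ` local_dual P p M = loc p M"
  show "\<sigma> ` pi_dual P M = M"
  proof (intro equalityI subsetI)
    fix v assume "v \<in> \<sigma> ` pi_dual P M"
    then obtain u where u: "u \<in> pi_dual P M" "v = \<sigma> u" by blast
    show "v \<in> M"
      using u a pi_dual_iff_local[OF M] by (intro in_subgroup_if_loc[OF integral_latticeD(2)[OF M]]) blast
  next
    fix v assume v: "v \<in> M"
    have ex: "\<exists>u. u \<in> local_dual P p M \<and> v = \<sigma> u" if "prime p" for p
      using a that loc_base[OF that v] by blast
    obtain u where u: "u \<in> local_dual P 2 M" "v = \<sigma> u" using ex[OF two_is_prime_nat] by blast
    have all: "u \<in> local_dual P p M" if "prime p" for p
      using ex[OF that] u(2) inj by (metis injD)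
    have "u \<in> rational_space M"
      using u(1) loc_subset_rational_space[of 2 M] by (auto simp: local_dual_def split: if_splits)
    then have "u \<in> pi_dual P M" using all pi_dual_iff_local[OF M] by blast
    then show "v \<in> \<sigma> ` pi_dual P M" using u(2) by blast
  qed
qed

subsection \<open>The even neighbour\<close>

lemma Z2_eqI: "x \<in> Z2 \<Longrightarrow> x = y \<Longrightarrow> y \<in> Z2"
  by simp

lemma Z2_odd_cases:
  assumes "x \<in> Z2"
  shows "x / 2 \<in> Z2 \<or> (x - 1) / 2 \<in> Z2"
  by (rule Z2_parity[OF assms]) simp_all

lemma Z2_not_both: "x / 2 \<in> Z2 \<Longrightarrow> (x - 1) / 2 \<notin> Z2"
proof
  assume "x / 2 \<in> Z2" "(x - 1) / 2 \<in> Z2"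
  then have "x / 2 - (x - 1) / 2 \<in> Z2" by - (assumption | rule Z2I)+
  then show False using half_notin_Z2 by (simp add: field_simps)
qed

text \<open>The 2-adic heart of the theorem. The lattice \<open>E\<close> is \<open>M\<^sub>0 + \<int> g\<close>, an even neighbour
  of \<open>M\<close>, where the glue vector \<open>g = s/2 + u\<close> is chosen such that \<open>g \<bullet> k \<equiv> k \<bullet> k\<close> modulo 1
  for all \<open>k \<in> K\<close>. The condition on \<open>t\<close> and \<open>s\<close> says that \<open>g \<bullet> g\<close> is even.\<close>

lemma even_neighbour:
  fixes W M X :: "'a::euclidean_space set"
  assumes P: "char_pair W M X t s"
    and c: "c \<in> M" "(c \<bullet> c - 1) / 2 \<in> Z2"
    and x0: "x0 \<in> X" "(2 * (x0 \<bullet> x0) - 1) / 2 \<in> Z2"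
    and tt: "t \<bullet> t / 2 \<in> Z2" and tau: "(t \<bullet> t + s \<bullet> s / 2 + s \<bullet> t) / 4 \<in> Z2"
  defines "M0 \<equiv> {u \<in> M. u \<bullet> u / 2 \<in> Z2}"
  defines "K \<equiv> dual_in W M0"
  defines "N \<equiv> {k \<in> K. k \<bullet> k \<in> Z2}"
  defines "L0 \<equiv> {x \<in> X. x \<bullet> x \<in> Z2}"
  defines "E \<equiv> {y \<in> dual_in W L0. y \<bullet> y / 2 \<in> Z2}"
  shows "\<And>k l. k \<in> K \<Longrightarrow> l \<in> K \<Longrightarrow> 2 * (k \<bullet> l) \<in> Z2"
    and "dual_in W N = E" and "dual_in W E = N" and "\<And>y z. y \<in> E \<Longrightarrow> z \<in> E \<Longrightarrow> y \<bullet> z \<in> Z2"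
proof -
  note CD = char_pairD[OF P]
  note D = dual_pairD[OF CD(1)]
  note cl = dual_pair_closed[OF CD(1)]
  note W = D(1)
  have half: "(1 / 2) *\<^sub>R v \<in> W" if "v \<in> W" for v using rat_spaceD(4)[OF W _ that] by simp
  have tW: "t \<in> W" and sW: "s \<in> W" using CD(2,3) D(2) by blast+
  have tX: "x \<bullet> t \<in> Z2" "t \<bullet> x \<in> Z2" if "x \<in> X" for x using D(6)[OF that CD(2)] D(7)[OF that CD(2)] by blast+
  have t_even: "t \<bullet> u / 2 \<in> Z2" if "u \<in> M0" for u
  proof -
    have "(t \<bullet> u - u \<bullet> u) / 2 + u \<bullet> u / 2 \<in> Z2" using CD(4)[of u] that unfolding M0_def by blast
    then show ?thesis by (simp add: diff_divide_distrib)
  qed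
  have M0M: "M0 \<subseteq> M" by (auto simp: M0_def)
  have t2K: "(1 / 2) *\<^sub>R t \<in> K"
    unfolding K_def by (rule dual_inI[OF half[OF tW]]) (use t_even in simp)
  have XK: "X \<subseteq> K"
    unfolding K_def using D(3,6) M0M by (intro subsetI dual_inI) blast+
  have KW: "K \<subseteq> W" unfolding K_def using dual_inD(1) by blast
  note Kcl = dual_in_closed[OF W, where S = M0, folded K_def]
  \<comment> \<open>Within \<open>M\<close> the sublattice \<open>M0\<close> is the kernel of the
    pairing with \<open>t\<close> modulo 2, so its dual \<open>K\<close> exceeds \<open>X\<close> by
    the single coset of \<open>t / 2\<close>. The product with \<open>c\<close>, a vector of odd
    norm, tells the two cosets apart.\<close>
  have Kcases: "k \<in> X \<or> k - (1 / 2) *\<^sub>R t \<in> X" if k: "k \<in> K" for k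
  proof -
    have kW: "k \<in> W" using k KW by blast
    have kM0: "k \<bullet> u \<in> Z2" if "u \<in> M0" for u using dual_inD(2)[OF k[unfolded K_def] that] .
    have mem: "v \<in> X" if v: "v \<in> W" "v \<bullet> c \<in> Z2" "\<And>u. u \<in> M0 \<Longrightarrow> v \<bullet> u \<in> Z2" for v
    proof (rule D(10)[OF v(1)])
      fix u assume u: "u \<in> M"
      show "v \<bullet> u \<in> Z2"
      proof (cases "u \<bullet> u / 2 \<in> Z2")
        case True
        then show ?thesis using v(3) u by (simp add: M0_def)
      next
        case False
        then have u1: "(u \<bullet> u - 1) / 2 \<in> Z2" using Z2_odd_cases[OF D(8)[OF u u]] by blast
        have uc: "u \<bullet> c \<in> Z2" using D(8)[OF u c(1)] .
        have "(u \<bullet> u - 1) / 2 + (c \<bullet> c - 1) / 2 + 1 - u \<bullet> c \<in> Z2" using u1 c(2) uc by - (assumption | rule Z2I)+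
        also have "(u \<bullet> u - 1) / 2 + (c \<bullet> c - 1) / 2 + 1 - u \<bullet> c = (u - c) \<bullet> (u - c) / 2"
          by (simp add: inner_diff_left inner_diff_right inner_commute[of c u] field_simps)
        finally have "u - c \<in> M0" using cl(3)[OF u c(1)] by (simp add: M0_def)
        then have "v \<bullet> (u - c) + v \<bullet> c \<in> Z2" using v(2,3) by - (assumption | rule Z2I)+
        then show ?thesis by (simp add: inner_diff_right)
      qed
    qed
    have "2 *\<^sub>R c \<in> M0"
    proof -
      have "(2 *\<^sub>R c) \<bullet> (2 *\<^sub>R c) / 2 = 2 * (c \<bullet> c)" by simp
      also have "\<dots> \<in> Z2" using D(8)[OF c(1) c(1)] by - (assumption | rule Z2I)+
      finally show ?thesis using cl(4)[of 2 c] c(1) by (simp add: M0_def)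
    qed
    then have "k \<bullet> (2 *\<^sub>R c) \<in> Z2" by (rule kM0)
    then have kc: "2 * (k \<bullet> c) \<in> Z2" by simp
    show ?thesis
    proof (cases "k \<bullet> c \<in> Z2")
      case True
      then show ?thesis using mem[OF kW True kM0] by blast
    next
      case False
      then have odd: "(2 * (k \<bullet> c) - 1) / 2 \<in> Z2" using Z2_odd_cases[OF kc] by simp
      have "k - (1 / 2) *\<^sub>R t \<in> X"
      proof (rule mem)
        show "k - (1 / 2) *\<^sub>R t \<in> W" by (rule rat_space_diff[OF W kW half[OF tW]])
        have "(2 * (k \<bullet> c) - 1) / 2 - (t \<bullet> c - c \<bullet> c) / 2 - (c \<bullet> c - 1) / 2 \<in> Z2"
          using odd CD(4)[OF c(1)] c(2) by - (assumption | rule Z2I)+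
        then show "(k - (1 / 2) *\<^sub>R t) \<bullet> c \<in> Z2" by (rule Z2_eqI) (simp add: inner_diff_left field_simps)
        fix u assume u: "u \<in> M0"
        have "k \<bullet> u - t \<bullet> u / 2 \<in> Z2" using kM0[OF u] t_even[OF u] by - (assumption | rule Z2I)+
        then show "(k - (1 / 2) *\<^sub>R t) \<bullet> u \<in> Z2" by (simp add: inner_diff_left)
      qed
      then show ?thesis by blast
    qed
  qed
  have Krep: "\<exists>x\<in>X. \<exists>e\<in>{0, 1 :: real}. k = x + (e / 2) *\<^sub>R t" if k: "k \<in> K" for k
    using Kcases[OF k]
  proof
    assume "k \<in> X"
    then show ?thesis by (intro bexI[of _ k] bexI[of _ 0]) simp_all
  next
    assume "k - (1 / 2) *\<^sub>R t \<in> X"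
    then show ?thesis by (intro bexI[of _ "k - (1 / 2) *\<^sub>R t"] bexI[of _ 1]) simp_all
  qed
  have eZ: "e \<in> Z2" if "e \<in> {0, 1 :: real}" for e using that by auto
  show K2: "2 * (k \<bullet> l) \<in> Z2" if kl: "k \<in> K" "l \<in> K" for k l
  proof -
    obtain x e where x: "x \<in> X" "e \<in> {0, 1}" "k = x + (e / 2) *\<^sub>R t" using Krep[OF kl(1)] by blast
    obtain y f where y: "y \<in> X" "f \<in> {0, 1}" "l = y + (f / 2) *\<^sub>R t" using Krep[OF kl(2)] by blast
    have "2 * (x \<bullet> y) + f * (x \<bullet> t) + e * (t \<bullet> y) + e * f * (t \<bullet> t / 2) \<in> Z2"
      using dual_pair_double[OF CD(1) x(1) y(1)] tX[OF x(1)] tX[OF y(1)] tt eZ[OF x(2)] eZ[OF y(2)] by - (assumption | rule Z2I)+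
    also have "2 * (x \<bullet> y) + f * (x \<bullet> t) + e * (t \<bullet> y) + e * f * (t \<bullet> t / 2) = 2 * (k \<bullet> l)"
      unfolding x(3) y(3) by (simp add: inner_add_left inner_add_right field_simps)
    finally show ?thesis .
  qed
  have stZ: "s \<bullet> t / 2 \<in> Z2" by (rule char_pair_s_even[OF P CD(2)])
  \<comment> \<open>The parity that \<open>u0 \<bullet> u0\<close> must have. For
    \<open>g = s / 2 + u0\<close> the condition at \<open>k = t / 2\<close> says that
    \<open>t \<bullet> u0\<close>, hence \<open>u0 \<bullet> u0\<close>, is congruent to
    \<open>r\<close> modulo 2. The vectors \<open>0\<close> and \<open>c\<close> provide both
    parities.\<close>
  define r where "r = t \<bullet> t / 2 - s \<bullet> t / 2"
  have r: "r \<in> Z2" unfolding r_def using tt stZ by - (assumption | rule Z2I)+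
  have "\<exists>u\<in>M. (u \<bullet> u - r) / 2 \<in> Z2"
  proof (cases "r / 2 \<in> Z2")
    case True
    then have "(0 \<bullet> 0 - r) / 2 \<in> Z2" using Z2I(8) by fastforce
    then show ?thesis using cl(1) by blast
  next
    case False
    then have "(r - 1) / 2 \<in> Z2" using Z2_odd_cases[OF r] by blast
    then have "(c \<bullet> c - 1) / 2 - (r - 1) / 2 \<in> Z2" using c(2) by - (assumption | rule Z2I)+
    then have "(c \<bullet> c - r) / 2 \<in> Z2" by (rule Z2_eqI) (simp add: field_simps)
    then show ?thesis using c(1) by blast
  qed
  then obtain u0 where u0: "u0 \<in> M" "(u0 \<bullet> u0 - r) / 2 \<in> Z2" by blast
  define g where "g = (1 / 2) *\<^sub>R s + u0"
  have gW: "g \<in> W" unfolding g_def using rat_spaceD(2)[OF W half[OF sW]] u0(1) D(2) by blast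
  have gX: "g \<bullet> x - x \<bullet> x \<in> Z2" if x: "x \<in> X" for x
  proof -
    have "(s \<bullet> x - 2 * (x \<bullet> x)) / 2 + u0 \<bullet> x \<in> Z2" using CD(5)[OF x] D(7)[OF x u0(1)] by - (assumption | rule Z2I)+
    then show ?thesis by (rule Z2_eqI) (simp add: g_def inner_add_left field_simps)
  qed
  have gt: "g \<bullet> t / 2 - t \<bullet> t / 4 \<in> Z2"
  proof -
    have "(t \<bullet> u0 - u0 \<bullet> u0) / 2 + (u0 \<bullet> u0 - r) / 2 \<in> Z2" using CD(4)[OF u0(1)] u0(2) by - (assumption | rule Z2I)+
    then have "(t \<bullet> u0 - r) / 2 \<in> Z2" by (rule Z2_eqI) (simp add: field_simps)
    then show ?thesis by (rule Z2_eqI) (simp add: g_def r_def inner_add_left inner_commute[of u0 t] field_simps)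
  qed
  have gK: "g \<bullet> k - k \<bullet> k \<in> Z2" if k: "k \<in> K" for k
  proof -
    obtain x e where x: "x \<in> X" "e \<in> {0, 1}" "k = x + (e / 2) *\<^sub>R t" using Krep[OF k] by blast
    have "(g \<bullet> x - x \<bullet> x) + e * (g \<bullet> t / 2 - t \<bullet> t / 4) - e * (x \<bullet> t) \<in> Z2"
      using gX[OF x(1)] gt tX[OF x(1)] eZ[OF x(2)] by - (assumption | rule Z2I)+
    also have "(g \<bullet> x - x \<bullet> x) + e * (g \<bullet> t / 2 - t \<bullet> t / 4) - e * (x \<bullet> t) = g \<bullet> k - k \<bullet> k"
      using x(2) unfolding x(3)
      by (auto simp: inner_add_left inner_add_right inner_commute[of t x] field_simps)
    finally show ?thesis .
  qed
  \<comment> \<open>The hypothesis \<open>tau\<close> supplies \<open>s \<bullet> s / 8\<close>; its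
    term \<open>t \<bullet> t / 4\<close> is cancelled by \<open>r / 2\<close>, and what remains of
    \<open>s \<bullet> t\<close> is integral.\<close>
  have gg: "g \<bullet> g / 2 \<in> Z2"
  proof -
    have su: "s \<bullet> u0 / 2 \<in> Z2" by (rule char_pair_s_even[OF P u0(1)])
    have "(t \<bullet> t + s \<bullet> s / 2 + s \<bullet> t) / 4 - s \<bullet> t / 2 + s \<bullet> u0 / 2 + (u0 \<bullet> u0 - r) / 2 \<in> Z2"
      using tau stZ su u0(2) by - (assumption | rule Z2I)+
    also have "(t \<bullet> t + s \<bullet> s / 2 + s \<bullet> t) / 4 - s \<bullet> t / 2 + s \<bullet> u0 / 2 + (u0 \<bullet> u0 - r) / 2 = g \<bullet> g / 2"
      by (simp add: g_def r_def inner_add_left inner_add_right inner_commute[of u0 s] field_simps)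
    finally show ?thesis .
  qed
  have M0K: "u \<bullet> k \<in> Z2" "k \<bullet> u \<in> Z2" if "u \<in> M0" "k \<in> K" for u k
    using dual_inD(2)[OF that(2)[unfolded K_def] that(1)] by (auto simp: inner_commute)
  have gN: "g \<bullet> k \<in> Z2" if "k \<in> N" for k
  proof -
    have "k \<in> K" "k \<bullet> k \<in> Z2" using that by (auto simp: N_def)
    then have "(g \<bullet> k - k \<bullet> k) + k \<bullet> k \<in> Z2" using Z2I(5)[OF gK] by blast
    then show ?thesis by simp
  qed
  have gL: "g \<bullet> x \<in> Z2" if "x \<in> L0" for x
  proof -
    have "x \<in> X" "x \<bullet> x \<in> Z2" using that by (auto simp: L0_def)
    then have "(g \<bullet> x - x \<bullet> x) + x \<bullet> x \<in> Z2" using Z2I(5)[OF gX] by blast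
    then show ?thesis by simp
  qed
  have gM: "g \<bullet> m \<in> Z2" if "m \<in> M" for m
  proof -
    have "(g \<bullet> m - m \<bullet> m) + m \<bullet> m \<in> Z2" using Z2I(5)[OF gX D(8)[OF that that]] that D(4) by blast
    then show ?thesis by simp
  qed
  have x0x0: "x0 \<bullet> x0 \<notin> Z2"
  proof
    assume "x0 \<bullet> x0 \<in> Z2"
    then have "2 * (x0 \<bullet> x0) / 2 \<in> Z2" by simp
    then show False using Z2_not_both x0(2) by blast
  qed
  have x02: "2 *\<^sub>R x0 \<in> M" "(2 *\<^sub>R x0) \<bullet> (2 *\<^sub>R x0) \<in> Z2"
  proof -
    show "2 *\<^sub>R x0 \<in> M" by (rule D(5)[OF x0(1)])
    then show "(2 *\<^sub>R x0) \<bullet> (2 *\<^sub>R x0) \<in> Z2" using D(8) by blast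
  qed
  \<comment> \<open>The vector \<open>x0\<close> represents the nontrivial coset of \<open>N\<close>
    in \<open>K\<close>: two half-integral norms have an integral sum, and
    \<open>2 (k \<bullet> x0)\<close> is integral.\<close>
  have near: "(k - x0) \<bullet> (k - x0) \<in> Z2" if k: "k \<in> K" "k \<bullet> k \<notin> Z2" for k
  proof -
    have a: "2 * (k \<bullet> k) \<in> Z2" "2 * (k \<bullet> x0) \<in> Z2" using K2[OF k(1) k(1)] K2[OF k(1)] x0(1) XK by blast+
    from Z2_odd_cases[OF a(1)] have "(2 * (k \<bullet> k) - 1) / 2 \<in> Z2" using k(2) by simp
    then have "(2 * (k \<bullet> k) - 1) / 2 + (2 * (x0 \<bullet> x0) - 1) / 2 + 1 - 2 * (k \<bullet> x0) \<in> Z2"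
      using x0(2) a(2) by - (assumption | rule Z2I)+
    then show ?thesis by (rule Z2_eqI) (simp add: inner_diff_left inner_diff_right inner_commute[of x0 k] field_simps)
  qed
  \<comment> \<open>Since \<open>g \<bullet> x0\<close> is congruent to
    \<open>x0 \<bullet> x0\<close> modulo 1, it is half-integral as well, and subtracting
    \<open>g\<close> repairs a half-integral product with \<open>x0\<close>.\<close>
  have glue: "(w - g) \<bullet> x0 \<in> Z2" if w: "w \<bullet> (2 *\<^sub>R x0) \<in> Z2" "w \<bullet> x0 \<notin> Z2" for w
  proof -
    have "2 * (w \<bullet> x0) \<in> Z2" using w(1) by simp
    from Z2_odd_cases[OF this] have "(2 * (w \<bullet> x0) - 1) / 2 \<in> Z2" using w(2) by simp
    then have "(2 * (w \<bullet> x0) - 1) / 2 - (2 * (x0 \<bullet> x0) - 1) / 2 - (g \<bullet> x0 - x0 \<bullet> x0) \<in> Z2"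
      using x0(2) gX[OF x0(1)] by - (assumption | rule Z2I)+
    then show ?thesis by (rule Z2_eqI) (simp add: inner_diff_left field_simps)
  qed
  \<comment> \<open>The neighbour written out. Both \<open>dual_in W N\<close> and \<open>E\<close>
    are compared with it, which gives their equality.\<close>
  define F where "F = M0 \<union> {y. y - g \<in> M0}"
  have M0cl: "(v \<in> M \<Longrightarrow> v \<bullet> v / 2 \<in> Z2 \<Longrightarrow> v \<in> M0)" for v by (simp add: M0_def)
  have N_F: "dual_in W N \<subseteq> F"
  proof
    fix w assume w: "w \<in> dual_in W N"
    have wW: "w \<in> W" and wN: "\<And>k. k \<in> N \<Longrightarrow> w \<bullet> k \<in> Z2" using dual_inD[OF w] by blast+
    have M0mem: "v \<in> M0" if v: "v \<in> W" "\<And>k. k \<in> N \<Longrightarrow> v \<bullet> k \<in> Z2" "v \<bullet> x0 \<in> Z2" for v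
    proof -
      have vK: "v \<bullet> k \<in> Z2" if k: "k \<in> K" for k
      proof (cases "k \<bullet> k \<in> Z2")
        case True
        then show ?thesis using v(2) k by (simp add: N_def)
      next
        case False
        have "k - x0 \<in> K" using Kcl(3) k XK x0(1) by blast
        then have "k - x0 \<in> N" using near[OF k False] by (simp add: N_def)
        then have "v \<bullet> (k - x0) + v \<bullet> x0 \<in> Z2" using v(2,3) by - (assumption | rule Z2I)+
        then show ?thesis by (simp add: inner_diff_right)
      qed
      have vM: "v \<in> M" by (rule D(9)[OF v(1)]) (use vK XK in blast)
      \<comment> \<open>Integrality against \<open>t / 2\<close>, which lies in \<open>K\<close>,
        forces the norm to be even.\<close>
      have "v \<bullet> ((1 / 2) *\<^sub>R t) - (t \<bullet> v - v \<bullet> v) / 2 \<in> Z2" using vK[OF t2K] CD(4)[OF vM] by - (assumption | rule Z2I)+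
      then have "v \<bullet> v / 2 \<in> Z2" by (rule Z2_eqI) (simp add: inner_commute[of v t] field_simps)
      then show ?thesis using vM M0cl by blast
    qed
    have "2 *\<^sub>R x0 \<in> N" using x02 D(4) XK by (auto simp: N_def)
    then have w2: "w \<bullet> (2 *\<^sub>R x0) \<in> Z2" by (rule wN)
    show "w \<in> F"
    proof (cases "w \<bullet> x0 \<in> Z2")
      case True
      then show ?thesis using M0mem[OF wW wN] by (simp add: F_def)
    next
      case False
      have "w - g \<in> M0"
      proof (rule M0mem)
        show "w - g \<in> W" by (rule rat_space_diff[OF W wW gW])
        show "(w - g) \<bullet> x0 \<in> Z2" by (rule glue[OF w2 False])
        fix k assume "k \<in> N"
        then have "w \<bullet> k - g \<bullet> k \<in> Z2" using wN gN by - (assumption | rule Z2I)+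
        then show "(w - g) \<bullet> k \<in> Z2" by (simp add: inner_diff_left)
      qed
      then show ?thesis by (simp add: F_def)
    qed
  qed
  have E_F: "E \<subseteq> F"
  proof
    fix y assume y: "y \<in> E"
    have yW: "y \<in> W" and yL: "\<And>x. x \<in> L0 \<Longrightarrow> y \<bullet> x \<in> Z2" and yy: "y \<bullet> y / 2 \<in> Z2"
      using y dual_inD unfolding E_def by blast+
    have Mmem: "v \<in> M" if v: "v \<in> W" "\<And>x. x \<in> L0 \<Longrightarrow> v \<bullet> x \<in> Z2" "v \<bullet> x0 \<in> Z2" for v
    proof (rule D(9)[OF v(1)])
      fix x assume x: "x \<in> X"
      show "v \<bullet> x \<in> Z2"
      proof (cases "x \<bullet> x \<in> Z2")
        case True
        then show ?thesis using v(2) x by (simp add: L0_def)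
      next
        case False
        have "x - x0 \<in> L0" using cl(7)[OF x x0(1)] near[OF subsetD[OF XK x] False] by (simp add: L0_def)
        then have "v \<bullet> (x - x0) + v \<bullet> x0 \<in> Z2" using v(2,3) by - (assumption | rule Z2I)+
        then show ?thesis by (simp add: inner_diff_right)
      qed
    qed
    have "2 *\<^sub>R x0 \<in> L0" using x02 D(4) by (auto simp: L0_def)
    then have y2: "y \<bullet> (2 *\<^sub>R x0) \<in> Z2" by (rule yL)
    show "y \<in> F"
    proof (cases "y \<bullet> x0 \<in> Z2")
      case True
      then show ?thesis using M0cl[OF Mmem[OF yW yL] yy] by (simp add: F_def)
    next
      case False
      have m: "y - g \<in> M"
      proof (rule Mmem)
        show "y - g \<in> W" by (rule rat_space_diff[OF W yW gW])
        show "(y - g) \<bullet> x0 \<in> Z2" by (rule glue[OF y2 False])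
        fix k assume "k \<in> L0"
        then have "y \<bullet> k - g \<bullet> k \<in> Z2" using yL gL by - (assumption | rule Z2I)+
        then show "(y - g) \<bullet> k \<in> Z2" by (simp add: inner_diff_left)
      qed
      have "y \<bullet> y / 2 - g \<bullet> g / 2 - g \<bullet> (y - g) \<in> Z2" using yy gg gM[OF m] by - (assumption | rule Z2I)+
      also have "y \<bullet> y / 2 - g \<bullet> g / 2 - g \<bullet> (y - g) = (y - g) \<bullet> (y - g) / 2"
        by (simp add: inner_diff_left inner_diff_right inner_commute[of y g] field_simps)
      finally show ?thesis using M0cl[OF m] by (simp add: F_def)
    qed
  qed
  have NK: "N \<subseteq> K" by (auto simp: N_def)
  have Frep: "\<exists>m\<in>M0. \<exists>e\<in>{0, 1 :: real}. y = m + e *\<^sub>R g" if "y \<in> F" for y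
    using that unfolding F_def
  proof
    assume "y \<in> M0"
    then show ?thesis by (intro bexI[of _ y] bexI[of _ 0]) simp_all
  next
    assume "y \<in> {y. y - g \<in> M0}"
    then show ?thesis by (intro bexI[of _ "y - g"] bexI[of _ 1]) simp_all
  qed
  have FW: "y \<in> W" if "y \<in> F" for y
  proof -
    obtain m e where m: "m \<in> M0" "e \<in> {0, 1}" "y = m + e *\<^sub>R g" using Frep[OF \<open>y \<in> F\<close>] by blast
    then have "m \<in> W" using M0M D(2) by blast
    then show ?thesis using m gW rat_spaceD(2)[OF W] by auto
  qed
  have F_N: "F \<subseteq> dual_in W N"
  proof (intro subsetI dual_inI FW)
    fix y k assume y: "y \<in> F" and k: "k \<in> N"
    obtain m e where m: "m \<in> M0" "e \<in> {0, 1}" "y = m + e *\<^sub>R g" using Frep[OF y] by blast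
    have "m \<bullet> k + e * (g \<bullet> k) \<in> Z2" using M0K(1)[OF m(1) subsetD[OF NK k]] gN[OF k] eZ[OF m(2)]
      by - (assumption | rule Z2I)+
    then show "y \<bullet> k \<in> Z2" unfolding m(3) by (simp add: inner_add_left)
  qed
  have F_inner: "y \<bullet> z \<in> Z2" if yz: "y \<in> F" "z \<in> F" for y z
  proof -
    obtain m e where m: "m \<in> M0" "e \<in> {0, 1}" "y = m + e *\<^sub>R g" using Frep[OF yz(1)] by blast
    obtain n f where n: "n \<in> M0" "f \<in> {0, 1}" "z = n + f *\<^sub>R g" using Frep[OF yz(2)] by blast
    have "m \<bullet> n + f * (g \<bullet> m) + e * (g \<bullet> n) + e * f * (2 * (g \<bullet> g / 2)) \<in> Z2"
      using D(8)[OF subsetD[OF M0M m(1)] subsetD[OF M0M n(1)]] gM[OF subsetD[OF M0M m(1)]]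
        gM[OF subsetD[OF M0M n(1)]] gg eZ[OF m(2)] eZ[OF n(2)] by - (assumption | rule Z2I)+
    also have "m \<bullet> n + f * (g \<bullet> m) + e * (g \<bullet> n) + e * f * (2 * (g \<bullet> g / 2)) = y \<bullet> z"
      unfolding m(3) n(3) by (simp add: inner_add_left inner_add_right inner_commute[of m g] algebra_simps)
    finally show ?thesis .
  qed
  have F_E: "F \<subseteq> E"
  proof
    fix y assume y: "y \<in> F"
    obtain m e where m: "m \<in> M0" "e \<in> {0, 1}" "y = m + e *\<^sub>R g" using Frep[OF y] by blast
    have mM: "m \<in> M" using m(1) M0M by blast
    have "y \<in> dual_in W L0"
    proof (rule dual_inI[OF FW[OF y]])
      fix x assume x: "x \<in> L0"
      then have xX: "x \<in> X" by (simp add: L0_def)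
      have "m \<bullet> x + e * (g \<bullet> x) \<in> Z2" using D(7)[OF xX mM] gL[OF x] eZ[OF m(2)] by - (assumption | rule Z2I)+
      then show "y \<bullet> x \<in> Z2" unfolding m(3) by (simp add: inner_add_left)
    qed
    moreover have "y \<bullet> y / 2 \<in> Z2"
    proof -
      have m0: "m \<bullet> m / 2 \<in> Z2" using m(1) by (simp add: M0_def)
      have "m \<bullet> m / 2 + e * (g \<bullet> m) + e * e * (g \<bullet> g / 2) \<in> Z2"
        using m0 gM[OF mM] gg eZ[OF m(2)] by - (assumption | rule Z2I)+
      also have "m \<bullet> m / 2 + e * (g \<bullet> m) + e * e * (g \<bullet> g / 2) = y \<bullet> y / 2"
        unfolding m(3) by (simp add: inner_add_left inner_add_right inner_commute[of m g] field_simps)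
      finally show ?thesis .
    qed
    ultimately show "y \<in> E" by (simp add: E_def)
  qed
  have EF: "E = F" using E_F F_E by blast
  have NF: "dual_in W N = F" using N_F F_N by blast
  show "dual_in W N = E" using EF NF by simp
  show "y \<bullet> z \<in> Z2" if "y \<in> E" "z \<in> E" for y z using F_inner that EF by blast
  show "dual_in W E = N"
  proof (intro equalityI subsetI)
    fix v assume v: "v \<in> dual_in W E"
    have vW: "v \<in> W" and vF: "\<And>y. y \<in> F \<Longrightarrow> v \<bullet> y \<in> Z2" using dual_inD[OF v] EF by blast+
    have vK: "v \<in> K" unfolding K_def by (rule dual_inI[OF vW]) (use vF in \<open>simp add: F_def\<close>)
    have "0 \<in> M0" using cl(1) by (simp add: M0_def)
    then have "v \<bullet> g \<in> Z2" by (intro vF) (simp add: F_def)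
    \<comment> \<open>On \<open>K\<close>, pairing with \<open>g\<close> equals the norm modulo 1,
      so integrality against \<open>g\<close> is integrality of the norm.\<close>
    then have "v \<bullet> g - (g \<bullet> v - v \<bullet> v) \<in> Z2" using gK[OF vK] by - (assumption | rule Z2I)+
    then have "v \<bullet> v \<in> Z2" by (simp add: inner_commute)
    then show "v \<in> N" using vK by (simp add: N_def)
  next
    fix v assume v: "v \<in> N"
    show "v \<in> dual_in W E"
    proof (rule dual_inI)
      show "v \<in> W" using v NK KW by blast
      fix y assume "y \<in> E"
      then have "y \<bullet> v \<in> Z2" using dual_inD(2)[of y W N v] v NF EF by blast
      then show "v \<bullet> y \<in> Z2" by (simp add: inner_commute)
    qed
  qed
qed

subsection \<open>Similarities and modularities\<close>

lemma similarity_inner: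
  assumes "similarity r \<sigma>"
  shows "\<sigma> x \<bullet> \<sigma> y = r * (x \<bullet> y)"
proof -
  have lin: "linear \<sigma>" and sq: "\<And>v. \<sigma> v \<bullet> \<sigma> v = r * (v \<bullet> v)" using assms by (auto simp: similarity_def)
  have "\<sigma> (x + y) \<bullet> \<sigma> (x + y) = \<sigma> x \<bullet> \<sigma> x + 2 * (\<sigma> x \<bullet> \<sigma> y) + \<sigma> y \<bullet> \<sigma> y"
    by (simp add: linear_add[OF lin] inner_add_left inner_add_right inner_commute[of "\<sigma> y" "\<sigma> x"])
  moreover have "r * ((x + y) \<bullet> (x + y)) = r * (x \<bullet> x) + 2 * (r * (x \<bullet> y)) + r * (y \<bullet> y)"
    by (simp add: inner_add_left inner_add_right inner_commute[of y x] algebra_simps)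
  ultimately show ?thesis using sq[of "x + y"] sq[of x] sq[of y] by linarith
qed

lemma similarity_inj:
  assumes "similarity r \<sigma>" "r > 0"
  shows "linear \<sigma>" "inj \<sigma>"
proof -
  show lin: "linear \<sigma>" using assms(1) by (simp add: similarity_def)
  have "v = 0" if "\<sigma> v = 0" for v
    using similarity_inner[OF assms(1), of v v] assms(2) that by simp
  then show "inj \<sigma>" using linear_injective_0[OF lin] by blast
qed

abbreviation even_part :: "'a::euclidean_space set \<Rightarrow> 'a set" where
  "even_part S \<equiv> {u \<in> S. u \<bullet> u / 2 \<in> Z2}"

abbreviation integral_part :: "'a::euclidean_space set \<Rightarrow> 'a set" where
  "integral_part S \<equiv> {u \<in> S. u \<bullet> u \<in> Z2}"

lemma Z2_odd_mult_iff: "odd m \<Longrightarrow> of_int m * z \<in> Z2 \<longleftrightarrow> z \<in> Z2"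
  using padic_ints_divide[OF two_is_prime_nat, of m z] by auto

text \<open>Even norms, integral norms and duality in \<open>W\<close> are all stable under
  multiplication of the form by an odd integer, so the construction commutes with
  \<open>\<sigma>\<close>.\<close>

lemma odd_similarity_neighbour:
  fixes W M :: "'a::euclidean_space set"
  assumes m: "odd (m::int)" and inner: "\<And>x y. \<sigma> x \<bullet> \<sigma> y = of_int m * (x \<bullet> y)"
    and W: "\<sigma> ` W = W" and M: "\<sigma> ` M = M"
  shows "\<sigma> ` dual_in W (integral_part (dual_in W (even_part M))) =
    dual_in W (integral_part (dual_in W (even_part M)))"
proof -
  have ev: "\<sigma> u \<bullet> \<sigma> u / 2 \<in> Z2 \<longleftrightarrow> u \<bullet> u / 2 \<in> Z2" for u
    using Z2_odd_mult_iff[OF m, of "u \<bullet> u / 2"] by (simp add: inner)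
  have i: "\<sigma> u \<bullet> \<sigma> v \<in> Z2 \<longleftrightarrow> u \<bullet> v \<in> Z2" for u v
    using Z2_odd_mult_iff[OF m, of "u \<bullet> v"] by (simp add: inner)
  have e: "\<sigma> ` even_part S = even_part (\<sigma> ` S)" for S using ev by blast
  have n: "\<sigma> ` integral_part S = integral_part (\<sigma> ` S)" for S using i by blast
  have d: "\<sigma> ` dual_in W S = dual_in W (\<sigma> ` S)" for S
  proof (intro equalityI subsetI)
    fix v assume "v \<in> \<sigma> ` dual_in W S"
    then obtain u where u: "u \<in> dual_in W S" "v = \<sigma> u" by blast
    have "v \<in> W" using u W dual_inD(1) by blast
    moreover have "v \<bullet> w \<in> Z2" if "w \<in> \<sigma> ` S" for w using that u dual_inD(2) i by blast
    ultimately show "v \<in> dual_in W (\<sigma> ` S)" by (rule dual_inI)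
  next
    fix v assume v: "v \<in> dual_in W (\<sigma> ` S)"
    then obtain u where u: "u \<in> W" "v = \<sigma> u" using W dual_inD(1) by blast
    have "u \<bullet> w \<in> Z2" if "w \<in> S" for w using dual_inD(2)[OF v] that u(2) i by blast
    then show "v \<in> \<sigma> ` dual_in W S" using u dual_inI by blast
  qed
  show ?thesis by (simp only: d n e M)
qed

text \<open>The form is multiplied by twice a unit of \<open>Z2\<close>. Pairing \<open>u\<close>
  with \<open>X\<close> thus amounts to pairing half of \<open>\<sigma> u\<close> with
  \<open>\<sigma>\<close> applied to \<open>X\<close>, which is \<open>M\<close>, and the dual of
  \<open>M\<close> is \<open>X\<close>.\<close>

lemma even_similarity_image:
  fixes W M X :: "'a::euclidean_space set"
  assumes P: "dual_pair W M X" and m: "odd (m::int)"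
    and inner: "\<And>x y. \<sigma> x \<bullet> \<sigma> y = 2 * of_int m * (x \<bullet> y)"
    and W: "\<sigma> ` W = W" and X: "\<sigma> ` X = M"
  shows "\<sigma> ` M = (*\<^sub>R) 2 ` X"
proof (intro equalityI subsetI)
  note D = dual_pairD[OF P]
  fix v assume "v \<in> \<sigma> ` M"
  then obtain u where u: "u \<in> M" "v = \<sigma> u" by blast
  have "(1 / 2) *\<^sub>R v \<in> X"
  proof (rule D(10))
    have "v \<in> W" using u D(2) W by blast
    then show "(1 / 2) *\<^sub>R v \<in> W" using rat_spaceD(4)[OF D(1)] by simp
    fix w assume "w \<in> M"
    then obtain y where y: "y \<in> X" "w = \<sigma> y" using X by blast
    have "of_int m * (u \<bullet> y) \<in> Z2" using D(7)[OF y(1) u(1)] Z2_odd_mult_iff[OF m] by blast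
    then show "(1 / 2) *\<^sub>R v \<bullet> w \<in> Z2" by (simp add: u(2) y(2) inner)
  qed
  moreover have "v = 2 *\<^sub>R (1 / 2) *\<^sub>R v" by simp
  ultimately show "v \<in> (*\<^sub>R) 2 ` X" by blast
next
  note D = dual_pairD[OF P]
  fix v assume "v \<in> (*\<^sub>R) 2 ` X"
  then obtain x where x: "x \<in> X" "v = 2 *\<^sub>R x" by blast
  then obtain y where y: "y \<in> X" "v = \<sigma> y" using D(5) X by blast
  have "y \<in> M"
  proof (rule D(9))
    show "y \<in> W" using y(1) D(3) by blast
    fix z assume z: "z \<in> X"
    have "2 * of_int m * (y \<bullet> z) = 2 * (x \<bullet> \<sigma> z)" using inner[of y z] x(2) y(2) by simp
    then have "of_int m * (y \<bullet> z) = x \<bullet> \<sigma> z" by simp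
    moreover have "x \<bullet> \<sigma> z \<in> Z2" using D(6)[OF x(1)] z X by blast
    ultimately show "y \<bullet> z \<in> Z2" using Z2_odd_mult_iff[OF m] by metis
  qed
  then show "v \<in> \<sigma> ` M" using y(2) by blast
qed

text \<open>If \<open>\<sigma> u = 2 x\<close>, then \<open>u\<close> has even norm exactly when
  \<open>x\<close> has integral norm, so the test vectors in \<open>M\<close> and \<open>X\<close>
  correspond. The doubling of norms also turns the integrality of \<open>k \<bullet> k\<close> into
  evenness of the norm of \<open>\<sigma> k\<close>.\<close>

lemma even_similarity_neighbour:
  fixes W M X :: "'a::euclidean_space set"
  assumes P: "dual_pair W M X" and m: "odd (m::int)"
    and inner: "\<And>x y. \<sigma> x \<bullet> \<sigma> y = 2 * of_int m * (x \<bullet> y)"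
    and W: "\<sigma> ` W = W" and X: "\<sigma> ` X = M"
  shows "\<sigma> ` integral_part (dual_in W (even_part M)) = even_part (dual_in W (integral_part X))"
proof (intro equalityI subsetI)
  note D = dual_pairD[OF P]
  have img: "\<sigma> ` M = (*\<^sub>R) 2 ` X" by (rule even_similarity_image[OF P m inner W X])
  have norms: "of_int m * (u \<bullet> u / 2) = x \<bullet> x" if "\<sigma> u = 2 *\<^sub>R x" for u x
    using inner[of u u] unfolding that by simp
  have half_norm: "\<sigma> k \<bullet> \<sigma> k / 2 = of_int m * (k \<bullet> k)" for k by (simp add: inner)
  { fix v assume "v \<in> \<sigma> ` integral_part (dual_in W (even_part M))"
    then obtain k where k: "k \<in> dual_in W (even_part M)" "k \<bullet> k \<in> Z2" "v = \<sigma> k" by blast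
    have "v \<in> dual_in W (integral_part X)"
    proof (rule dual_inI)
      show "v \<in> W" using k dual_inD(1) W by blast
      fix x assume x: "x \<in> integral_part X"
      then have "2 *\<^sub>R x \<in> \<sigma> ` M" unfolding img by blast
      then obtain u where u: "u \<in> M" "\<sigma> u = 2 *\<^sub>R x" by force
      have "x \<bullet> x \<in> Z2" using x by blast
      then have "u \<bullet> u / 2 \<in> Z2" unfolding norms[OF u(2), symmetric] Z2_odd_mult_iff[OF m] .
      then have "k \<bullet> u \<in> Z2" using dual_inD(2)[OF k(1)] u(1) by blast
      then have "of_int m * (k \<bullet> u) \<in> Z2" using Z2_odd_mult_iff[OF m] by blast
      moreover have "2 * (v \<bullet> x) = 2 * of_int m * (k \<bullet> u)" using inner[of k u] u(2) k(3) by simp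
      ultimately show "v \<bullet> x \<in> Z2" by simp
    qed
    moreover have "of_int m * (k \<bullet> k) \<in> Z2" using k(2) Z2_odd_mult_iff[OF m] by blast
    then have "v \<bullet> v / 2 \<in> Z2" unfolding k(3) half_norm .
    ultimately show "v \<in> even_part (dual_in W (integral_part X))" by blast
  next
    fix v assume v: "v \<in> even_part (dual_in W (integral_part X))"
    then have vd: "v \<in> dual_in W (integral_part X)" by blast
    obtain k where k: "k \<in> W" "v = \<sigma> k" using dual_inD(1)[OF vd] W by blast
    have "k \<in> dual_in W (even_part M)"
    proof (rule dual_inI[OF k(1)])
      fix u assume u: "u \<in> even_part M"
      then obtain x where x: "x \<in> X" "\<sigma> u = 2 *\<^sub>R x" using img by blast
      have "of_int m * (u \<bullet> u / 2) \<in> Z2" using u Z2_odd_mult_iff[OF m] by blast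
      then have "x \<bullet> x \<in> Z2" using norms[OF x(2)] by simp
      then have "v \<bullet> x \<in> Z2" using dual_inD(2)[OF vd] x(1) by blast
      moreover have "2 * of_int m * (k \<bullet> u) = 2 * (v \<bullet> x)" using inner[of k u] x(2) k(2) by simp
      then have "of_int m * (k \<bullet> u) = v \<bullet> x" by simp
      ultimately show "k \<bullet> u \<in> Z2" using Z2_odd_mult_iff[OF m] by metis
    qed
    moreover have "v \<bullet> v / 2 \<in> Z2" using v by blast
    then have "of_int m * (k \<bullet> k) \<in> Z2" unfolding k(2) half_norm .
    then have "k \<bullet> k \<in> Z2" using Z2_odd_mult_iff[OF m] by blast
    ultimately show "v \<in> \<sigma> ` integral_part (dual_in W (even_part M))" using k(2) by blast
  }
qed

section \<open>Local consequences of a modularity\<close>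

lemma dual_in_loc:
  shows "dual_in W (loc 2 L) = dual_in W L"
  using padic_inner_loc[OF two_is_prime_nat] loc_base[OF two_is_prime_nat] unfolding dual_in_def by blast

lemma modular_image:
  fixes L :: "'a::euclidean_space set"
  assumes mod: "m_modularity m L \<sigma>"
  shows "linear \<sigma>" "inj \<sigma>" "\<sigma> x \<bullet> \<sigma> y = of_nat m * (x \<bullet> y)" "\<sigma> ` rational_space L = rational_space L"
    "prime p \<Longrightarrow> \<sigma> ` local_dual {p. prime p \<and> p dvd m} p L = loc p L"
    "even m \<Longrightarrow> \<sigma> ` dual_in (rational_space L) L = loc 2 L"
    "odd m \<Longrightarrow> \<sigma> ` loc 2 L = loc 2 L"
proof -
  let ?P = "{p. prime p \<and> p dvd m}"
  have m: "m > 0" and L: "integral_lattice L" and sim: "similarity (of_nat m) \<sigma>" and im: "\<sigma> ` pi_dual ?P L = L"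
    using mod by (auto simp: m_modularity_def)
  show lin: "linear \<sigma>" and inj: "inj \<sigma>" using similarity_inj[OF sim] m by simp_all
  show "\<sigma> x \<bullet> \<sigma> y = of_nat m * (x \<bullet> y)" by (rule similarity_inner[OF sim])
  have "\<sigma> ` rational_space (pi_dual ?P L) = rational_space L"
    using rational_space_linear_image[OF lin, of "pi_dual ?P L"] im by simp
  then show "\<sigma> ` rational_space L = rational_space L" unfolding pi_dual_lattice(4)[OF L] .
  have all: "\<And>p. prime p \<Longrightarrow> \<sigma> ` local_dual ?P p L = loc p L"
    using pi_dual_image_iff_local[OF L lin inj] im by blast
  then show "prime p \<Longrightarrow> \<sigma> ` local_dual ?P p L = loc p L" by blast
  show "\<sigma> ` dual_in (rational_space L) L = loc 2 L" if "even m"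
    using all[OF two_is_prime_nat] that by (simp add: local_dual_def dual_in_def)
  show "\<sigma> ` loc 2 L = loc 2 L" if "odd m"
    using all[OF two_is_prime_nat] that by (simp add: local_dual_def)
qed

lemma dual_lattice_rational:
  fixes L :: "'a::euclidean_space set"
  assumes L: "integral_lattice L"
  shows "dual_lattice L \<subseteq> rational_space L"
proof
  fix v assume v: "v \<in> dual_lattice L"
  obtain D :: int where "D \<noteq> 0" "\<forall>v\<in>dual_lattice L. of_int D *\<^sub>R v \<in> L"
    using dual_lattice_denominator[OF L] by blast
  then show "v \<in> rational_space L" using v by (intro rational_spaceI[of D]) blast+
qed

text \<open>Reflexivity comes from biduality of the lattice itself. The modularity enters for the
  inclusion of \<open>2 X\<close> in \<open>M\<close>: it turns \<open>2 (x \<bullet> y)\<close>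
  into a product of two vectors of \<open>M\<close>.\<close>

lemma dual_pair_of_modular:
  fixes L :: "'a::euclidean_space set"
  assumes L: "integral_lattice L" and mod: "m_modularity 2 L \<sigma>"
  shows "dual_pair (rational_space L) (loc 2 L) (dual_in (rational_space L) L)"
  unfolding dual_pair_def
proof (intro conjI ballI)
  let ?W = "rational_space L" and ?M = "loc 2 L"
  let ?X = "dual_in ?W L"
  show W: "rat_space ?W" by (rule rat_space_rational_space[OF L])
  show "?X = dual_in ?W ?M" by (rule dual_in_loc[symmetric])
  have im: "\<sigma> ` ?X = ?M" by (rule modular_image(6)[OF mod]) simp
  have XM: "x \<bullet> u \<in> Z2" if "x \<in> ?X" "u \<in> ?M" for x u
    using that unfolding dual_in_loc[symmetric, of _ L] by (rule dual_inD(2))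
  have Mdual: "v \<in> ?M" if v: "v \<in> ?W" "\<And>x. x \<in> ?X \<Longrightarrow> v \<bullet> x \<in> Z2" for v
    unfolding loc_iff_dual_lattice[OF integral_latticeD(1)[OF L] two_is_prime_nat]
  proof
    fix u assume u: "u \<in> dual_lattice L"
    then have "u \<in> ?X"
      using dual_lattice_rational[OF L] padic_ints_Ints[OF two_is_prime_nat]
      by (intro dual_inI) (auto simp: dual_lattice_def)
    then show "v \<bullet> u \<in> Z2" by (rule v(2))
  qed
  show "?M = dual_in ?W ?X"
  proof (intro equalityI subsetI)
    fix v assume v: "v \<in> ?M"
    show "v \<in> dual_in ?W ?X"
    proof (rule dual_inI)
      show "v \<in> ?W" using v loc_subset_rational_space by blast
      show "v \<bullet> x \<in> Z2" if "x \<in> ?X" for x using XM[OF that v] by (simp add: inner_commute)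
    qed
  next
    fix v assume "v \<in> dual_in ?W ?X"
    then show "v \<in> ?M" using Mdual dual_inD by blast
  qed
  show "?M \<subseteq> ?X" unfolding dual_in_loc[symmetric, of _ L]
    using loc_inner_integral[OF L two_is_prime_nat] loc_subset_rational_space by (intro subsetI dual_inI) blast+
  fix x assume x: "x \<in> ?X"
  show "2 *\<^sub>R x \<in> ?M"
  proof (rule Mdual)
    show "2 *\<^sub>R x \<in> ?W" using rat_spaceD(4)[OF W _ dual_inD(1)[OF x], of 2] by simp
    fix y assume y: "y \<in> ?X"
    have "\<sigma> x \<bullet> \<sigma> y \<in> Z2" using im x y loc_inner_integral[OF L two_is_prime_nat] by blast
    then show "2 *\<^sub>R x \<bullet> y \<in> Z2" using modular_image(3)[OF mod, of x y] by simp
  qed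
qed

lemma char_pair_of_modular:
  fixes L :: "'a::euclidean_space set"
  assumes L: "integral_lattice L" and mod: "m_modularity 2 L \<sigma>"
  shows "\<exists>t s. char_pair (rational_space L) (loc 2 L) (dual_in (rational_space L) L) t s"
proof -
  let ?W = "rational_space L" and ?M = "loc 2 L"
  let ?X = "dual_in ?W L"
  have P: "dual_pair ?W ?M ?X" by (rule dual_pair_of_modular[OF L mod])
  note D = dual_pairD[OF P]
  note LD = integral_latticeD[OF L]
  have im: "\<sigma> ` ?X = ?M" by (rule modular_image(6)[OF mod]) simp
  have in2: "\<sigma> x \<bullet> \<sigma> y = 2 * (x \<bullet> y)" for x y using modular_image(3)[OF mod] by simp
  obtain B where B: "independent B" "L = zspan B" "B \<subseteq> L" using is_latticeE[OF LD(1)] by metis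
  obtain f :: "'a \<Rightarrow> real" where f: "linear f" "\<And>b. b \<in> B \<Longrightarrow> f b = b \<bullet> b"
    using linear_independent_extend[OF B(1), of "\<lambda>b. b \<bullet> b"] by blast
  define t where "t = adjoint f 1"
  have tf: "t \<bullet> x = f x" for x using adjoint_works[OF f(1), of x 1] by (simp add: t_def inner_commute)
  \<comment> \<open>Norms on an integral lattice are additive modulo 2, so the characteristic
    congruence is stable under differences. It holds on a basis by the choice of \<open>f\<close>,
    hence on all of \<open>L\<close>.\<close>
  define S where "S = {u \<in> L. t \<bullet> u \<in> \<int> \<and> (t \<bullet> u - u \<bullet> u) / 2 \<in> \<int>}"
  have "add_subgroup S" unfolding add_subgroup_def
  proof (intro conjI ballI)
    show "0 \<in> S" using add_subgroupD(1)[OF LD(2)] by (simp add: S_def)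
    fix u v assume u: "u \<in> S" and v: "v \<in> S"
    have uv: "u - v \<in> L" "u \<bullet> v \<in> \<int>" "v \<bullet> v \<in> \<int>"
      using u v add_subgroupD(2)[OF LD(2)] LD(3) by (auto simp: S_def)
    have "(t \<bullet> u - u \<bullet> u) / 2 - (t \<bullet> v - v \<bullet> v) / 2 + u \<bullet> v - v \<bullet> v \<in> \<int>"
      using u v uv by (auto simp: S_def)
    also have "(t \<bullet> u - u \<bullet> u) / 2 - (t \<bullet> v - v \<bullet> v) / 2 + u \<bullet> v - v \<bullet> v
        = (t \<bullet> (u - v) - (u - v) \<bullet> (u - v)) / 2"
      by (simp add: inner_diff_left inner_diff_right inner_commute[of v u] field_simps)
    finally show "u - v \<in> S" using u v uv(1) by (simp add: S_def inner_diff_right)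
  qed
  moreover have "B \<subseteq> S" using B(3) f(2) LD(3) by (auto simp: S_def tf)
  ultimately have LS: "L \<subseteq> S" unfolding B(2) by (rule zspan_minimal)
  obtain C where C: "finite C" "C \<subseteq> ?W" "pairwise orthogonal C" "0 \<notin> C" "span C = UNIV"
    using rational_space_orthogonal_basis[OF L] by blast
  \<comment> \<open>The functional \<open>f\<close> is only real, so the rationality of
    \<open>t\<close> is recovered from its integral products with \<open>L\<close>.\<close>
  have tW: "t \<in> ?W"
  proof (rule rat_space_orthogonal_basis_mem[OF D(1) C])
    fix c assume "c \<in> C"
    then obtain q u where q: "q \<in> \<rat>" "u \<in> L" "c = q *\<^sub>R u" using C(2) by (auto simp: rational_space_def)
    then have "t \<bullet> u \<in> \<rat>" using LS Ints_subset_Rats by (auto simp: S_def)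
    then show "t \<bullet> c \<in> \<rat>" using q by simp
  qed
  have tX: "t \<in> ?X" using LS padic_ints_Ints[OF two_is_prime_nat] by (intro dual_inI[OF tW]) (auto simp: S_def)
  have tM2: "(t \<bullet> u - u \<bullet> u) / 2 \<in> Z2" if u: "u \<in> ?M" for u
  proof -
    obtain c where c: "\<not> int 2 dvd c" "of_int c *\<^sub>R u \<in> L" using u by (rule locE)
    then have oc: "odd c" by simp
    then obtain k where k: "c = 2 * k + 1" by (rule oddE)
    have uu: "u \<bullet> u \<in> Z2" by (rule D(8)[OF u u])
    have "(t \<bullet> (of_int c *\<^sub>R u) - (of_int c *\<^sub>R u) \<bullet> (of_int c *\<^sub>R u)) / 2 \<in> \<int>"
      using LS c(2) by (auto simp: S_def)
    then have "(t \<bullet> (of_int c *\<^sub>R u) - (of_int c *\<^sub>R u) \<bullet> (of_int c *\<^sub>R u)) / 2 \<in> Z2"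
      by (rule padic_ints_Ints[OF two_is_prime_nat])
    then have "of_int c * ((t \<bullet> u - of_int c * (u \<bullet> u)) / 2) \<in> Z2"
      by (rule Z2_eqI) (simp add: field_simps)
    then have "(t \<bullet> u - of_int c * (u \<bullet> u)) / 2 \<in> Z2" using Z2_odd_mult_iff[OF oc] by blast
    then have "(t \<bullet> u - of_int c * (u \<bullet> u)) / 2 + of_int k * (u \<bullet> u) \<in> Z2" using uu by blast
    then show ?thesis by (rule Z2_eqI) (simp add: k field_simps)
  qed
  \<comment> \<open>For \<open>x\<close> in \<open>X\<close> the vector \<open>2 x\<close> lies in
    \<open>M\<close> and has norm \<open>2 (2 (x \<bullet> x))\<close>, an even number; so
    \<open>t \<bullet> (2 x)\<close> is even, that is, \<open>t \<bullet> x\<close> is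
    integral.\<close>
  have tM: "t \<in> ?M"
  proof (rule D(9)[OF tW])
    fix x assume x: "x \<in> ?X"
    have "(t \<bullet> (2 *\<^sub>R x) - (2 *\<^sub>R x) \<bullet> (2 *\<^sub>R x)) / 2 + 2 * (x \<bullet> x) \<in> Z2"
      using tM2[OF D(5)[OF x]] dual_pair_double[OF P x x] by blast
    then show "t \<bullet> x \<in> Z2" by (rule Z2_eqI) (simp add: field_simps)
  qed
  \<comment> \<open>With \<open>s = 2 x0\<close> the product \<open>s \<bullet> x\<close> equals
    \<open>t \<bullet> \<sigma> x\<close>, which is congruent modulo 2 to the norm of
    \<open>\<sigma> x\<close>, namely \<open>2 (x \<bullet> x)\<close>.\<close>
  then obtain x0 where x0: "x0 \<in> ?X" "t = \<sigma> x0" using im by blast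
  have "(2 *\<^sub>R x0 \<bullet> x - 2 * (x \<bullet> x)) / 2 \<in> Z2" if x: "x \<in> ?X" for x
  proof -
    have "\<sigma> x \<in> ?M" using x im by blast
    from tM2[OF this] show ?thesis unfolding x0(2) in2 by simp
  qed
  then have "char_pair ?W ?M ?X t (2 *\<^sub>R x0)"
    unfolding char_pair_def using P tM D(5)[OF x0(1)] tM2 by blast
  then show ?thesis by blast
qed

text \<open>The choice operator in \<open>oddity\<close> returns a genuine value only if there is
  one; a rational orthogonal basis and the residues modulo 8 of the unit parts of its norms provide
  it.\<close>

lemma has_oddity_exists:
  fixes L :: "'a::euclidean_space set"
  assumes L: "integral_lattice L"
  shows "\<exists>k. has_oddity L k"
proof -
  obtain C where C: "finite C" "C \<subseteq> rational_space L" "pairwise orthogonal C" "0 \<notin> C" "span C = UNIV"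
    using rational_space_orthogonal_basis[OF L] by blast
  have "\<exists>j a. odd a \<and> (\<exists>u. c \<bullet> c = 2 powi j * u \<and> (u - real_of_int a) / 8 \<in> Z2)" if c: "c \<in> C" for c
  proof -
    have "c \<bullet> c \<in> \<rat>" using rat_spaceD(3)[OF rat_space_rational_space[OF L]] c C(2) by blast
    moreover have "c \<bullet> c \<noteq> 0" using c C(4) by auto
    ultimately obtain j y where y: "y \<in> Z2" "c \<bullet> c = 2 powi j * (1 + 2 * y)" using Rats_unit_part by blast
    have "1 + 2 * y \<in> Z2" using y(1) by - (assumption | rule Z2I)+
    then obtain a where a: "(1 + 2 * y - of_int a) / 8 \<in> Z2" using Z2_mod_8 by blast
    have "y - 4 * ((1 + 2 * y - of_int a) / 8) \<in> Z2" using y(1) a by - (assumption | rule Z2I)+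
    then have "(real_of_int a - 1) / 2 \<in> Z2" by (rule Z2_eqI) (simp add: field_simps)
    then have "odd a" by (simp add: odd_iff_Z2)
    then show ?thesis using y(2) a by blast
  qed
  then obtain e a where ea: "\<And>c. c \<in> C \<Longrightarrow> odd (a c) \<and> (\<exists>u. c \<bullet> c = 2 powi e c * u \<and> (u - real_of_int (a c)) / 8 \<in> Z2)"
    by metis
  have "rational_orthogonal_basis L C" using C by (simp add: rational_orthogonal_basis_def)
  then show ?thesis unfolding has_oddity_def using ea by blast
qed

text \<open>The diagonalization \<open>C\<close> ties the discriminant to \<open>t\<close> and
  \<open>s\<close>, the diagonalization \<open>B\<close> ties it to the oddity. They differ by a
  rational square, so their unit parts agree modulo 4, and the second one is 1 modulo 4.\<close>

lemma modular_char_norms: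
  fixes L :: "'a::euclidean_space set"
  assumes L: "integral_lattice L" and mod: "m_modularity 2 L \<sigma>" and dim: "4 dvd DIM('a)" and odd4: "4 dvd oddity L"
    and P: "char_pair (rational_space L) (loc 2 L) (dual_in (rational_space L) L) t s"
  shows "t \<bullet> t / 2 \<in> Z2" "(t \<bullet> t + s \<bullet> s / 2 + s \<bullet> t) / 4 \<in> Z2"
proof -
  let ?W = "rational_space L" and ?M = "loc 2 L"
  let ?X = "dual_in ?W L"
  have W: "rat_space ?W" by (rule rat_space_rational_space[OF L])
  have im: "\<sigma> ` ?X = ?M" by (rule modular_image(6)[OF mod]) simp
  have im2: "\<sigma> ` ?M = (*\<^sub>R) 2 ` ?X"
    by (rule even_similarity_image[OF char_pairD(1)[OF P], of 1])
       (use modular_image[OF mod] im in simp_all)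
  have ix: "index ?M ((*\<^sub>R) 2 ` ?X) = index ?X ?M"
    using index_linear_image[OF modular_image(1,2)[OF mod], of ?X ?M] unfolding im im2 .
  obtain C p q k w where C: "finite C" "C \<subseteq> ?W" "pairwise orthogonal C" "0 \<notin> C" "?W \<subseteq> span C"
      "card C = p + q" "(\<Prod>c\<in>C. c \<bullet> c) = 2 powi k * w"
    and w: "(w - (1 - real (p + q) + (t \<bullet> t + s \<bullet> s / 2 + s \<bullet> t))) / 4 \<in> Z2"
    and pq: "(t \<bullet> t - real q) / 2 \<in> Z2" "(s \<bullet> s / 2 - real p) / 2 \<in> Z2"
      "index ?X ?M = 2 ^ p" "index ?M ((*\<^sub>R) 2 ` ?X) = 2 ^ q"
    using discriminant_data_exists[OF P] unfolding discriminant_data_def by blast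
  have "p = q" using ix pq(3,4) by simp
  obtain A where A: "span A = UNIV" "A \<subseteq> L" using is_latticeE[OF integral_latticeD(1)[OF L]] by metis
  have "A \<subseteq> span C" using A(2) C(5) rational_space_base by blast
  then have spC: "span C = UNIV" using A(1) span_minimal[of A "span C"] by auto
  have "independent C" using C(3,4) by (intro pairwise_orthogonal_independent) auto
  then have cardC: "card C = DIM('a)" using spC basis_card_eq_dim[of C UNIV] by simp
  then obtain l where l: "q = 2 * l" using dim C(6) \<open>p = q\<close> by (metis dvd_def mult_2 mult.assoc nat_mult_eq_cancel1 numeral_Bit0_eq_double pos2)
  have "(t \<bullet> t - real q) / 2 + of_int (int l) \<in> Z2" using pq(1) by - (assumption | rule Z2I)+
  then show tt: "t \<bullet> t / 2 \<in> Z2" by (rule Z2_eqI) (simp add: l field_simps)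
  have "has_oddity L (oddity L)" unfolding oddity_def using has_oddity_exists[OF L] by (rule someI_ex)
  then obtain B e a where B: "rational_orthogonal_basis L B"
    and ea: "\<forall>b\<in>B. odd (a b) \<and> (\<exists>u. b \<bullet> b = 2 powi e b * u \<and> (u - of_int (a b)) / 8 \<in> Z2)"
    and o: "oddity L = ((\<Sum>b\<in>B. a b) + 4 * int (card {b\<in>B. odd (e b) \<and> a b mod 8 \<in> {3, 5}})) mod 8"
    unfolding has_oddity_def by blast
  have B': "B \<subseteq> ?W" "pairwise orthogonal B" "0 \<notin> B" "span B = UNIV"
    using B by (auto simp: rational_orthogonal_basis_def)
  then have indB: "independent B" by (intro pairwise_orthogonal_independent) auto
  then have finB: "finite B" by (rule independent_imp_finite)
  have cardB: "card B = DIM('a)" using indB B'(4) basis_card_eq_dim[of B UNIV] by simp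
  obtain j u where u: "(\<Prod>b\<in>B. b \<bullet> b) = 2 powi j * u" "(u - 1) / 4 \<in> Z2"
    using oddity_unit_part[OF finB, of a e] ea odd4 dim unfolding cardB o by blast
  obtain r where r: "r \<in> \<rat>" "r \<noteq> 0" "(\<Prod>c\<in>C. c \<bullet> c) = r\<^sup>2 * (\<Prod>b\<in>B. b \<bullet> b)"
    using discriminant_square_class[OF W C(1-4) finB B'(1-3)] spC B'(4) by auto
  have "(w - 1) / 2 \<in> Z2"
    by (rule discriminant_unit_odd[OF w pq(1,2) char_pair_s_even[OF P char_pairD(2)[OF P]]])
  moreover have "2 * ((u - 1) / 4) \<in> Z2" using u(2) by - (assumption | rule Z2I)+
  then have "(u - 1) / 2 \<in> Z2" by (rule Z2_eqI) simp
  moreover have "2 powi k * w = r\<^sup>2 * (2 powi j * u)" using C(7) r(3) u(1) by simp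
  ultimately have wu: "(w - u) / 4 \<in> Z2" by (rule unit_square_class_mod_4[OF r(1,2)])
  have "(w - u) / 4 + (u - 1) / 4 - (w - (1 - real (p + q) + (t \<bullet> t + s \<bullet> s / 2 + s \<bullet> t))) / 4
      + of_int (int l) \<in> Z2"
    using wu u(2) w by - (assumption | rule Z2I)+
  then show "(t \<bullet> t + s \<bullet> s / 2 + s \<bullet> t) / 4 \<in> Z2"
    by (rule Z2_eqI) (simp add: \<open>p = q\<close> l field_simps)
qed

text \<open>Lattices with the same rational space and the same localization at \<open>p\<close> thus
  have the same local dual there, which settles the odd primes.\<close>

lemma local_dual_eq_loc:
  assumes "prime p"
  shows "local_dual P p M =
     (if p \<in> P then {v \<in> rational_space M. \<forall>u\<in>loc p M. v \<bullet> u \<in> padic_ints p} else loc p M)"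
proof -
  have "(\<forall>u\<in>M. v \<bullet> u \<in> padic_ints p) \<longleftrightarrow> (\<forall>u\<in>loc p M. v \<bullet> u \<in> padic_ints p)" for v
    using padic_inner_loc[OF assms, of _ M v] loc_base[OF assms, of _ M] by blast
  then show ?thesis unfolding local_dual_def by simp
qed

subsection \<open>The theorem\<close>

lemma sqrt2_double_image:
  fixes S :: "'a::real_vector set"
  shows "(*\<^sub>R) (sqrt 2) ` (*\<^sub>R) (sqrt 2) ` S = (*\<^sub>R) 2 ` S"
  unfolding image_image by (intro image_cong refl) simp

lemma loc_double:
  assumes p: "prime p" "p \<noteq> 2" and M: "add_subgroup M"
  shows "(*\<^sub>R) 2 ` loc p M = loc p M"
proof (intro equalityI subsetI)
  fix v assume "v \<in> (*\<^sub>R) 2 ` loc p M"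
  then obtain u where "u \<in> loc p M" "v = of_int 2 *\<^sub>R u" by auto
  then show "v \<in> loc p M" using add_subgroupD(4)[OF add_subgroup_loc[OF p(1) M]] by blast
next
  fix v assume v: "v \<in> loc p M"
  have nd: "\<not> int p dvd 2" using p primes_dvd_imp_eq[of p 2] two_is_prime_nat by (metis of_nat_dvd_iff of_nat_numeral)
  have "of_int 2 *\<^sub>R (1 / 2) *\<^sub>R v \<in> loc p M" using v by simp
  then have "(1 / 2) *\<^sub>R v \<in> loc p M" by (rule loc_scaleE[OF p(1) nd])
  moreover have "v = 2 *\<^sub>R (1 / 2) *\<^sub>R v" by simp
  ultimately show "v \<in> (*\<^sub>R) 2 ` loc p M" by blast
qed

lemma rational_space_double:
  assumes W: "rat_space W"
  shows "(*\<^sub>R) 2 ` W = W"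
proof (intro equalityI subsetI)
  fix v assume "v \<in> W"
  then have "(1 / 2) *\<^sub>R v \<in> W" using rat_spaceD(4)[OF W, of "1 / 2"] by simp
  moreover have "v = 2 *\<^sub>R (1 / 2) *\<^sub>R v" by simp
  ultimately show "v \<in> (*\<^sub>R) 2 ` W" by blast
next
  fix v assume "v \<in> (*\<^sub>R) 2 ` W"
  then show "v \<in> W" using rat_spaceD(4)[OF W, of 2] by auto
qed

text \<open>Scaling a lattice by \<open>sqrt 2\<close> scales its dual by \<open>1 / sqrt 2\<close>,
  which the outer factor undoes. At 2 the two rescalings in the construction of
  \<open>\<Lambda>''\<close> therefore cancel.\<close>

lemma sqrt2_dual_in:
  assumes W: "rat_space W"
  shows "(*\<^sub>R) (sqrt 2) ` dual_in ((*\<^sub>R) (sqrt 2) ` W) ((*\<^sub>R) (sqrt 2) ` N) = dual_in W N"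
proof (intro equalityI subsetI)
  fix v assume "v \<in> (*\<^sub>R) (sqrt 2) ` dual_in ((*\<^sub>R) (sqrt 2) ` W) ((*\<^sub>R) (sqrt 2) ` N)"
  then obtain x where x: "x \<in> dual_in ((*\<^sub>R) (sqrt 2) ` W) ((*\<^sub>R) (sqrt 2) ` N)" "v = sqrt 2 *\<^sub>R x" by blast
  then obtain w where w: "w \<in> W" "x = sqrt 2 *\<^sub>R w" using dual_inD(1) by blast
  have v: "v = 2 *\<^sub>R w" unfolding x(2) w(2) by simp
  show "v \<in> dual_in W N"
  proof (rule dual_inI)
    show "v \<in> W" unfolding v using rat_spaceD(4)[OF W _ w(1)] by simp
    fix k assume "k \<in> N"
    then have "x \<bullet> (sqrt 2 *\<^sub>R k) \<in> Z2" using dual_inD(2)[OF x(1)] by blast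
    then show "v \<bullet> k \<in> Z2" by (simp add: x(2))
  qed
next
  fix v assume v: "v \<in> dual_in W N"
  define x where "x = (1 / sqrt 2) *\<^sub>R v"
  have x: "v = sqrt 2 *\<^sub>R x" "x = sqrt 2 *\<^sub>R (1 / 2) *\<^sub>R v"
    unfolding x_def by (simp_all add: real_div_sqrt field_simps)
  have "x \<in> dual_in ((*\<^sub>R) (sqrt 2) ` W) ((*\<^sub>R) (sqrt 2) ` N)"
  proof (rule dual_inI)
    have "(1 / 2) *\<^sub>R v \<in> W" using rat_spaceD(4)[OF W _ dual_inD(1)[OF v], of "1 / 2"] by simp
    then show "x \<in> (*\<^sub>R) (sqrt 2) ` W" using x(2) by blast
    fix u assume "u \<in> (*\<^sub>R) (sqrt 2) ` N"
    then obtain k where k: "k \<in> N" "u = sqrt 2 *\<^sub>R k" by blast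
    have "x \<bullet> u = v \<bullet> k" unfolding k(2) x(1) by simp
    then show "x \<bullet> u \<in> Z2" using dual_inD(2)[OF v k(1)] by simp
  qed
  then show "v \<in> (*\<^sub>R) (sqrt 2) ` dual_in ((*\<^sub>R) (sqrt 2) ` W) ((*\<^sub>R) (sqrt 2) ` N)" using x(1) by blast
qed

text \<open>Checked prime by prime. At odd primes both lattices agree. At 2, a modularity of odd
  level preserves the neighbour because it preserves \<open>M\<close>; one of even level maps
  \<open>N\<close>, the dual of the neighbour, to the neighbour as described from
  \<open>X\<close>.\<close>

lemma modularity_transfer:
  fixes L L2 :: "'a::euclidean_space set"
  assumes L: "integral_lattice L" and L2: "integral_lattice L2"
    and W: "rational_space L2 = rational_space L"
    and locp: "\<And>p. prime p \<Longrightarrow> p \<noteq> 2 \<Longrightarrow> loc p L2 = loc p L"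
    and P: "dual_pair (rational_space L) (loc 2 L) (dual_in (rational_space L) L)"
    and c: "c \<in> loc 2 L" "(c \<bullet> c - 1) / 2 \<in> Z2"
    and N: "N = integral_part (dual_in (rational_space L) (even_part (loc 2 L)))"
    and E: "loc 2 L2 = dual_in (rational_space L) N"
      "loc 2 L2 = even_part (dual_in (rational_space L) (integral_part (dual_in (rational_space L) L)))"
      "dual_in (rational_space L) (loc 2 L2) = N"
    and mod: "m_modularity m L \<sigma>"
  shows "m_modularity m L2 \<sigma>"
proof -
  let ?P = "{p. prime p \<and> p dvd m}"
  note MI = modular_image[OF mod]
  have m: "m > 0" "similarity (of_nat m) \<sigma>" using mod by (auto simp: m_modularity_def)
  have "\<sigma> ` local_dual ?P p L2 = loc p L2" if p: "prime p" for p
  proof (cases "p = 2")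
    case False
    have "local_dual ?P p L2 = local_dual ?P p L"
      unfolding local_dual_eq_loc[OF p] W locp[OF p False] ..
    then show ?thesis using MI(5)[OF p] locp[OF p False] by simp
  next
    case True
    show ?thesis
    proof (cases "even m")
      case False
      then have "local_dual ?P 2 L2 = loc 2 L2" by (simp add: local_dual_def)
      moreover have "\<sigma> ` loc 2 L2 = loc 2 L2"
        unfolding E(1) N
        by (rule odd_similarity_neighbour[of "int m"]) (use False MI(3,4,7) in simp_all)
      ultimately show ?thesis using True by simp
    next
      case m2: True
      then obtain n where n: "m = 2 * n" by blast
      have im: "\<sigma> ` dual_in (rational_space L) L = loc 2 L" by (rule MI(6)[OF m2])
      obtain x where x: "x \<in> dual_in (rational_space L) L" "c = \<sigma> x" using im c(1) by blast
      \<comment> \<open>A vector of odd norm excludes that 4 divides \<open>m\<close>.\<close>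
      have "odd n"
      proof
        assume "even n"
        then obtain l where l: "n = 2 * l" by blast
        have "c \<bullet> c / 2 = of_int (int l) * (2 * (x \<bullet> x))" unfolding x(2) MI(3) n l by simp
        also have "\<dots> \<in> Z2" using dual_pair_double[OF P x(1) x(1)] Z2I(7)[OF Z2I(1)] by blast
        finally show False using Z2_not_both c(2) by blast
      qed
      then have "\<sigma> ` N = loc 2 L2" unfolding N E(2)
        by (intro even_similarity_neighbour[OF P, of "int n"]) (use MI(3,4) im n in simp_all)
      moreover have "local_dual ?P 2 L2 = N"
        using m2 unfolding E(3)[symmetric] dual_in_loc by (simp add: local_dual_def dual_in_def W)
      ultimately show ?thesis using True by simp
    qed
  qed
  then have "\<sigma> ` pi_dual ?P L2 = L2" using pi_dual_image_iff_local[OF L2 MI(1,2)] by blast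
  then show ?thesis using m L2 by (simp add: m_modularity_def)
qed

theorem theorem8:
  fixes \<Lambda> \<Lambda>' \<Lambda>'' :: "'a::euclidean_space set"
  assumes "odd_lattice \<Lambda>"
    and "\<exists>\<sigma>. m_modularity 2 \<Lambda> \<sigma>"
    and "4 dvd DIM('a)"
    and "4 dvd oddity \<Lambda>"
    and "\<Lambda>' = (\<lambda>v. sqrt 2 *\<^sub>R v) ` pi_dual {2} (even_sublattice \<Lambda>)"
    and "\<Lambda>'' = (\<lambda>v. sqrt 2 *\<^sub>R v) ` pi_dual {2} (even_sublattice \<Lambda>')"
  shows "integral_lattice \<Lambda>' \<and>
         even_lattice \<Lambda>'' \<and>
         (\<exists>\<sigma>. m_modularity 2 \<Lambda>'' \<sigma>) \<and>
         rationally_equivalent \<Lambda>'' \<Lambda> \<and>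
         (\<forall>\<sigma>. modularity \<Lambda> \<sigma> \<longrightarrow> modularity \<Lambda>'' \<sigma>)"
proof -
  obtain \<sigma> where mod: "m_modularity 2 \<Lambda> \<sigma>" using assms(2) by blast
  have L: "integral_lattice \<Lambda>" using assms(1) by (simp add: odd_lattice_def)
  note p2 = two_is_prime_nat
  define W where "W = rational_space \<Lambda>"
  define M where "M = loc 2 \<Lambda>"
  define X where "X = dual_in W \<Lambda>"
  have W: "rat_space W" unfolding W_def by (rule rat_space_rational_space[OF L])
  obtain t s where P: "char_pair W M X t s"
    using char_pair_of_modular[OF L mod] unfolding W_def M_def X_def by blast
  note D = dual_pairD[OF char_pairD(1)[OF P]]
  have norms: "t \<bullet> t / 2 \<in> Z2" "(t \<bullet> t + s \<bullet> s / 2 + s \<bullet> t) / 4 \<in> Z2"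
    using modular_char_norms[OF L mod assms(3,4)] P unfolding W_def M_def X_def by blast+
  obtain c and k :: int where c0: "c \<in> \<Lambda>" "odd k" "c \<bullet> c = of_int k"
    using assms(1) unfolding odd_lattice_def by blast
  have c: "c \<in> M" "(c \<bullet> c - 1) / 2 \<in> Z2"
    using loc_base[OF p2 c0(1)] c0(2,3) odd_iff_Z2 unfolding M_def by simp_all
  have im: "\<sigma> ` X = M" unfolding X_def W_def M_def by (rule modular_image(6)[OF mod]) simp
  \<comment> \<open>The preimage of the odd vector \<open>c\<close> is the vector of half-integral
    norm in \<open>X\<close> that the neighbour construction asks for.\<close>
  obtain x0 where x0: "x0 \<in> X" "c = \<sigma> x0" using im c(1) by blast
  have x0': "(2 * (x0 \<bullet> x0) - 1) / 2 \<in> Z2" using c(2) modular_image(3)[OF mod, of x0 x0] unfolding x0(2) by simp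
  define K where "K = dual_in W (even_part M)"
  define N where "N = integral_part K"
  \<comment> \<open>Defined in the form in which \<open>\<Lambda>''\<close> arises at 2; the
    description from \<open>X\<close> follows as \<open>E_even\<close>.\<close>
  define E where "E = dual_in W N"
  note EN = even_neighbour[OF P c x0(1) x0' norms, folded K_def N_def]
  have E_even: "E = even_part (dual_in W (integral_part X))" unfolding E_def by (rule EN(2))
  have E_dual: "dual_in W E = N" unfolding E_even by (rule EN(3))
  have E_inner: "y \<bullet> z \<in> Z2" if "y \<in> E" "z \<in> E" for y z using EN(4) that unfolding E_even by blast

  let ?r = "(*\<^sub>R) (sqrt 2) :: 'a \<Rightarrow> 'a"
  have lin: "linear ?r" by (rule linear_scaleR)
  have inj: "inj ?r" by (simp add: inj_def)
  have norm_r: "?r u \<bullet> ?r v = 2 * (u \<bullet> v)" for u v by simp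

  define A where "A = even_sublattice \<Lambda>"
  note AL = even_sublattice_lattice[OF L, folded A_def]
  define D1 where "D1 = pi_dual {2} A"
  note D1L = pi_dual_lattice[OF AL(1), of "{2}", folded D1_def]
  have L': "\<Lambda>' = ?r ` D1" unfolding assms(5) D1_def A_def ..
  \<comment> \<open>Before the factor \<open>sqrt 2\<close> is applied, the first dual is
    \<open>K\<close> at 2. Products on \<open>K\<close> are half-integral, which is why the factor
    makes \<open>\<Lambda>'\<close> integral.\<close>
  have D1_2: "loc 2 D1 = K"
  proof -
    have "loc 2 D1 = dual_in W A"
      unfolding D1_def loc_pi_dual[OF AL(1) p2] by (simp add: local_dual_def dual_in_def AL(2) W_def)
    then show ?thesis unfolding dual_in_loc[symmetric, of W A] AL(4) K_def M_def .
  qed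
  have D1_p: "loc p D1 = loc p \<Lambda>" if p: "prime p" "p \<noteq> 2" for p
    unfolding D1_def loc_pi_dual[OF AL(1) p(1)] using p(2) AL(3)[OF p] by (simp add: local_dual_def)
  have int': "integral_lattice \<Lambda>'"
    unfolding integral_lattice_def
  proof (intro conjI ballI)
    show "is_lattice \<Lambda>'" unfolding L' by (rule is_lattice_scale[OF D1L(3)]) simp
    fix u v assume "u \<in> \<Lambda>'" "v \<in> \<Lambda>'"
    then obtain x y where xy: "x \<in> D1" "y \<in> D1" "u = ?r x" "v = ?r y" unfolding L' by blast
    show "u \<bullet> v \<in> \<int>"
    proof (rule Ints_if_padic_ints)
      fix p :: nat assume p: "prime p"
      have "2 * (x \<bullet> y) \<in> padic_ints p"
      proof (cases "p = 2")
        case True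
        have "x \<in> K" "y \<in> K" using xy(1,2) loc_base[OF p2] unfolding D1_2[symmetric] by blast+
        then show ?thesis using EN(1) True by blast
      next
        case False
        have "x \<in> loc p \<Lambda>" "y \<in> loc p \<Lambda>" using xy(1,2) loc_base[OF p] unfolding D1_p[OF p False, symmetric] by blast+
        then show ?thesis using loc_inner_integral[OF L p] p by (intro padic_ints_mult) simp_all
      qed
      then show "u \<bullet> v \<in> padic_ints p" unfolding xy norm_r .
    qed
  qed

  define A' where "A' = even_sublattice \<Lambda>'"
  note AL' = even_sublattice_lattice[OF int', folded A'_def]
  define D2 where "D2 = pi_dual {2} A'"
  note D2L = pi_dual_lattice[OF AL'(1), of "{2}", folded D2_def]
  have L'': "\<Lambda>'' = ?r ` D2" unfolding assms(6) D2_def A'_def ..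
  have W': "rational_space \<Lambda>' = ?r ` W"
    unfolding L' rational_space_linear_image[OF lin] D1L(4) AL(2) W_def ..
  have A'_2: "loc 2 A' = ?r ` N"
  proof -
    \<comment> \<open>Rescaled by \<open>sqrt 2\<close>, a vector of \<open>K\<close> has even norm
      exactly when its original norm is integral; this selects \<open>N\<close>.\<close>
    have "?r u \<bullet> ?r u / 2 \<in> Z2 \<longleftrightarrow> u \<bullet> u \<in> Z2" for u unfolding norm_r by simp
    then show ?thesis unfolding AL'(4) L' loc_linear_image[OF lin inj] D1_2 N_def by blast
  qed
  have D2_2: "loc 2 D2 = dual_in (?r ` W) (?r ` N)"
  proof -
    have "loc 2 D2 = dual_in (rational_space \<Lambda>') A'"
      unfolding D2_def loc_pi_dual[OF AL'(1) p2] by (simp add: local_dual_def dual_in_def AL'(2))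
    then show ?thesis unfolding dual_in_loc[symmetric, of _ A'] A'_2 W' .
  qed
  have L''_2: "loc 2 \<Lambda>'' = E"
    unfolding L'' loc_linear_image[OF lin inj] D2_2 E_def by (rule sqrt2_dual_in[OF W])
  have L''_p: "loc p \<Lambda>'' = loc p \<Lambda>" if p: "prime p" "p \<noteq> 2" for p
  proof -
    have "loc p D2 = loc p \<Lambda>'"
      unfolding D2_def loc_pi_dual[OF AL'(1) p(1)] using p(2) AL'(3)[OF p] by (simp add: local_dual_def)
    also have "\<dots> = ?r ` loc p \<Lambda>" unfolding L' loc_linear_image[OF lin inj] D1_p[OF p] ..
    finally have "loc p \<Lambda>'' = ?r ` ?r ` loc p \<Lambda>" unfolding L'' loc_linear_image[OF lin inj] by (rule arg_cong)
    then show ?thesis unfolding sqrt2_double_image loc_double[OF p integral_latticeD(2)[OF L]] .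
  qed
  have W'': "rational_space \<Lambda>'' = W"
    unfolding L'' rational_space_linear_image[OF lin] D2L(4) AL'(2) W' sqrt2_double_image
    by (rule rational_space_double[OF W])
  have mem2: "u \<in> E" if "u \<in> \<Lambda>''" for u using loc_base[OF p2 that] unfolding L''_2 .
  have int'': "integral_lattice \<Lambda>''"
    unfolding integral_lattice_def
  proof (intro conjI ballI)
    show "is_lattice \<Lambda>''" unfolding L'' by (rule is_lattice_scale[OF D2L(3)]) simp
    fix u v assume uv: "u \<in> \<Lambda>''" "v \<in> \<Lambda>''"
    show "u \<bullet> v \<in> \<int>"
    proof (rule Ints_if_padic_ints)
      fix p :: nat assume p: "prime p"
      show "u \<bullet> v \<in> padic_ints p"
      proof (cases "p = 2")
        case True
        then show ?thesis using E_inner mem2 uv by blast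
      next
        case False
        have "u \<in> loc p \<Lambda>" "v \<in> loc p \<Lambda>" using uv loc_base[OF p] unfolding L''_p[OF p False, symmetric] by blast+
        then show ?thesis by (rule loc_inner_integral[OF L p])
      qed
    qed
  qed
  have even'': "even_lattice \<Lambda>''"
    unfolding even_lattice_def
  proof (intro conjI ballI int'')
    fix u assume u: "u \<in> \<Lambda>''"
    obtain n where n: "u \<bullet> u = of_int n" using integral_latticeD(3)[OF int'' u u] by (auto elim: Ints_cases)
    have "u \<bullet> u / 2 \<in> Z2" using mem2[OF u] unfolding E_even by blast
    then have "even n" using Z2_not_both odd_iff_Z2 unfolding n by blast
    then show "\<exists>n::int. even n \<and> u \<bullet> u = of_int n" using n by blast
  qed
  have transfer: "m_modularity m \<Lambda>'' \<tau>" if "m_modularity m \<Lambda> \<tau>" for m \<tau>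
  proof (rule modularity_transfer[OF L int'' _ L''_p _ _ c(2) _ _ _ _ that])
    show "rational_space \<Lambda>'' = rational_space \<Lambda>" using W'' W_def by simp
    show "dual_pair (rational_space \<Lambda>) (loc 2 \<Lambda>) (dual_in (rational_space \<Lambda>) \<Lambda>)"
      using char_pairD(1)[OF P] unfolding W_def M_def X_def .
    show "c \<in> loc 2 \<Lambda>" using c(1) unfolding M_def .
    show "N = integral_part (dual_in (rational_space \<Lambda>) (even_part (loc 2 \<Lambda>)))"
      unfolding N_def K_def W_def M_def ..
    show "loc 2 \<Lambda>'' = dual_in (rational_space \<Lambda>) N" unfolding L''_2 E_def W_def ..
    show "loc 2 \<Lambda>'' = even_part (dual_in (rational_space \<Lambda>) (integral_part (dual_in (rational_space \<Lambda>) \<Lambda>)))"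
      unfolding L''_2 using E_even unfolding X_def W_def .
    show "dual_in (rational_space \<Lambda>) (loc 2 \<Lambda>'') = N" unfolding L''_2 using E_dual unfolding W_def .
  qed
  \<comment> \<open>The two rational spaces coincide as sets, so the identity is an
    isometry.\<close>
  have "rationally_equivalent \<Lambda>'' \<Lambda>"
    unfolding rationally_equivalent_def using W'' W_def by (intro exI[of _ id]) simp
  then show ?thesis
    using int' even'' transfer mod unfolding modularity_def by blast
qed

end
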